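(* Let $N\ge1$, $s\in(0,1)$, $m_c:=\max\{(N-2s)/N,0\}$, $m_1=N/(N+2s)$, and $m_c<m<m_1$. Put $a=2sm/(1-m)$ and $$k(a)=2^{2s}\frac{\Gamma((N-a)/2)\,\Gamma((a+2s)/2)}{\Gamma((N-a-2s)/2)\,\Gamma(a/2)},$$ and let $C>0$ be defined by $C^{1-m}=(1-m)(-k(a))$. Then the function $$\widetilde U(x,t)=C\,t^{1/(1-m)}\,|x|^{-2s/(1-m)}$$ is a very singular solution of $\partial_tu+(-\Delta)^s(u^m)=0$: it is a weak solution with an isolated singularity at $x=0$ (a weak solution in a generalized sense).
   Context: $(-\Delta)^s$ is the fractional Laplacian with Fourier symbol $|\xi|^{2s}$; for $N-2s<a<N$ one has $(-\Delta)^s|x|^{-a}=k(a)|x|^{-a-2s}$ with $k(a)<0$. A weak solution with an isolated singularity (generalized weak solution) is a nonnegative function $u$ with $u^m$ locally integrable such that the weak formulation $\iint\big(u\,\partial_t\varphi-u^m(-\Delta)^s\varphi\big)\,dx\,dt=0$ holds for all smooth test functions $\varphi$ compactly supported in $(\mathbb{R}^N\setminus\{0\})\times(0,\infty)$ (test functions supported away from the origin); $u(\cdot,t)$ need not be integrable near $x=0$. *)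

theory Defs
  imports "HOL-Analysis.Analysis"
begin

fun Ck :: "nat \<Rightarrow> ('a::euclidean_space \<Rightarrow> real) \<Rightarrow> bool" where
  "Ck 0 f = continuous_on UNIV f"
| "Ck (Suc k) f = (\<exists>f'. (\<forall>x. (f has_derivative f' x) (at x)) \<and> (\<forall>v. Ck k (\<lambda>x. f' x v)))"

definition smooth :: "('a::euclidean_space \<Rightarrow> real) \<Rightarrow> bool" where
  "smooth f \<longleftrightarrow> (\<forall>k. Ck k f)"

definition fourier :: "('a::euclidean_space \<Rightarrow> real) \<Rightarrow> 'a \<Rightarrow> complex" where
  "fourier \<phi> \<xi> = (LINT x|lborel. cis (- (x \<bullet> \<xi>)) * complex_of_real (\<phi> x))"

text \<open>(-Delta)^s phi = inverse Fourier transform of |xi|^{2s} F phi, i.e.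
  (2 pi)^{-N} int e^{i x.xi} |xi|^{2s} F phi(xi) d xi  (real part; the value is real
  for real phi).  Used only for smooth compactly supported phi.\<close>
definition frac_lap :: "real \<Rightarrow> ('a::euclidean_space \<Rightarrow> real) \<Rightarrow> 'a \<Rightarrow> real" where
  "frac_lap s \<phi> x = Re (complex_of_real (1 / (2 * pi) ^ DIM('a)) *
      (LINT \<xi>|lborel. cis (x \<bullet> \<xi>) * complex_of_real (norm \<xi> powr (2 * s)) * fourier \<phi> \<xi>))"

definition test_fun :: "('a::euclidean_space \<times> real \<Rightarrow> real) \<Rightarrow> bool" where
  "test_fun \<phi> \<longleftrightarrow> smooth \<phi> \<and> compact (closure {p. \<phi> p \<noteq> 0}) \<and>
      closure {p. \<phi> p \<noteq> 0} \<subseteq> (UNIV - {0}) \<times> {0<..}"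

definition locally_integrable_on :: "('a::euclidean_space \<Rightarrow> real) \<Rightarrow> 'a set \<Rightarrow> bool" where
  "locally_integrable_on f S \<longleftrightarrow> (\<forall>K. compact K \<and> K \<subseteq> S \<longrightarrow> set_integrable lborel K f)"

definition gen_weak_solution ::
    "real \<Rightarrow> real \<Rightarrow> ('a::euclidean_space \<Rightarrow> real \<Rightarrow> real) \<Rightarrow> bool" where
  "gen_weak_solution s m u \<longleftrightarrow>
     (\<forall>x. \<forall>t>0. 0 \<le> u x t) \<and>
     locally_integrable_on (\<lambda>(x,t). u x t powr m) (UNIV \<times> {0<..}) \<and>
     locally_integrable_on (\<lambda>(x,t). u x t) ((UNIV - {0}) \<times> {0<..}) \<and>
     (\<forall>\<phi>. test_fun \<phi> \<longrightarrow>
        (let g = (\<lambda>(x,t). u x t * deriv (\<lambda>\<tau>. \<phi> (x,\<tau>)) t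
                          - u x t powr m * frac_lap s (\<lambda>y. \<phi> (y,t)) x)
         in set_integrable lborel (UNIV \<times> {0<..}) g \<and>
            (LINT p:UNIV \<times> {0<..}|lborel. g p) = 0))"

definition kconst :: "nat \<Rightarrow> real \<Rightarrow> real \<Rightarrow> real" where
  "kconst N s a = 2 powr (2 * s) *
     (Gamma ((real N - a) / 2) * Gamma ((a + 2 * s) / 2)) /
     (Gamma ((real N - a - 2 * s) / 2) * Gamma (a / 2))"

end

theory Submission
  imports Defs "HOL-Probability.Characteristic_Functions"
begin

text \<open>
  Since \<open>\<partial>\<^sub>t U\<close> and \<open>U\<^sup>m\<close> have the same power of \<open>t\<close>, the weak formulation reduces by an integration by
  parts in time to the identity
  \<open>\<integral> |x| powr (-a) (-\<Delta>)\<^sup>s f = k(a) \<integral> |x| powr (-a-2s) f\<close> for the time slices \<open>f\<close> of a test function,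
  which vanish near the origin.

  This identity follows by writing all powers as superpositions of Gaussians. First
  \<open>|x| powr (-a)\<close> is an average of \<open>exp (-t|x|\<^sup>2)\<close>, and the Fourier transform of a Gaussian being a
  Gaussian, the left-hand side becomes a multiple of \<open>\<integral> |\<xi>| powr (a+2s-N) F f(\<xi>) d\<xi>\<close>, that is, of
  \<open>(-\<Delta>)\<^sup>\<sigma> f(0)\<close> with \<open>\<sigma> = (a+2s-N)/2\<close>, which lies in \<open>(0,1)\<close>. Next \<open>|\<xi>| powr (2\<sigma>)\<close> is an
  average of \<open>1 - exp (-r|\<xi>|\<^sup>2)\<close>, so that \<open>(-\<Delta>)\<^sup>\<sigma> f\<close> is an average of \<open>f - exp (r\<Delta>) f\<close>. At the origin
  \<open>f\<close> vanishes, and averaging the heat kernel over \<open>r\<close> gives back \<open>|x| powr (-a-2s)\<close>.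

  The same heat representation, together with the symmetry of the Gaussian, bounds the
  \<open>L\<^sup>1\<close> norm of \<open>(-\<Delta>)\<^sup>s f\<close> by second differences of \<open>f\<close>; this and boundedness give
  the integrability against the locally integrable, bounded at infinity weight \<open>|x| powr (-a)\<close>.
\<close>

subsection \<open>Gaussian and Gamma integrals\<close>

text \<open>The weight |x|^(-a) lies in no L^p space, and (-\<Delta>)^s f is in general neither
  compactly supported nor zero near the origin, so Parseval cannot be applied to this pair directly.
  With a Gaussian in place of the weight, every interchange of integrals is an absolutely convergent
  Fubini. The second obstacle is a + 2s > N: the weight |x|^(-a-2s) is not locally integrable at the
  origin, and the multiplier |\<xi>|^(a+2s-N) that belongs to it grows instead of decaying. A
  growing power is no average of exp (-r|\<xi>|^2) with positive weight; subtracting from 1 repairs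
  this, and the subtracted constant is what the condition f(0) = 0 removes again. The integral with
  1 - exp has the value -Gamma(-\<sigma>) |\<xi>|^(2\<sigma>), so it continues Euler's integral to
  the interval (-1,0). This is the origin of the factor Gamma((N-a-2s)/2) in k(a), and of the sign
  of k(a), all other factors being positive. The restriction \<sigma> < 1 holds because a < N gives
  \<sigma> < s.\<close>

lemma gaussian_fourier_real:
  fixes t \<xi> :: real
  assumes t: "t > 0"
  shows "integrable lborel (\<lambda>x. cis (x * \<xi>) * complex_of_real (exp (- t * x\<^sup>2)))"
    and "(LINT x|lborel. cis (x * \<xi>) * complex_of_real (exp (- t * x\<^sup>2)))
       = complex_of_real (sqrt (pi / t) * exp (- \<xi>\<^sup>2 / (4 * t)))"
proof -
  \<comment> \<open>The dilation by \<open>c\<close> turns the exponent -x^2/2 of the standard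
    normal density into -t x^2, so the known characteristic function gives the claim after
    rescaling.\<close>
  define c where "c = sqrt (2 * t)"
  have c: "c > 0" "c\<^sup>2 = 2 * t" using t by (auto simp: c_def)
  define F where "F x = std_normal_density x *\<^sub>R iexp (\<xi> / c * x)" for x
  have [measurable]: "F \<in> borel_measurable borel" unfolding F_def by measurable
  have F_int: "integrable lborel F"
  proof (rule Bochner_Integration.integrable_bound[OF integrable_normal_density[of 1 0]])
    show "AE x in lborel. norm (F x) \<le> norm (std_normal_density x)"
      by (auto simp: F_def)
  qed auto
  have F_val: "integral\<^sup>L lborel F = complex_of_real (exp (- (\<xi> / c)\<^sup>2 / 2))"
    using fun_cong[OF char_std_normal_distribution, of "\<xi> / c"] unfolding char_def F_def
    by (subst (asm) integral_density) auto
  have F_c: "F (0 + c * x) = complex_of_real (1 / sqrt (2 * pi)) * (cis (x * \<xi>) * complex_of_real (exp (- t * x\<^sup>2)))" for x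
  proof -
    have "iexp (\<xi> / c * (c * x)) = cis (x * \<xi>)"
      using c by (simp add: cis_conv_exp mult.commute)
    moreover have "std_normal_density (c * x) = 1 / sqrt (2 * pi) * exp (- t * x\<^sup>2)"
      unfolding std_normal_density_def by (simp add: power_mult_distrib c)
    ultimately show ?thesis
      by (simp add: F_def scaleR_conv_of_real)
  qed
  have "integrable lborel (\<lambda>x. F (0 + c * x))"
    using F_int c by (intro lborel_integrable_real_affine) auto
  then have "integrable lborel (\<lambda>x. complex_of_real (sqrt (2 * pi)) * F (0 + c * x))"
    by (intro integrable_mult_right)
  then show 1: "integrable lborel (\<lambda>x. cis (x * \<xi>) * complex_of_real (exp (- t * x\<^sup>2)))"
    unfolding F_c by (simp flip: of_real_mult mult.assoc)
  have "complex_of_real (exp (- (\<xi> / c)\<^sup>2 / 2)) = c *\<^sub>R (LINT x|lborel. F (0 + c * x))"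
    using lborel_integral_real_affine[of c F 0] c by (simp add: F_val)
  also have "\<dots> = complex_of_real (c / sqrt (2 * pi)) * (LINT x|lborel. cis (x * \<xi>) * complex_of_real (exp (- t * x\<^sup>2)))"
    unfolding F_c by (simp add: scaleR_conv_of_real)
  finally have *: "complex_of_real (c / sqrt (2 * pi)) * (LINT x|lborel. cis (x * \<xi>) * complex_of_real (exp (- t * x\<^sup>2))) =
      complex_of_real (exp (- (\<xi> / c)\<^sup>2 / 2))" by simp
  have "sqrt (2 * pi) / c = sqrt (pi / t)"
    unfolding c_def by (simp add: real_sqrt_divide real_sqrt_mult)
  moreover have "(\<xi> / c)\<^sup>2 / 2 = \<xi>\<^sup>2 / (4 * t)"
    by (simp add: power_divide c)
  moreover have "complex_of_real (sqrt (2 * pi) / c) * (complex_of_real (c / sqrt (2 * pi)) * z) = z" for z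
    using c by simp
  ultimately show "(LINT x|lborel. cis (x * \<xi>) * complex_of_real (exp (- t * x\<^sup>2)))
       = complex_of_real (sqrt (pi / t) * exp (- \<xi>\<^sup>2 / (4 * t)))"
    using arg_cong[OF *, of "\<lambda>z. complex_of_real (sqrt (2 * pi) / c) * z"] by simp
qed

text \<open>Coordinates with respect to \<open>Basis\<close> identify Lebesgue measure with a finite
  product of one-dimensional Lebesgue measures. Gaussians and phases both factorise over
  coordinates, so this reduces their transform to dimension one.\<close>

lemma lborel_integral_prod_Basis:
  fixes f :: "'a::euclidean_space \<Rightarrow> real \<Rightarrow> 'b::{real_normed_field,banach,second_countable_topology}"
  assumes f: "\<And>b. b \<in> Basis \<Longrightarrow> integrable lborel (f b)"
  shows "integrable lborel (\<lambda>x. \<Prod>b\<in>Basis. f b (x \<bullet> b))"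
    and "(LINT x|lborel. (\<Prod>b\<in>Basis. f b (x \<bullet> b))) = (\<Prod>b\<in>Basis. integral\<^sup>L lborel (f b))"
proof -
  interpret product_sigma_finite "\<lambda>b::'a. lborel :: real measure" ..
  have [measurable]: "b \<in> Basis \<Longrightarrow> f b \<in> borel_measurable borel" for b
    using borel_measurable_integrable[OF f] by simp
  have m: "(\<lambda>x. \<Prod>b\<in>Basis. f b (x \<bullet> b)) \<in> borel_measurable borel"
    by measurable
  have e: "(\<Prod>b\<in>Basis. f b ((\<Sum>b\<in>Basis. x b *\<^sub>R b) \<bullet> b)) = (\<Prod>b\<in>Basis. f b (x b))" for x
    by (intro prod.cong) auto
  show "integrable lborel (\<lambda>x. \<Prod>b\<in>Basis. f b (x \<bullet> b))"
    apply (subst lborel_eq)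
    apply (subst integrable_distr_eq)
    using m apply (simp_all add: e)
    using product_integrable_prod[of Basis f] f by auto
  show "(LINT x|lborel. (\<Prod>b\<in>Basis. f b (x \<bullet> b))) = (\<Prod>b\<in>Basis. integral\<^sup>L lborel (f b))"
    apply (subst lborel_eq)
    apply (subst integral_distr)
    using m apply (simp_all add: e)
    using product_integral_prod[of Basis f] f by auto
qed

lemma cis_sum: "finite A \<Longrightarrow> cis (\<Sum>b\<in>A. g b) = (\<Prod>b\<in>A. cis (g b))"
  by (induction A rule: finite_induct) (auto simp flip: cis_mult)

lemma gaussian_fourier:
  fixes \<xi> :: "'a::euclidean_space"
  assumes t: "t > 0"
  shows "integrable lborel (\<lambda>x::'a. cis (x \<bullet> \<xi>) * complex_of_real (exp (- t * (norm x)\<^sup>2)))"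
    and "(LINT x|lborel. cis (x \<bullet> \<xi>) * complex_of_real (exp (- t * (norm x)\<^sup>2)))
       = complex_of_real ((pi / t) powr (real DIM('a) / 2) * exp (- (norm \<xi>)\<^sup>2 / (4 * t)))"
proof -
  define f where "f b x = cis (x * (\<xi> \<bullet> b)) * complex_of_real (exp (- t * x\<^sup>2))" for b :: 'a and x :: real
  have n: "(norm x)\<^sup>2 = (\<Sum>b\<in>Basis. (x \<bullet> b)\<^sup>2)" for x :: 'a
    using euclidean_inner[of x x] unfolding power2_norm_eq_inner by (simp add: power2_eq_square)
  have e: "(\<Prod>b\<in>Basis. f b (x \<bullet> b)) = cis (x \<bullet> \<xi>) * complex_of_real (exp (- t * (norm x)\<^sup>2))" for x
  proof -
    have "cis (x \<bullet> \<xi>) = (\<Prod>b\<in>Basis. cis ((x \<bullet> b) * (\<xi> \<bullet> b)))"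
      by (subst euclidean_inner) (simp add: cis_sum)
    moreover have "exp (- t * (norm x)\<^sup>2) = (\<Prod>b\<in>Basis. exp (- t * (x \<bullet> b)\<^sup>2))"
      unfolding n by (simp add: exp_sum sum_distrib_left flip: sum_negf)
    ultimately show ?thesis
      unfolding f_def by (simp add: prod.distrib)
  qed
  have i: "integrable lborel (f b)" for b
    unfolding f_def using gaussian_fourier_real[OF t] by auto
  show "integrable lborel (\<lambda>x::'a. cis (x \<bullet> \<xi>) * complex_of_real (exp (- t * (norm x)\<^sup>2)))"
    using lborel_integral_prod_Basis(1)[of f, OF i] unfolding e .
  have "(LINT x|lborel. cis (x \<bullet> \<xi>) * complex_of_real (exp (- t * (norm x)\<^sup>2))) = (\<Prod>b\<in>Basis. integral\<^sup>L lborel (f b))"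
    using lborel_integral_prod_Basis(2)[of f, OF i] unfolding e .
  also have "\<dots> = (\<Prod>b\<in>Basis. complex_of_real (sqrt (pi / t) * exp (- (\<xi> \<bullet> b)\<^sup>2 / (4 * t))))"
    unfolding f_def using gaussian_fourier_real[OF t] by auto
  also have "\<dots> = complex_of_real (\<Prod>b\<in>(Basis::'a set). sqrt (pi / t) * exp (- (\<xi> \<bullet> b)\<^sup>2 / (4 * t)))"
    by simp
  also have "(\<Prod>b\<in>Basis. sqrt (pi / t) * exp (- (\<xi> \<bullet> b)\<^sup>2 / (4 * t))) = sqrt (pi / t) ^ DIM('a) * exp (- (norm \<xi>)\<^sup>2 / (4 * t))"
    unfolding n by (simp add: prod.distrib sum_divide_distrib flip: sum_negf exp_sum)
  also have "sqrt (pi / t) ^ DIM('a) = (pi / t) powr (real DIM('a) / 2)"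
    using t by (simp add: powr_half_sqrt[symmetric] powr_powr flip: powr_realpow)
  finally show "(LINT x|lborel. cis (x \<bullet> \<xi>) * complex_of_real (exp (- t * (norm x)\<^sup>2)))
       = complex_of_real ((pi / t) powr (real DIM('a) / 2) * exp (- (norm \<xi>)\<^sup>2 / (4 * t)))" .
qed

lemma gaussian_integral:
  assumes t: "t > 0"
  shows "integrable lborel (\<lambda>x::'a::euclidean_space. exp (- t * (norm x)\<^sup>2))"
    and "(LINT x::'a|lborel. exp (- t * (norm x)\<^sup>2)) = (pi / t) powr (real DIM('a) / 2)"
proof -
  show *: "integrable lborel (\<lambda>x::'a. exp (- t * (norm x)\<^sup>2))"
    using gaussian_fourier(1)[OF t, of "0::'a"] integrable_Re by (fastforce simp del: of_real_exp)
  show "(LINT x::'a|lborel. exp (- t * (norm x)\<^sup>2)) = (pi / t) powr (real DIM('a) / 2)"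
    using gaussian_fourier(2)[OF t, of "0::'a"] by (simp del: of_real_exp)
qed

lemma gaussian_nn_integral:
  assumes t: "t > 0"
  shows "(\<integral>\<^sup>+x. ennreal (exp (- t * (norm (x::'a::euclidean_space))\<^sup>2)) \<partial>lborel) = ennreal ((pi / t) powr (real DIM('a) / 2))"
  using gaussian_integral[OF t, where 'a='a] by (subst nn_integral_eq_integral) auto

text \<open>Euler's integral after the dilation by \<open>l\<close>. With l = |x|^2 and p = a/2 it
  represents |x|^(-a) by Gaussians. The nonnegative integral records finiteness and value in a
  single equation, which is the form \<open>kernel_superposition\<close> asks for.\<close>

lemma nn_integral_powr_exp:
  assumes p: "p > 0" and l: "l > 0"
  shows "(\<integral>\<^sup>+t. ennreal (indicator {0<..} t * t powr (p - 1) * exp (- t * l)) \<partial>lborel) = ennreal (Gamma p * l powr (- p))"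
proof -
  define F :: "real \<Rightarrow> real" where "F t = indicator {0..} t * t powr (p - 1) / exp t" for t
  have [measurable]: "F \<in> borel_measurable borel" unfolding F_def by measurable
  have "ennreal (Gamma p) = (\<integral>\<^sup>+t. ennreal (F t) \<partial>lborel)"
    unfolding F_def by (rule Gamma_conv_nn_integral_real[OF p])
  also have "\<dots> = ennreal l * (\<integral>\<^sup>+t. ennreal (F (0 + l * t)) \<partial>lborel)"
    using l by (subst nn_integral_real_affine[where c=l and t=0]) auto
  also have "(\<integral>\<^sup>+t. ennreal (F (0 + l * t)) \<partial>lborel) =
     (\<integral>\<^sup>+t. ennreal (l powr (p - 1)) * ennreal (indicator {0<..} t * t powr (p - 1) * exp (- t * l)) \<partial>lborel)"
    using l by (intro nn_integral_cong)
      (auto simp: F_def indicator_def powr_mult exp_minus field_simps zero_le_mult_iff simp flip: ennreal_mult')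
  also have "\<dots> = ennreal (l powr (p - 1)) * (\<integral>\<^sup>+t. ennreal (indicator {0<..} t * t powr (p - 1) * exp (- t * l)) \<partial>lborel)"
    by (intro nn_integral_cmult) measurable
  also have "ennreal l * (ennreal (l powr (p - 1)) * X) = ennreal (l powr p) * X" for X
    using l by (simp add: powr_diff field_simps flip: mult.assoc ennreal_mult')
  finally have "ennreal (l powr (-p)) * ennreal (Gamma p) = ennreal (l powr (-p)) * ennreal (l powr p) *
     (\<integral>\<^sup>+t. ennreal (indicator {0<..} t * t powr (p - 1) * exp (- t * l)) \<partial>lborel)"
    by (simp add: mult.assoc)
  also have "ennreal (l powr (-p)) * ennreal (l powr p) = 1"
    using l by (simp flip: ennreal_mult' powr_add)
  finally show ?thesis
    using l p by (simp add: ennreal_mult' mult.commute)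
qed

text \<open>The substitution t -> 1/t in \<open>nn_integral_powr_exp\<close>. This form is needed
  because both the heat kernel and the transform of a Gaussian carry their parameter in the
  denominator of the exponent.\<close>

lemma nn_integral_powr_exp_inverse:
  assumes p: "p > 0" and l: "l > 0"
  shows "(\<integral>\<^sup>+t. ennreal (indicator {0<..} t * t powr (- p - 1) * exp (- l / t)) \<partial>lborel) = ennreal (Gamma p * l powr (- p))"
proof -
  define f where "f t = indicator {0<..} t * t powr (p - 1) * exp (- t * l)" for t
  define g where "g t = indicator {0<..} t * t powr (- p - 1) * exp (- l / t)" for t
  have [measurable]: "f \<in> borel_measurable borel" "g \<in> borel_measurable borel"
    unfolding f_def g_def by measurable
  have nn: "f t \<ge> 0" "g t \<ge> 0" for t by (auto simp: f_def g_def)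
  have f: "has_bochner_integral lborel f (Gamma p * l powr (- p))"
    using nn_integral_powr_exp[OF p l] p nn
    by (intro has_bochner_integral_nn_integral) (auto simp: f_def Gamma_real_pos)
  have fi: "integrable lborel f" and fv: "integral\<^sup>L lborel f = Gamma p * l powr (- p)"
    using f by (auto simp: has_bochner_integral_iff)
  have f_ind: "indicator {0<..} t * f t = f t" "indicator {0<..} t * g t = g t" for t
    by (auto simp: f_def g_def indicator_def)
  have fa: "f absolutely_integrable_on {0<..}"
    using fi by (auto simp: set_integrable_def f_ind intro: integrable_completion[THEN iffD2])
  have fv': "integral {0<..} f = Gamma p * l powr (- p)"
    using set_borel_integral_eq_integral(2)[of "{0<..}" f] fi fv
    by (simp add: set_integrable_def set_lebesgue_integral_def f_ind)
  have img: "inverse ` {0<..} = {0::real<..}"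
  proof (intro equalityI subsetI)
    fix x :: real assume "x \<in> {0<..}"
    then have "x = inverse (inverse x)" "inverse x \<in> {0<..}" by auto
    then show "x \<in> inverse ` {0<..}" by blast
  qed auto
  define h where "h t = \<bar>- (inverse t ^ Suc (Suc 0))\<bar> * f (inverse t)" for t
  have "h absolutely_integrable_on {0<..} \<and> integral {0<..} h = Gamma p * l powr (- p)"
    unfolding h_def
    by (subst has_absolute_integral_change_of_variables_1'[where g = inverse])
       (auto simp: img fa fv' inj_on_def intro!: derivative_eq_intros)
  moreover have hg: "h t = g t" if "t \<in> {0<..}" for t
  proof -
    have "t powr (- p - 1) = (1 / t)\<^sup>2 * (1 / t) powr (p - 1)"
      using that by (simp add: powr_divide powr_diff powr_minus field_simps power2_eq_square)
    then show ?thesis using that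
      by (simp add: h_def g_def f_def divide_inverse power2_eq_square mult.commute)
  qed
  moreover have "h absolutely_integrable_on {0<..} \<longleftrightarrow> g absolutely_integrable_on {0<..}"
    using hg by (intro set_integrable_cong) auto
  moreover have "integral {0<..} h = integral {0<..} g"
    using hg by (intro Henstock_Kurzweil_Integration.integral_cong) auto
  ultimately have "g absolutely_integrable_on {0<..}" "integral {0<..} g = Gamma p * l powr (- p)"
    by auto
  then have "integrable lebesgue g" "integral {0<..} g = Gamma p * l powr (- p)"
    by (auto simp: set_integrable_def f_ind)
  then have gi: "integrable lborel g" by (simp add: integrable_completion)
  have "integral\<^sup>L lborel g = Gamma p * l powr (- p)"
    using set_borel_integral_eq_integral(2)[of "{0<..}" g] gi \<open>integral {0<..} g = _\<close>
    by (simp add: set_integrable_def set_lebesgue_integral_def f_ind)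
  then have "(\<integral>\<^sup>+t. ennreal (g t) \<partial>lborel) = ennreal (Gamma p * l powr (- p))"
    using gi nn by (subst nn_integral_eq_integral) auto
  then show ?thesis unfolding g_def .
qed

text \<open>Write 1 - exp (-r l) as the integral of l exp (-u l) over 0 < u < r and exchange the
  order: the integral of r^(-q-1) over r > u is u^(-q)/q, and Euler's integral with exponent 1 - q
  remains. Here q > 0 is convergence at infinity and q < 1 convergence at 0.\<close>

lemma nn_integral_powr_one_minus_exp:
  assumes q: "0 < q" "q < 1" and l: "l \<ge> 0"
  shows "(\<integral>\<^sup>+r. ennreal (indicator {0<..} r * r powr (- q - 1) * (1 - exp (- r * l))) \<partial>lborel)
    = ennreal (Gamma (1 - q) / q * l powr q)"
proof (cases "l = 0")
  case False
  with l have l: "l > 0" by simp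
  define K where "K r u = ennreal (r powr (- q - 1)) * ennreal (l * exp (- u * l)) * indicator {u<..} r * indicator {0<..} u" for r u :: real
  have [measurable]: "(\<lambda>(r, u). K r u) \<in> borel_measurable (borel \<Otimes>\<^sub>M borel)"
  proof -
    have "K r u = (if u < r \<and> 0 < u then ennreal (r powr (- q - 1)) * ennreal (l * exp (- u * l)) else 0)" for r u
      by (auto simp: K_def indicator_def)
    then show ?thesis by simp measurable
  qed
  have 1: "(\<integral>\<^sup>+u. K r u \<partial>lborel) = ennreal (indicator {0<..} r * r powr (- q - 1) * (1 - exp (- r * l)))" for r
  proof (cases "r > 0")
    case True
    have "(\<integral>\<^sup>+u. K r u \<partial>lborel) = (\<integral>\<^sup>+u. ennreal (r powr (- q - 1)) * (ennreal (l * exp (- u * l)) * indicator {0<..<r} u) \<partial>lborel)"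
      by (intro nn_integral_cong) (auto simp: K_def indicator_def mult_ac)
    also have "\<dots> = ennreal (r powr (- q - 1)) * (\<integral>\<^sup>+u. ennreal (l * exp (- u * l)) * indicator {0<..<r} u \<partial>lborel)"
      by (intro nn_integral_cmult) measurable
    also have "(\<integral>\<^sup>+u. ennreal (l * exp (- u * l)) * indicator {0<..<r} u \<partial>lborel)
        = (\<integral>\<^sup>+u. ennreal (l * exp (- u * l)) * indicator {0..r} u \<partial>lborel)"
      by (intro nn_integral_cong_AE eventually_mono[OF eventually_conj[OF AE_lborel_singleton[of 0] AE_lborel_singleton[of r]]])
         (auto simp: indicator_def)
    also have "\<dots> = ennreal ((- exp (- r * l)) - (- exp (- 0 * l)))"
      using True l by (intro nn_integral_FTC_Icc) (auto intro!: derivative_eq_intros)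
    finally show ?thesis using True by (simp add: ennreal_mult')
  qed (auto simp: K_def indicator_def intro!: nn_integral_zero')
  have 2: "(\<integral>\<^sup>+r. K r u \<partial>lborel) = ennreal (l / q) * ennreal (indicator {0<..} u * u powr ((1 - q) - 1) * exp (- u * l))" for u
  proof (cases "u > 0")
    case True
    have "(\<integral>\<^sup>+r. K r u \<partial>lborel) = (\<integral>\<^sup>+r. ennreal (l * exp (- u * l)) * (ennreal (r powr (- q - 1)) * indicator {u<..} r) \<partial>lborel)"
      using True by (intro nn_integral_cong) (auto simp: K_def indicator_def mult_ac)
    also have "\<dots> = ennreal (l * exp (- u * l)) * (\<integral>\<^sup>+r. ennreal (r powr (- q - 1)) * indicator {u<..} r \<partial>lborel)"
      by (intro nn_integral_cmult) measurable
    also have "(\<integral>\<^sup>+r. ennreal (r powr (- q - 1)) * indicator {u<..} r \<partial>lborel) = (\<integral>\<^sup>+r. ennreal (r powr (- q - 1)) * indicator {u..} r \<partial>lborel)"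
      by (intro nn_integral_cong_AE AE_I[where N="{u}"]) (auto simp: indicator_def)
    also have "\<dots> = ennreal (0 - (- (u powr (- q)) / q))"
    proof (rule nn_integral_FTC_atLeast)
      fix x assume "u \<le> x"
      then show "((\<lambda>x. - (x powr - q) / q) has_real_derivative x powr (- q - 1)) (at x)"
        using True q by (auto intro!: derivative_eq_intros)
      show "0 \<le> x powr (- q - 1)" by simp
    next
      have "((\<lambda>x::real. x powr - q) \<longlongrightarrow> 0) at_top"
        using q by (intro tendsto_neg_powr filterlim_ident) auto
      then have "((\<lambda>x::real. - (x powr - q) / q) \<longlongrightarrow> - 0 / q) at_top"
        by (intro tendsto_intros) (use q in auto)
      then show "((\<lambda>x::real. - (x powr - q) / q) \<longlongrightarrow> 0) at_top" by simp
    qed auto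
    finally show ?thesis using True q l by (simp add: mult_ac flip: ennreal_mult')
  qed (auto simp: K_def indicator_def intro!: nn_integral_zero')
  have "(\<integral>\<^sup>+r. ennreal (indicator {0<..} r * r powr (- q - 1) * (1 - exp (- r * l))) \<partial>lborel) = (\<integral>\<^sup>+r. \<integral>\<^sup>+u. K r u \<partial>lborel \<partial>lborel)"
    by (simp add: 1)
  also have "\<dots> = (\<integral>\<^sup>+u. \<integral>\<^sup>+r. K r u \<partial>lborel \<partial>lborel)"
    by (rule lborel_pair.Fubini'[symmetric]) simp
  also have "\<dots> = ennreal (l / q) * (\<integral>\<^sup>+u. ennreal (indicator {0<..} u * u powr ((1 - q) - 1) * exp (- u * l)) \<partial>lborel)"
    unfolding 2 by (intro nn_integral_cmult) measurable
  also have "\<dots> = ennreal (l / q) * ennreal (Gamma (1 - q) * l powr (- (1 - q)))"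
    using q l by (subst nn_integral_powr_exp) auto
  also have "\<dots> = ennreal (Gamma (1 - q) / q * l powr q)"
    using q l by (simp add: powr_diff field_simps flip: ennreal_mult')
  finally show ?thesis .
qed (auto simp: indicator_def)

subsection \<open>Fourier inversion and the heat semigroup\<close>

lemma borel_measurable_cis [measurable (raw)]:
  "f \<in> borel_measurable M \<Longrightarrow> (\<lambda>x. cis (f x)) \<in> borel_measurable M"
  by (rule borel_measurable_continuous_on[of cis]) (auto intro: continuous_intros)

text \<open>Since \<open>K\<close> is nonnegative, the t-integral of |K x t h x| equals |W x h x|,
  so integrability of the weighted function alone licenses Fubini. The mass of \<open>K\<close> is
  prescribed only almost everywhere and where \<open>h\<close> is nonzero, because for negative
  powers of the norm it is infinite at the origin. The values of \<open>h\<close> may be real or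
  complex, as functions of x and of \<xi> are both treated.\<close>

lemma kernel_superposition:
  fixes K :: "'a::euclidean_space \<Rightarrow> real \<Rightarrow> real" and h :: "'a \<Rightarrow> 'b::{banach,second_countable_topology}"
  assumes K[measurable]: "(\<lambda>(x, t). K x t) \<in> borel_measurable (borel \<Otimes>\<^sub>M borel)"
    and nn: "\<And>x t. K x t \<ge> 0"
    and h[measurable]: "h \<in> borel_measurable borel"
    and W: "AE x in lborel. h x \<noteq> 0 \<longrightarrow> 0 \<le> W x \<and> (\<integral>\<^sup>+t. ennreal (K x t) \<partial>lborel) = ennreal (W x)"
    and i: "integrable lborel (\<lambda>x. W x *\<^sub>R h x)"
  shows "integrable lborel (\<lambda>t. LINT x|lborel. K x t *\<^sub>R h x)"
    and "(LINT t|lborel. LINT x|lborel. K x t *\<^sub>R h x) = (LINT x|lborel. W x *\<^sub>R h x)"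
proof -
  have AE_K: "AE x in lborel. integrable lborel (\<lambda>t. K x t *\<^sub>R h x) \<and> (LINT t|lborel. K x t *\<^sub>R h x) = W x *\<^sub>R h x
      \<and> (LINT t|lborel. norm (K x t *\<^sub>R h x)) = norm (W x *\<^sub>R h x)"
    using W
  proof eventually_elim
    case (elim x)
    show ?case
    proof (cases "h x = 0")
      case False
      then have "has_bochner_integral lborel (K x) (W x)"
        using elim nn by (intro has_bochner_integral_nn_integral) auto
      moreover have "norm (K x t *\<^sub>R h x) = K x t * norm (h x)" for t
        using nn[of x t] by simp
      ultimately show ?thesis
        using False elim nn by (auto simp: has_bochner_integral_iff)
    qed simp
  qed
  have int: "integrable (lborel \<Otimes>\<^sub>M lborel) (\<lambda>(x, t). K x t *\<^sub>R h x)"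
  proof (rule lborel_pair.Fubini_integrable)
    show "(\<lambda>(x, t). K x t *\<^sub>R h x) \<in> borel_measurable (lborel \<Otimes>\<^sub>M lborel)"
      by measurable
    have "integrable lborel (\<lambda>x. LINT t|lborel. norm (K x t *\<^sub>R h x)) \<longleftrightarrow> integrable lborel (\<lambda>x. norm (W x *\<^sub>R h x))"
    proof (rule integrable_cong_AE)
      show "(\<lambda>x. LINT t|lborel. norm (K x t *\<^sub>R h x)) \<in> borel_measurable lborel" by measurable
      show "(\<lambda>x. norm (W x *\<^sub>R h x)) \<in> borel_measurable lborel"
        using borel_measurable_integrable[OF i] by measurable
    qed (use AE_K in auto)
    then show "integrable lborel (\<lambda>x. LINT y|lborel. norm (case (x, y) of (x, t) \<Rightarrow> K x t *\<^sub>R h x))"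
      using i by (simp only: prod.case) (rule integrable_norm)
    show "AE x in lborel. integrable lborel (\<lambda>y. case (x, y) of (x, t) \<Rightarrow> K x t *\<^sub>R h x)"
      using AE_K by auto
  qed
  show "integrable lborel (\<lambda>t. LINT x|lborel. K x t *\<^sub>R h x)"
    using lborel_pair.integrable_snd[OF int] .
  have "(LINT t|lborel. LINT x|lborel. K x t *\<^sub>R h x) = (LINT x|lborel. LINT t|lborel. K x t *\<^sub>R h x)"
    using lborel_pair.Fubini_integral[OF int] .
  also have "\<dots> = (LINT x|lborel. W x *\<^sub>R h x)"
  proof (rule integral_cong_AE)
    show "(\<lambda>x. LINT t|lborel. K x t *\<^sub>R h x) \<in> borel_measurable lborel" by measurable
    show "(\<lambda>x. W x *\<^sub>R h x) \<in> borel_measurable lborel"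
      using borel_measurable_integrable[OF i] by simp
  qed (use AE_K in auto)
  finally show "(LINT t|lborel. LINT x|lborel. K x t *\<^sub>R h x) = (LINT x|lborel. W x *\<^sub>R h x)" .
qed

text \<open>\<open>(1 + |\<xi>|\<^sup>2) powr (-p)\<close> is itself a superposition of Gaussians.\<close>

lemma integrable_one_plus_norm_square_powr:
  assumes p: "p > real DIM('a::euclidean_space) / 2"
  shows "integrable lborel (\<lambda>x::'a. (1 + (norm x)\<^sup>2) powr (- p))"
proof (rule integrableI_bounded)
  have p0: "p > 0" using p by (meson divide_nonneg_pos less_le_trans of_nat_0_le_iff order.strict_trans1 zero_less_numeral)
  have G: "Gamma p \<noteq> 0" using Gamma_real_pos[OF p0] by simp
  define K where "K x t = indicator {0<..} t * t powr (p - 1) * exp (- t * (1 + (norm x)\<^sup>2))" for x :: 'a and t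
  have [measurable]: "(\<lambda>(x, t). K x t) \<in> borel_measurable (borel \<Otimes>\<^sub>M borel)"
    unfolding K_def by measurable
  have s: "1 + (norm x)\<^sup>2 > 0" for x :: 'a by (simp add: add_pos_nonneg)
  have "(\<integral>\<^sup>+x. ennreal (norm ((1 + (norm (x::'a))\<^sup>2) powr (- p))) \<partial>lborel)
     \<le> ennreal (1 / Gamma p) * (\<integral>\<^sup>+x. \<integral>\<^sup>+t. ennreal (K x t) \<partial>lborel \<partial>lborel)"
  proof (subst nn_integral_cmult[symmetric])
    show "(\<integral>\<^sup>+x. ennreal (norm ((1 + (norm (x::'a))\<^sup>2) powr (- p))) \<partial>lborel)
     \<le> (\<integral>\<^sup>+x. ennreal (1 / Gamma p) * (\<integral>\<^sup>+t. ennreal (K x t) \<partial>lborel) \<partial>lborel)"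
      unfolding K_def using p0 s G
      by (intro nn_integral_mono) (subst nn_integral_powr_exp, auto simp flip: ennreal_mult')
  qed measurable
  also have "(\<integral>\<^sup>+x. \<integral>\<^sup>+t. ennreal (K x t) \<partial>lborel \<partial>lborel) = (\<integral>\<^sup>+t. \<integral>\<^sup>+x. ennreal (K x t) \<partial>lborel \<partial>lborel)"
    by (rule lborel_pair.Fubini'[symmetric]) simp
  also have "\<dots> = (\<integral>\<^sup>+t. ennreal (pi powr (real DIM('a) / 2)) *
      ennreal (indicator {0<..} t * t powr ((p - real DIM('a) / 2) - 1) * exp (- t * 1)) \<partial>lborel)"
  proof (intro nn_integral_cong)
    fix t :: real
    show "(\<integral>\<^sup>+x. ennreal (K x t) \<partial>lborel) = ennreal (pi powr (real DIM('a) / 2)) *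
      ennreal (indicator {0<..} t * t powr ((p - real DIM('a) / 2) - 1) * exp (- t * 1))"
    proof (cases "t > 0")
      case True
      have "(\<integral>\<^sup>+x. ennreal (K x t) \<partial>lborel) = (\<integral>\<^sup>+x. ennreal (t powr (p - 1) * exp (- t)) * ennreal (exp (- t * (norm (x::'a))\<^sup>2)) \<partial>lborel)"
        using True by (intro nn_integral_cong) (simp add: K_def algebra_simps exp_diff exp_add exp_minus field_simps flip: ennreal_mult')
      also have "\<dots> = ennreal (t powr (p - 1) * exp (- t)) * ennreal ((pi / t) powr (real DIM('a) / 2))"
        using True by (subst nn_integral_cmult) (simp_all only: gaussian_nn_integral, measurable)
      also have "\<dots> = ennreal (pi powr (real DIM('a) / 2)) *
      ennreal (indicator {0<..} t * t powr ((p - real DIM('a) / 2) - 1) * exp (- t * 1))"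
      proof -
        have "p - real DIM('a) / 2 - 1 = (p - 1) - real DIM('a) / 2" by simp
        then have "t powr (p - real DIM('a) / 2 - 1) = t powr (p - 1) / t powr (real DIM('a) / 2)"
          by (simp only: powr_diff)
        then show ?thesis
          using True by (simp add: powr_divide mult_ac flip: ennreal_mult')
      qed
      finally show ?thesis .
    qed (simp add: K_def)
  qed
  also have "\<dots> = ennreal (pi powr (real DIM('a) / 2)) * ennreal (Gamma (p - real DIM('a) / 2) * 1 powr (- (p - real DIM('a) / 2)))"
    by (subst nn_integral_cmult) (use p in \<open>simp_all only: nn_integral_powr_exp diff_gt_0_iff_gt zero_less_one, auto\<close>)
  finally show "(\<integral>\<^sup>+x. ennreal (norm ((1 + (norm (x::'a))\<^sup>2) powr (- p))) \<partial>lborel) < \<infinity>"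
    by (rule order.strict_trans1) (simp add: ennreal_mult_less_top)
qed measurable

lemma integrable_one_plus_norm_square_power:
  "integrable lborel (\<lambda>x::'a::euclidean_space. 1 / (1 + (norm x)\<^sup>2) ^ DIM('a))"
proof -
  have "(1 + (norm x)\<^sup>2) powr (- real DIM('a)) = 1 / (1 + (norm x)\<^sup>2) ^ DIM('a)" for x :: 'a
    by (simp add: add_pos_nonneg powr_minus powr_realpow divide_inverse)
  then show ?thesis
    using integrable_one_plus_norm_square_powr[where 'a='a and p="real DIM('a)"] by simp
qed

text \<open>The constant \<open>M\<close> is explicit because the estimates must be uniform over the time slices
  of a test function; the last two clauses replace bounds on derivatives.\<close>

definition tame :: "real \<Rightarrow> ('a::euclidean_space \<Rightarrow> real) \<Rightarrow> bool" where
  "tame M f \<longleftrightarrow> continuous_on UNIV f \<and> (\<forall>x. M < norm x \<longrightarrow> f x = 0) \<and> (\<forall>x. \<bar>f x\<bar> \<le> M) \<and>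
     (\<forall>x v. \<bar>f (x + v) + f (x - v) - 2 * f x\<bar> \<le> M * (norm v)\<^sup>2) \<and>
     (\<forall>\<xi>. norm (fourier f \<xi>) * (1 + (norm \<xi>)\<^sup>2) ^ (DIM('a) + 1) \<le> M)"

section \<open>Integrability and Fourier bounds for \<open>tame\<close> functions\<close>

lemma tame_measurable: "tame M f \<Longrightarrow> f \<in> borel_measurable borel"
  by (auto simp: tame_def intro: borel_measurable_continuous_onI)

lemma tame_nonneg: "tame M f \<Longrightarrow> M \<ge> 0"
  unfolding tame_def by (meson abs_ge_zero order_trans)

text \<open>The radius M + 1 leaves room for shifts by vectors of length at most 1, so that the same
  volume constant serves in \<open>tame_second_difference\<close>.\<close>

lemma tame_nn_integral:
  assumes f: "tame M (f :: 'a::euclidean_space \<Rightarrow> real)"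
  shows "(\<integral>\<^sup>+x. ennreal \<bar>f x\<bar> \<partial>lborel) \<le> ennreal M * emeasure lborel (cball (0::'a) (M + 1))"
proof -
  have "(\<integral>\<^sup>+x. ennreal \<bar>f x\<bar> \<partial>lborel) \<le> (\<integral>\<^sup>+x. ennreal M * indicator (cball (0::'a) (M + 1)) x \<partial>lborel)"
  proof (rule nn_integral_mono)
    fix x :: 'a
    have "\<bar>f x\<bar> \<le> M" "norm x > M \<Longrightarrow> f x = 0" using f by (auto simp: tame_def)
    then show "ennreal \<bar>f x\<bar> \<le> ennreal M * indicator (cball 0 (M + 1)) x"
      by (cases "norm x > M") (auto simp: indicator_def intro: ennreal_leI)
  qed
  then show ?thesis by (subst (asm) nn_integral_cmult_indicator) auto
qed

lemma tame_integrable: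
  assumes f: "tame M (f :: 'a::euclidean_space \<Rightarrow> real)"
  shows "integrable lborel f"
proof (rule integrableI_bounded)
  have "emeasure lborel (cball (0::'a) (M + 1)) < \<infinity>" by (rule emeasure_lborel_cball_finite)
  then show "(\<integral>\<^sup>+x. ennreal (norm (f x)) \<partial>lborel) < \<infinity>"
    using tame_nn_integral[OF f] by (auto simp: ennreal_mult_less_top intro: order.strict_trans1)
qed (use tame_measurable[OF f] in measurable)

text \<open>The function as well as the frequency may depend on the parameter \<open>w\<close>. This
  is what later makes the fractional Laplacian of a time slice jointly measurable in space and
  time.\<close>

lemma fourier_measurable [measurable (raw)]:
  assumes [measurable]: "(\<lambda>(w, y). \<phi> w y) \<in> borel_measurable (N \<Otimes>\<^sub>M borel)" "g \<in> borel_measurable N"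
  shows "(\<lambda>w. fourier (\<phi> w) (g w :: 'a::euclidean_space)) \<in> borel_measurable N"
  unfolding fourier_def by measurable

text \<open>Of the N + 1 powers of 1 + |\<xi>|^2 in \<open>tame\<close>, one pays for a multiplier
  of quadratic growth; the other N exceed N/2 and leave an integrable majorant.\<close>

lemma tame_fourier_bound:
  assumes f: "tame M (f :: 'a::euclidean_space \<Rightarrow> real)"
  shows "(1 + (norm \<xi>)\<^sup>2) * norm (fourier f \<xi>) \<le> M / (1 + (norm \<xi>)\<^sup>2) ^ DIM('a)"
proof -
  have "(1 + (norm \<xi>)\<^sup>2) ^ DIM('a) > 0" by (simp add: add_pos_nonneg)
  moreover have "norm (fourier f \<xi>) * (1 + (norm \<xi>)\<^sup>2) ^ (DIM('a) + 1) \<le> M"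
    using f unfolding tame_def by blast
  ultimately show ?thesis by (simp add: field_simps)
qed

text \<open>One majorant covers all multipliers that occur: phases, Gaussians, and powers of |\<xi>|
  with exponent between 0 and 2. The bound depends on \<open>f\<close> only through
  \<open>M\<close>, hence is the same for all time slices.\<close>

lemma tame_fourier_integrable:
  assumes f: "tame M (f :: 'a::euclidean_space \<Rightarrow> real)"
    and g[measurable]: "g \<in> borel_measurable borel" and le: "\<And>\<xi>. norm (g \<xi>) \<le> 1 + (norm \<xi>)\<^sup>2"
  shows "integrable lborel (\<lambda>\<xi>. (g \<xi> :: complex) * fourier f \<xi>)"
    and "(LINT \<xi>|lborel. norm (g \<xi> * fourier f \<xi>)) \<le> M * (LINT x|lborel. 1 / (1 + (norm (x::'a))\<^sup>2) ^ DIM('a))"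
proof -
  note [measurable] = tame_measurable[OF f]
  have i: "integrable lborel (\<lambda>x::'a. M * (1 / (1 + (norm x)\<^sup>2) ^ DIM('a)))"
    using integrable_one_plus_norm_square_power by (rule integrable_mult_right)
  have le': "norm (g \<xi> * fourier f \<xi>) \<le> M * (1 / (1 + (norm \<xi>)\<^sup>2) ^ DIM('a))" for \<xi>
  proof -
    have "norm (g \<xi> * fourier f \<xi>) \<le> (1 + (norm \<xi>)\<^sup>2) * norm (fourier f \<xi>)"
      unfolding norm_mult by (intro mult_right_mono le) auto
    then show ?thesis using tame_fourier_bound[OF f, of \<xi>] by simp
  qed
  show 1: "integrable lborel (\<lambda>\<xi>. g \<xi> * fourier f \<xi>)"
    by (rule Bochner_Integration.integrable_bound[OF i]) (use le' tame_nonneg[OF f] in auto)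
  have "(LINT \<xi>|lborel. norm (g \<xi> * fourier f \<xi>)) \<le> (LINT x|lborel. M * (1 / (1 + (norm (x::'a))\<^sup>2) ^ DIM('a)))"
    using 1 i le' by (intro integral_mono) auto
  then show "(LINT \<xi>|lborel. norm (g \<xi> * fourier f \<xi>)) \<le> M * (LINT x|lborel. 1 / (1 + (norm (x::'a))\<^sup>2) ^ DIM('a))"
    by (simp only: integral_mult_right_zero)
qed

lemma powr_le_one_plus_square:
  assumes "0 \<le> p" "p \<le> 2" "0 \<le> (x::real)" shows "x powr p \<le> 1 + x\<^sup>2"
proof (cases "x \<le> 1")
  case True
  then have "x powr p \<le> 1" using assms by (simp add: powr_le1)
  then show ?thesis by (smt (verit) zero_le_power2)
next
  case False
  then have "x powr p \<le> x powr 2" using assms by (intro powr_mono) auto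
  then show ?thesis using False by simp
qed

text \<open>This is exp (r \<Delta>), defined by its kernel and not by the multiplier exp
  (-r|\<xi>|^2), because at the origin it is the kernel that is averaged over r. The multiplier form
  is \<open>heat_fourier\<close>.\<close>

definition heat :: "real \<Rightarrow> ('a::euclidean_space \<Rightarrow> real) \<Rightarrow> 'a \<Rightarrow> real" where
  "heat r f x = (4 * pi * r) powr (- real DIM('a) / 2) * (LINT y|lborel. f y * exp (- (norm (x - y))\<^sup>2 / (4 * r)))"

text \<open>After Fubini the inner integral is the transform of a Gaussian at x - y. The Gaussian
  supplies all the decay in \<xi>, so \<open>f\<close> in L^1 suffices and no knowledge of
  \<open>fourier f\<close> enters; this is what allows the lemma to be used for the inversion
  formula.\<close>

lemma heat_fourier:
  assumes f: "integrable lborel (f :: 'a::euclidean_space \<Rightarrow> real)" and r: "r > 0"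
  shows "(LINT \<xi>|lborel. cis (x \<bullet> \<xi>) * complex_of_real (exp (- r * (norm \<xi>)\<^sup>2)) * fourier f \<xi>)
    = complex_of_real ((2 * pi) ^ DIM('a) * heat r f x)"
proof -
  have [measurable]: "f \<in> borel_measurable borel" using f by auto
  define F where "F \<xi> y = cis ((x - y) \<bullet> \<xi>) * complex_of_real (exp (- r * (norm \<xi>)\<^sup>2)) * complex_of_real (f y)" for \<xi> y
  have nF: "norm (F \<xi> y) = exp (- r * (norm \<xi>)\<^sup>2) * \<bar>f y\<bar>" for \<xi> y
    unfolding F_def by (simp add: norm_mult)
  have F_eq: "F \<xi> y = (cis (x \<bullet> \<xi>) * complex_of_real (exp (- r * (norm \<xi>)\<^sup>2))) * (cis (- (y \<bullet> \<xi>)) * complex_of_real (f y))" for \<xi> y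
    unfolding F_def diff_conv_add_uminus[of x] inner_add_left cis_mult[symmetric] by simp
  have [measurable]: "(\<lambda>(\<xi>, y). F \<xi> y) \<in> borel_measurable (borel \<Otimes>\<^sub>M borel)"
    unfolding F_def by measurable
  have int: "integrable (lborel \<Otimes>\<^sub>M lborel) (\<lambda>(\<xi>, y). F \<xi> y)"
  proof (rule lborel_pair.Fubini_integrable)
    show "integrable lborel (\<lambda>\<xi>. LINT y|lborel. norm (case (\<xi>, y) of (\<xi>, y) \<Rightarrow> F \<xi> y))"
      using gaussian_integral(1)[OF r, where 'a='a] by (simp add: nF)
    have "integrable lborel (F \<xi>)" for \<xi>
      using f unfolding F_def by (intro Bochner_Integration.integrable_bound[OF integrable_mult_right[OF f, of "exp (- r * (norm \<xi>)\<^sup>2)"]])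
        (auto simp: norm_mult abs_mult)
    then show "AE \<xi> in lborel. integrable lborel (\<lambda>y. case (\<xi>, y) of (\<xi>, y) \<Rightarrow> F \<xi> y)"
      by simp
  qed measurable
  have "(LINT \<xi>|lborel. cis (x \<bullet> \<xi>) * complex_of_real (exp (- r * (norm \<xi>)\<^sup>2)) * fourier f \<xi>) = (LINT \<xi>|lborel. LINT y|lborel. F \<xi> y)"
    unfolding fourier_def F_eq
    by (simp add: inner_diff_left mult_ac flip: integral_mult_right_zero cis_mult cis_divide)
  also have "\<dots> = (LINT y|lborel. LINT \<xi>|lborel. F \<xi> y)"
    using lborel_pair.Fubini_integral[OF int] by simp
  also have "\<dots> = (LINT y|lborel. complex_of_real ((pi / r) powr (real DIM('a) / 2) * (f y * exp (- (norm (x - y))\<^sup>2 / (4 * r)))))"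
    unfolding F_def
    by (intro Bochner_Integration.integral_cong refl)
       (subst integral_mult_left_zero, subst inner_commute, subst gaussian_fourier(2)[OF r], simp)
  also have "\<dots> = complex_of_real ((pi / r) powr (real DIM('a) / 2) * (LINT y|lborel. f y * exp (- (norm (x - y))\<^sup>2 / (4 * r))))"
    by (simp only: integral_complex_of_real integral_mult_right_zero)
  also have "(pi / r) powr (real DIM('a) / 2) = (2 * pi) ^ DIM('a) * (4 * pi * r) powr (- real DIM('a) / 2)"
  proof -
    have "((2 * pi)\<^sup>2) powr (real DIM('a) / 2) = ((2 * pi) powr 2) powr (real DIM('a) / 2)"
      by simp
    also have "\<dots> = (2 * pi) ^ DIM('a)"
      unfolding powr_powr by (simp add: powr_realpow)
    finally have "(2 * pi) ^ DIM('a) = ((2 * pi)\<^sup>2) powr (real DIM('a) / 2)" ..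
    moreover have "(4 * pi * r) powr (- real DIM('a) / 2) = (1 / (4 * pi * r)) powr (real DIM('a) / 2)"
      using r by (simp add: powr_minus_divide powr_divide)
    moreover have "(2 * pi)\<^sup>2 * (1 / (4 * pi * r)) = pi / r"
      by (simp add: power2_eq_square)
    ultimately show ?thesis
      using r by (simp flip: powr_mult)
  qed
  finally show ?thesis by (simp add: heat_def mult.assoc)
qed

section \<open>Gaussian averages and the inversion formula\<close>

lemma lborel_integral_affine:
  fixes f :: "'a::euclidean_space \<Rightarrow> real"
  assumes c: "c \<noteq> 0" and [measurable]: "f \<in> borel_measurable borel"
  shows "(LINT y|lborel. f y) = \<bar>c\<bar> ^ DIM('a) * (LINT z|lborel. f (x + c *\<^sub>R z))"
proof -
  have "(LINT y|lborel. f y) = (LINT y|density (distr lborel borel (\<lambda>z. x + c *\<^sub>R z)) (\<lambda>_. ennreal (\<bar>c\<bar> ^ DIM('a))). f y)"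
    using c by (subst lborel_affine[of c x]) (auto simp: ennreal_power)
  also have "\<dots> = \<bar>c\<bar> ^ DIM('a) * (LINT z|lborel. f (x + c *\<^sub>R z))"
    using c by (subst integral_density) (auto simp: integral_distr)
  finally show ?thesis .
qed

text \<open>The substitution y = x + c z makes the Gaussian independent of r, so that the limit r ->
  0 acts on the argument of \<open>f\<close> only. The hypothesis fixes just the square of
  \<open>c\<close>: both signs are admissible, and their combination produces second differences in
  \<open>heat_difference_pointwise\<close>.\<close>

lemma heat_average:
  assumes [measurable]: "f \<in> borel_measurable borel" and r: "r > 0" and c: "c\<^sup>2 = 4 * r"
  shows "heat r f (x :: 'a::euclidean_space)
    = pi powr (- real DIM('a) / 2) * (LINT z|lborel. f (x + c *\<^sub>R z) * exp (- (norm z)\<^sup>2))"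
proof -
  have c0: "c \<noteq> 0" using c r by auto
  have "(LINT y|lborel. f y * exp (- (norm (x - y))\<^sup>2 / (4 * r))) =
     \<bar>c\<bar> ^ DIM('a) * (LINT z|lborel. f (x + c *\<^sub>R z) * exp (- (norm (x - (x + c *\<^sub>R z)))\<^sup>2 / (4 * r)))"
    using c0 by (intro lborel_integral_affine) auto
  also have "(\<lambda>z. - (norm (x - (x + c *\<^sub>R z)))\<^sup>2 / (4 * r)) = (\<lambda>z. - (norm z)\<^sup>2)"
    using r c by (simp add: power_mult_distrib fun_eq_iff)
  also have "\<bar>c\<bar> ^ DIM('a) = (4 * r) powr (real DIM('a) / 2)"
  proof -
    have "\<bar>c\<bar> = (4 * r) powr (1 / 2)" using r by (simp add: powr_half_sqrt flip: c)
    then show ?thesis using r by (simp add: powr_powr flip: powr_realpow)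
  qed
  finally show ?thesis
    unfolding heat_def using r
    by (simp add: powr_mult powr_minus field_simps)
qed

lemma tame_gaussian_average_integrable:
  assumes f: "tame M (f :: 'a::euclidean_space \<Rightarrow> real)"
  shows "integrable lborel (\<lambda>z. f (x + c *\<^sub>R z) * exp (- (norm z)\<^sup>2))"
proof (rule Bochner_Integration.integrable_bound)
  note [measurable] = tame_measurable[OF f]
  show "integrable lborel (\<lambda>z::'a. M * exp (- (norm z)\<^sup>2))"
    using gaussian_integral(1)[of 1, where 'a='a] by simp
  show "AE z in lborel. norm (f (x + c *\<^sub>R z) * exp (- (norm z)\<^sup>2)) \<le> norm (M * exp (- (norm z)\<^sup>2))"
    using f tame_nonneg[OF f] by (auto simp: tame_def abs_mult)
qed (use tame_measurable[OF f] in measurable)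

lemma heat_tendsto:
  assumes f: "tame M (f :: 'a::euclidean_space \<Rightarrow> real)"
  shows "(\<lambda>n. heat (1 / real (Suc n)) f x) \<longlonglongrightarrow> f x"
proof -
  note [measurable] = tame_measurable[OF f]
  define c where "c n = 2 * sqrt (1 / real (Suc n))" for n
  have c: "c \<longlonglongrightarrow> 0"
  proof -
    have "(\<lambda>n. 2 * sqrt (1 / real (Suc n))) \<longlonglongrightarrow> 2 * sqrt 0"
      using LIMSEQ_inverse_real_of_nat by (intro tendsto_intros) (simp add: divide_inverse)
    then show ?thesis unfolding c_def by simp
  qed
  have "(\<lambda>n. LINT z|lborel. f (x + c n *\<^sub>R z) * exp (- (norm z)\<^sup>2)) \<longlonglongrightarrow> (LINT z|lborel. f x * exp (- (norm (z::'a))\<^sup>2))"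
  proof (rule integral_dominated_convergence[where w="\<lambda>z. M * exp (- (norm z)\<^sup>2)"])
    show "integrable lborel (\<lambda>z::'a. M * exp (- (norm z)\<^sup>2))"
      using gaussian_integral(1)[of 1, where 'a='a] by simp
    show "AE z in lborel. (\<lambda>n. f (x + c n *\<^sub>R z) * exp (- (norm z)\<^sup>2)) \<longlonglongrightarrow> f x * exp (- (norm z)\<^sup>2)"
    proof (intro AE_I2 tendsto_intros)
      fix z :: 'a
      have "(\<lambda>n. x + c n *\<^sub>R z) \<longlonglongrightarrow> x + 0 *\<^sub>R z" using c by (intro tendsto_intros)
      moreover have "isCont f x" using f by (auto simp: tame_def continuous_on_eq_continuous_at)
      ultimately show "(\<lambda>n. f (x + c n *\<^sub>R z)) \<longlonglongrightarrow> f x"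
        using isCont_tendsto_compose[of x f "\<lambda>n. x + c n *\<^sub>R z" sequentially] by simp
    qed
    show "AE z in lborel. norm (f (x + c n *\<^sub>R z) * exp (- (norm z)\<^sup>2)) \<le> M * exp (- (norm z)\<^sup>2)" for n
      using f by (auto simp: tame_def abs_mult)
  qed measurable
  then have "(\<lambda>n. pi powr (- real DIM('a) / 2) * (LINT z|lborel. f (x + c n *\<^sub>R z) * exp (- (norm z)\<^sup>2)))
     \<longlonglongrightarrow> pi powr (- real DIM('a) / 2) * (LINT z|lborel. f x * exp (- (norm (z::'a))\<^sup>2))"
    by (intro tendsto_intros)
  moreover have "pi powr (- real DIM('a) / 2) * (LINT z|lborel. f x * exp (- (norm (z::'a))\<^sup>2)) = f x"
    using gaussian_integral(2)[of 1, where 'a='a] by (simp add: powr_minus)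
  moreover have "heat (1 / real (Suc n)) f x = pi powr (- real DIM('a) / 2) * (LINT z|lborel. f (x + c n *\<^sub>R z) * exp (- (norm z)\<^sup>2))" for n
    by (intro heat_average) (auto simp: c_def power_mult_distrib)
  ultimately show ?thesis by (simp only:)
qed

text \<open>Gaussian regularisation: one sequence has two limits. On the frequency side dominated
  convergence, with majorant |\<open>fourier f\<close>|, removes the factor exp (-r|\<xi>|^2); on
  the space side the same sequence consists of heat averages, which converge to
  \<open>f x\<close>.\<close>

lemma fourier_inversion:
  assumes f: "tame M (f :: 'a::euclidean_space \<Rightarrow> real)"
  shows "(LINT \<xi>|lborel. cis (x \<bullet> \<xi>) * fourier f \<xi>) = complex_of_real ((2 * pi) ^ DIM('a) * f x)"
proof (rule LIMSEQ_unique)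
  note [measurable] = tame_measurable[OF f]
  define r where "r n = 1 / real (Suc n)" for n
  have r: "r \<longlonglongrightarrow> 0"
    unfolding r_def using LIMSEQ_inverse_real_of_nat by (simp add: divide_inverse)
  have r_pos: "r n > 0" for n by (simp add: r_def)
  define s where "s n = (LINT \<xi>|lborel. cis (x \<bullet> \<xi>) * complex_of_real (exp (- r n * (norm \<xi>)\<^sup>2)) * fourier f \<xi>)" for n
  show "s \<longlonglongrightarrow> (LINT \<xi>|lborel. cis (x \<bullet> \<xi>) * fourier f \<xi>)"
    unfolding s_def
  proof (rule integral_dominated_convergence[where w="\<lambda>\<xi>. norm (fourier f \<xi>)"])
    have "integrable lborel (\<lambda>\<xi>. 1 * fourier f \<xi>)"
      by (rule tame_fourier_integrable[OF f]) auto
    then show "integrable lborel (\<lambda>\<xi>. norm (fourier f \<xi>))" by simp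
    show "AE \<xi> in lborel. (\<lambda>n. cis (x \<bullet> \<xi>) * complex_of_real (exp (- r n * (norm \<xi>)\<^sup>2)) * fourier f \<xi>) \<longlonglongrightarrow> cis (x \<bullet> \<xi>) * fourier f \<xi>"
    proof (rule AE_I2)
      fix \<xi> :: 'a
      have "(\<lambda>n. cis (x \<bullet> \<xi>) * complex_of_real (exp (- r n * (norm \<xi>)\<^sup>2)) * fourier f \<xi>) \<longlonglongrightarrow>
        cis (x \<bullet> \<xi>) * complex_of_real (exp (- 0 * (norm \<xi>)\<^sup>2)) * fourier f \<xi>"
        by (intro tendsto_intros r)
      then show "(\<lambda>n. cis (x \<bullet> \<xi>) * complex_of_real (exp (- r n * (norm \<xi>)\<^sup>2)) * fourier f \<xi>) \<longlonglongrightarrow> cis (x \<bullet> \<xi>) * fourier f \<xi>"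
        by simp
    qed
    show "AE \<xi> in lborel. norm (cis (x \<bullet> \<xi>) * complex_of_real (exp (- r n * (norm \<xi>)\<^sup>2)) * fourier f \<xi>) \<le> norm (fourier f \<xi>)" for n
      using r_pos[of n] by (intro AE_I2) (auto simp: norm_mult intro!: mult_left_le_one_le)
  qed measurable
  have "s = (\<lambda>n. complex_of_real ((2 * pi) ^ DIM('a) * heat (r n) f x))"
    unfolding s_def fun_eq_iff by (intro allI heat_fourier[OF tame_integrable[OF f] r_pos])
  then show "s \<longlonglongrightarrow> complex_of_real ((2 * pi) ^ DIM('a) * f x)"
    using tendsto_of_real[OF tendsto_mult_left[OF heat_tendsto[OF f, of x]]] by (simp only: r_def)
qed

subsection \<open>The fractional Laplacian as an average of heat differences\<close>

lemma heat_measurable [measurable (raw)]: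
  assumes [measurable]: "f \<in> borel_measurable borel" "r \<in> borel_measurable N" "x \<in> borel_measurable N"
  shows "(\<lambda>w. heat (r w) f (x w :: 'a::euclidean_space)) \<in> borel_measurable N"
  unfolding heat_def by measurable

text \<open>The semigroup formula for fractional powers, with \<sigma>/Gamma(1-\<sigma>) =
  -1/Gamma(-\<sigma>). It is used for two exponents: for s itself, to estimate the L^1 norm, and for
  (a+2s-N)/2, to evaluate at the origin.\<close>

lemma frac_lap_heat:
  assumes f: "tame M (f :: 'a::euclidean_space \<Rightarrow> real)" and \<sigma>: "0 < \<sigma>" "\<sigma> < 1"
  shows "frac_lap \<sigma> f x =
    \<sigma> / Gamma (1 - \<sigma>) * (LINT r|lborel. indicator {0<..} r * r powr (- \<sigma> - 1) * (f x - heat r f x))"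
proof -
  note [measurable] = tame_measurable[OF f]
  define K where "K \<xi> r = indicator {0<..} r * r powr (- \<sigma> - 1) * (1 - exp (- r * (norm \<xi>)\<^sup>2))" for \<xi> :: 'a and r
  define h where "h \<xi> = cis (x \<bullet> \<xi>) * fourier f \<xi>" for \<xi>
  define W where "W \<xi> = Gamma (1 - \<sigma>) / \<sigma> * norm \<xi> powr (2 * \<sigma>)" for \<xi> :: 'a
  have G: "Gamma (1 - \<sigma>) > 0" using \<sigma> by (intro Gamma_real_pos) auto
  then have G0: "Gamma (1 - \<sigma>) \<noteq> 0" by (metis less_irrefl)
  have sq: "((norm \<xi>)\<^sup>2) powr \<sigma> = norm \<xi> powr (2 * \<sigma>)" for \<xi> :: 'a
    by (cases "\<xi> = 0") (simp_all add: powr_powr flip: powr_numeral)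
  have [measurable]: "h \<in> borel_measurable borel" unfolding h_def by measurable
  have nW: "W \<xi> *\<^sub>R h \<xi> = complex_of_real (Gamma (1 - \<sigma>) / \<sigma>) * (cis (x \<bullet> \<xi>) * complex_of_real (norm \<xi> powr (2 * \<sigma>)) * fourier f \<xi>)" for \<xi>
    by (simp add: W_def h_def scaleR_conv_of_real mult_ac)
  have iW: "integrable lborel (\<lambda>\<xi>. cis (x \<bullet> \<xi>) * complex_of_real (norm \<xi> powr (2 * \<sigma>)) * fourier f \<xi>)"
    using \<sigma> by (intro tame_fourier_integrable[OF f]) (auto simp: norm_mult intro!: powr_le_one_plus_square)
  have "(LINT r|lborel. LINT \<xi>|lborel. K \<xi> r *\<^sub>R h \<xi>) = (LINT \<xi>|lborel. W \<xi> *\<^sub>R h \<xi>)"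
  proof (rule kernel_superposition(2))
    show "(\<lambda>(\<xi>, r). K \<xi> r) \<in> borel_measurable (borel \<Otimes>\<^sub>M borel)"
      unfolding K_def by measurable
    show "K \<xi> r \<ge> 0" for \<xi> r unfolding K_def by (auto simp: indicator_def)
    show "AE \<xi> in lborel. h \<xi> \<noteq> 0 \<longrightarrow> 0 \<le> W \<xi> \<and> (\<integral>\<^sup>+r. ennreal (K \<xi> r) \<partial>lborel) = ennreal (W \<xi>)"
      unfolding K_def nn_integral_powr_one_minus_exp[OF \<sigma> zero_le_power2] sq W_def using \<sigma> G by simp
    show "integrable lborel (\<lambda>\<xi>. W \<xi> *\<^sub>R h \<xi>)"
      unfolding nW using iW by (rule integrable_mult_right)
  qed measurable
  also have "(\<lambda>r. LINT \<xi>|lborel. K \<xi> r *\<^sub>R h \<xi>) =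
    (\<lambda>r. complex_of_real ((2 * pi) ^ DIM('a) * (indicator {0<..} r * r powr (- \<sigma> - 1) * (f x - heat r f x))))"
  proof (rule ext)
    fix r :: real
    show "(LINT \<xi>|lborel. K \<xi> r *\<^sub>R h \<xi>) = complex_of_real ((2 * pi) ^ DIM('a) * (indicator {0<..} r * r powr (- \<sigma> - 1) * (f x - heat r f x)))"
    proof (cases "r > 0")
      case True
      have i1: "integrable lborel h"
        unfolding h_def by (intro tame_fourier_integrable[OF f]) auto
      have i2: "integrable lborel (\<lambda>\<xi>. cis (x \<bullet> \<xi>) * complex_of_real (exp (- r * (norm \<xi>)\<^sup>2)) * fourier f \<xi>)"
        using True by (intro tame_fourier_integrable[OF f]) (auto simp: norm_mult intro: order_trans[of _ 1])
      have "(LINT \<xi>|lborel. K \<xi> r *\<^sub>R h \<xi>) = (LINT \<xi>|lborel. complex_of_real (r powr (- \<sigma> - 1)) *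
          (h \<xi> - cis (x \<bullet> \<xi>) * complex_of_real (exp (- r * (norm \<xi>)\<^sup>2)) * fourier f \<xi>))"
        using True by (intro Bochner_Integration.integral_cong) (auto simp: K_def h_def scaleR_conv_of_real algebra_simps)
      also have "\<dots> = complex_of_real (r powr (- \<sigma> - 1)) * (complex_of_real ((2 * pi) ^ DIM('a) * f x) - complex_of_real ((2 * pi) ^ DIM('a) * heat r f x))"
        using fourier_inversion[OF f, of x] heat_fourier[OF tame_integrable[OF f] True, of x]
        unfolding h_def by (subst integral_mult_right_zero, subst Bochner_Integration.integral_diff[OF i1[unfolded h_def] i2]) simp
      finally show ?thesis using True by (simp add: algebra_simps)
    qed (simp add: K_def)
  qed
  also have "(LINT r|lborel. complex_of_real ((2 * pi) ^ DIM('a) * (indicator {0<..} r * r powr (- \<sigma> - 1) * (f x - heat r f x)))) =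
      complex_of_real ((2 * pi) ^ DIM('a) * (LINT r|lborel. indicator {0<..} r * r powr (- \<sigma> - 1) * (f x - heat r f x)))"
    by (simp only: integral_complex_of_real integral_mult_right_zero)
  also have "(LINT \<xi>|lborel. W \<xi> *\<^sub>R h \<xi>) = complex_of_real (Gamma (1 - \<sigma>) / \<sigma>) *
      (LINT \<xi>|lborel. cis (x \<bullet> \<xi>) * complex_of_real (norm \<xi> powr (2 * \<sigma>)) * fourier f \<xi>)"
    unfolding nW by (rule integral_mult_right_zero)
  finally have *: "complex_of_real (Gamma (1 - \<sigma>) / \<sigma>) *
      (LINT \<xi>|lborel. cis (x \<bullet> \<xi>) * complex_of_real (norm \<xi> powr (2 * \<sigma>)) * fourier f \<xi>) =
      complex_of_real ((2 * pi) ^ DIM('a) * (LINT r|lborel. indicator {0<..} r * r powr (- \<sigma> - 1) * (f x - heat r f x)))" by simp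
  define I where "I = (LINT \<xi>|lborel. cis (x \<bullet> \<xi>) * complex_of_real (norm \<xi> powr (2 * \<sigma>)) * fourier f \<xi>)"
  define L where "L = (LINT r|lborel. indicator {0<..} r * r powr (- \<sigma> - 1) * (f x - heat r f x))"
  have re: "Re (complex_of_real a * z) = a * Re z" for a z by simp
  have "Gamma (1 - \<sigma>) / \<sigma> * Re I = (2 * pi) ^ DIM('a) * L"
    using arg_cong[OF *, of Re] unfolding I_def[symmetric] L_def[symmetric] re Re_complex_of_real .
  then have "Re I = (2 * pi) ^ DIM('a) * (\<sigma> / Gamma (1 - \<sigma>) * L)"
    using G0 \<sigma> by (simp add: field_simps)
  then have "1 / (2 * pi) ^ DIM('a) * Re I = \<sigma> / Gamma (1 - \<sigma>) * L"
    by simp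
  moreover have "frac_lap \<sigma> f x = 1 / (2 * pi) ^ DIM('a) * Re I"
    unfolding frac_lap_def I_def[symmetric] re ..
  ultimately show ?thesis unfolding L_def by simp
qed

lemma frac_lap_bounded:
  assumes f: "tame M (f :: 'a::euclidean_space \<Rightarrow> real)" and \<sigma>: "0 \<le> \<sigma>" "\<sigma> \<le> 1"
  shows "\<bar>frac_lap \<sigma> f x\<bar> \<le> M * (LINT x|lborel. 1 / (1 + (norm (x::'a))\<^sup>2) ^ DIM('a))"
proof -
  define I where "I = (LINT \<xi>|lborel. cis (x \<bullet> \<xi>) * complex_of_real (norm \<xi> powr (2 * \<sigma>)) * fourier f \<xi>)"
  have "\<bar>frac_lap \<sigma> f x\<bar> \<le> norm (complex_of_real (1 / (2 * pi) ^ DIM('a)) * I)"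
    unfolding frac_lap_def I_def[symmetric] by (rule abs_Re_le_cmod)
  also have "\<dots> = 1 / (2 * pi) ^ DIM('a) * norm I"
    by (simp add: norm_mult norm_divide norm_power)
  also have "\<dots> \<le> 1 * norm I"
  proof (rule mult_right_mono)
    have "1 \<le> (2 * pi) ^ DIM('a)" using pi_ge_two by (intro one_le_power) simp
    then show "1 / (2 * pi) ^ DIM('a) \<le> 1" by (subst divide_le_eq_1_pos) simp_all
  qed simp
  also have "1 * norm I \<le> (LINT \<xi>|lborel. norm (cis (x \<bullet> \<xi>) * complex_of_real (norm \<xi> powr (2 * \<sigma>)) * fourier f \<xi>))"
    unfolding I_def by (simp only: mult_1_left integral_norm_bound)
  also have "\<dots> \<le> M * (LINT x|lborel. 1 / (1 + (norm (x::'a))\<^sup>2) ^ DIM('a))"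
    using \<sigma> by (intro tame_fourier_integrable[OF f]) (auto simp: norm_mult intro!: powr_le_one_plus_square)
  finally show ?thesis .
qed

section \<open>L^1 estimates by second differences\<close>

lemma nn_integral_lborel_shift:
  fixes f :: "'a::euclidean_space \<Rightarrow> ennreal"
  assumes [measurable]: "f \<in> borel_measurable borel"
  shows "(\<integral>\<^sup>+x. f (c + x) \<partial>lborel) = (\<integral>\<^sup>+x. f x \<partial>lborel)"
proof -
  have "(\<integral>\<^sup>+x. f x \<partial>lborel) = (\<integral>\<^sup>+x. f x \<partial>distr lborel borel ((+) c))"
    by (simp only: lborel_distr_plus)
  also have "\<dots> = (\<integral>\<^sup>+x. f (c + x) \<partial>lborel)"
    by (subst nn_integral_distr) auto
  finally show ?thesis ..
qed

text \<open>For |v| at most 1 the integrand vanishes outside the ball of radius M + 1 and is at most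
  M |v|^2. For larger v the three terms are estimated separately; by translation invariance each
  costs the L^1 norm of \<open>f\<close>, with weights 1 + 1 + 2 = 4.\<close>

lemma tame_second_difference:
  assumes f: "tame M (f :: 'a::euclidean_space \<Rightarrow> real)"
  shows "(\<integral>\<^sup>+x. ennreal \<bar>f (x + v) + f (x - v) - 2 * f x\<bar> \<partial>lborel)
    \<le> ennreal (4 * M * measure lborel (cball (0::'a) (M + 1)) * min 1 ((norm v)\<^sup>2))"
proof -
  note [measurable] = tame_measurable[OF f]
  define V where "V = measure lborel (cball (0::'a) (M + 1))"
  have M: "M \<ge> 0" by (rule tame_nonneg[OF f])
  have V: "emeasure lborel (cball (0::'a) (M + 1)) = ennreal V" "V \<ge> 0"
    unfolding V_def using emeasure_lborel_cball_finite[of "0::'a" "M + 1"]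
    by (auto intro!: emeasure_eq_ennreal_measure)
  show ?thesis
  proof (cases "norm v \<le> 1")
    case True
    have "(\<integral>\<^sup>+x. ennreal \<bar>f (x + v) + f (x - v) - 2 * f x\<bar> \<partial>lborel)
       \<le> (\<integral>\<^sup>+x. ennreal (M * (norm v)\<^sup>2) * indicator (cball (0::'a) (M + 1)) x \<partial>lborel)"
    proof (rule nn_integral_mono)
      fix x :: 'a
      show "ennreal \<bar>f (x + v) + f (x - v) - 2 * f x\<bar> \<le> ennreal (M * (norm v)\<^sup>2) * indicator (cball 0 (M + 1)) x"
      proof (cases "norm x \<le> M + 1")
        case True
        then show ?thesis using f by (auto simp: tame_def intro: ennreal_leI)
      next
        case False
        then have "norm (x + v) > M" "norm (x - v) > M" "norm x > M"
          using \<open>norm v \<le> 1\<close> norm_triangle_ineq4[of "x + v" v] norm_triangle_ineq[of "x - v" v] by auto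
        then have "f (x + v) = 0" "f (x - v) = 0" "f x = 0" using f by (auto simp: tame_def)
        then show ?thesis by simp
      qed
    qed
    also have "\<dots> = ennreal (M * (norm v)\<^sup>2) * ennreal V"
      by (subst nn_integral_cmult_indicator) (auto simp: V)
    also have "\<dots> = ennreal (M * V * (norm v)\<^sup>2)"
      using M V(2) by (simp add: mult_ac flip: ennreal_mult')
    also have "\<dots> \<le> ennreal (4 * M * V * min 1 ((norm v)\<^sup>2))"
    proof (rule ennreal_leI)
      have "min 1 ((norm v)\<^sup>2) = (norm v)\<^sup>2" using True by (simp add: power_le_one)
      moreover have "0 \<le> M * V * (norm v)\<^sup>2" using M V by simp
      ultimately show "M * V * (norm v)\<^sup>2 \<le> 4 * M * V * min 1 ((norm v)\<^sup>2)" by simp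
    qed
    finally show ?thesis unfolding V_def .
  next
    case False
    have i: "(\<integral>\<^sup>+x. ennreal \<bar>f x\<bar> \<partial>lborel) \<le> ennreal (M * V)"
      using tame_nn_integral[OF f] M V by (simp add: ennreal_mult')
    have "(\<integral>\<^sup>+x. ennreal \<bar>f (x + v) + f (x - v) - 2 * f x\<bar> \<partial>lborel)
       \<le> (\<integral>\<^sup>+x. ennreal \<bar>f (v + x)\<bar> + ennreal \<bar>f (- v + x)\<bar> + 2 * ennreal \<bar>f x\<bar> \<partial>lborel)"
    proof (rule nn_integral_mono)
      fix x :: 'a
      have "\<bar>f (x + v) + f (x - v) - 2 * f x\<bar> \<le> \<bar>f (v + x)\<bar> + \<bar>f (- v + x)\<bar> + 2 * \<bar>f x\<bar>"
        by (simp add: add.commute[of _ x])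
      then have "ennreal \<bar>f (x + v) + f (x - v) - 2 * f x\<bar> \<le> ennreal (\<bar>f (v + x)\<bar> + \<bar>f (- v + x)\<bar> + 2 * \<bar>f x\<bar>)"
        by (rule ennreal_leI)
      then show "ennreal \<bar>f (x + v) + f (x - v) - 2 * f x\<bar> \<le> ennreal \<bar>f (v + x)\<bar> + ennreal \<bar>f (- v + x)\<bar> + 2 * ennreal \<bar>f x\<bar>"
        by (simp add: ennreal_plus ennreal_mult)
    qed
    also have "\<dots> = (\<integral>\<^sup>+x. ennreal \<bar>f (v + x)\<bar> \<partial>lborel) + (\<integral>\<^sup>+x. ennreal \<bar>f (- v + x)\<bar> \<partial>lborel) + 2 * (\<integral>\<^sup>+x. ennreal \<bar>f x\<bar> \<partial>lborel)"
      by (simp add: nn_integral_add nn_integral_cmult)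
    also have "\<dots> = (\<integral>\<^sup>+x. ennreal \<bar>f x\<bar> \<partial>lborel) + (\<integral>\<^sup>+x. ennreal \<bar>f x\<bar> \<partial>lborel) + 2 * (\<integral>\<^sup>+x. ennreal \<bar>f x\<bar> \<partial>lborel)"
    proof -
      have "(\<integral>\<^sup>+x. ennreal \<bar>f (c + x)\<bar> \<partial>lborel) = (\<integral>\<^sup>+x. ennreal \<bar>f x\<bar> \<partial>lborel)" for c
        by (rule nn_integral_lborel_shift) measurable
      then show ?thesis by (simp only:)
    qed
    also have "\<dots> \<le> ennreal (M * V) + ennreal (M * V) + 2 * ennreal (M * V)"
      by (intro add_mono mult_left_mono i) auto
    also have "\<dots> = ennreal (4 * M * V * min 1 ((norm v)\<^sup>2))"
    proof -
      have "min 1 ((norm v)\<^sup>2) = 1" using False by (simp add: min_def one_le_power)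
      moreover have "2 * ennreal (M * V) = ennreal (2 * (M * V))"
        by (simp add: ennreal_mult')
      moreover have "ennreal (M * V) + ennreal (M * V) + ennreal (2 * (M * V)) = ennreal (4 * M * V)"
        using mult_nonneg_nonneg[OF M V(2)] by (simp add: algebra_simps flip: ennreal_plus)
      ultimately show ?thesis by (simp only: mult_1_right order.refl)
    qed
    finally show ?thesis unfolding V_def .
  qed
qed

text \<open>A first-order estimate of \<open>f x - heat r f x\<close> would only give the order sqrt
  r, not enough against r^(-\<sigma>-1) when \<sigma> is at least 1/2. Adding the averages for c and
  -c cancels the first order and leaves minus one half of the mean second difference; the factor one
  half is given away.\<close>

lemma heat_difference_pointwise:
  assumes f: "tame M (f :: 'a::euclidean_space \<Rightarrow> real)" and r: "r > 0"
  defines "c \<equiv> 2 * sqrt r"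
  shows "ennreal \<bar>f x - heat r f x\<bar> \<le> ennreal (pi powr (- real DIM('a) / 2)) *
    (\<integral>\<^sup>+z. ennreal (exp (- (norm z)\<^sup>2)) * ennreal \<bar>f (x + c *\<^sub>R z) + f (x - c *\<^sub>R z) - 2 * f x\<bar> \<partial>lborel)"
proof -
  note [measurable] = tame_measurable[OF f]
  define p where "p = pi powr (- real DIM('a) / 2)"
  have c: "c\<^sup>2 = 4 * r" "(- c)\<^sup>2 = 4 * r" using r by (auto simp: c_def power_mult_distrib)
  define D where "D z = (f (x + c *\<^sub>R z) * exp (- (norm z)\<^sup>2) + f (x + (- c) *\<^sub>R z) * exp (- (norm z)\<^sup>2)) - 2 * f x * exp (- (norm z)\<^sup>2)" for z :: 'a
  have g: "integrable lborel (\<lambda>z::'a. exp (- (norm z)\<^sup>2))" "p * (LINT z|lborel. exp (- (norm (z::'a))\<^sup>2)) = 1"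
    using gaussian_integral[of 1, where 'a='a] by (simp_all add: p_def powr_minus)
  note i = tame_gaussian_average_integrable[OF f, of x]
  have D: "integrable lborel D"
    unfolding D_def by (intro Bochner_Integration.integrable_diff Bochner_Integration.integrable_add i integrable_mult_right g)
  have "p * integral\<^sup>L lborel D = p * (LINT z|lborel. f (x + c *\<^sub>R z) * exp (- (norm z)\<^sup>2))
     + p * (LINT z|lborel. f (x + (- c) *\<^sub>R z) * exp (- (norm z)\<^sup>2)) - 2 * f x * (p * (LINT z|lborel. exp (- (norm (z::'a))\<^sup>2)))"
    unfolding D_def
    by (simp only: Bochner_Integration.integral_diff[OF Bochner_Integration.integrable_add[OF i i] integrable_mult_right[OF g(1)]]
       Bochner_Integration.integral_add[OF i i] integral_mult_right_zero) (simp only: algebra_simps)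
  also have "\<dots> = heat r f x + heat r f x - 2 * f x"
    unfolding g(2) unfolding p_def heat_average[OF tame_measurable[OF f] r c(1), symmetric] heat_average[OF tame_measurable[OF f] r c(2), symmetric] by simp
  finally have "f x - heat r f x = - (p * integral\<^sup>L lborel D) / 2" by simp
  moreover have p: "p \<ge> 0" by (simp add: p_def)
  ultimately have "\<bar>f x - heat r f x\<bar> = p * norm (integral\<^sup>L lborel D) / 2"
    by (simp add: abs_mult)
  also have "\<dots> \<le> p * norm (integral\<^sup>L lborel D)"
    using p by simp
  finally have "\<bar>f x - heat r f x\<bar> \<le> p * norm (integral\<^sup>L lborel D)" .
  then have "ennreal \<bar>f x - heat r f x\<bar> \<le> ennreal p * ennreal (norm (integral\<^sup>L lborel D))"
    unfolding p_def by (subst ennreal_mult'[symmetric]) (auto intro: ennreal_leI)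
  also have "\<dots> \<le> ennreal p * (\<integral>\<^sup>+z. ennreal (norm (D z)) \<partial>lborel)"
    by (intro mult_left_mono integral_norm_bound_ennreal D) auto
  also have "(\<lambda>z. norm (D z)) = (\<lambda>z. exp (- (norm z)\<^sup>2) * \<bar>f (x + c *\<^sub>R z) + f (x - c *\<^sub>R z) - 2 * f x\<bar>)"
  proof
    fix z
    have "D z = exp (- (norm z)\<^sup>2) * (f (x + c *\<^sub>R z) + f (x - c *\<^sub>R z) - 2 * f x)"
      by (simp add: D_def algebra_simps)
    then show "norm (D z) = exp (- (norm z)\<^sup>2) * \<bar>f (x + c *\<^sub>R z) + f (x - c *\<^sub>R z) - 2 * f x\<bar>" by (simp add: abs_mult)
  qed
  finally show ?thesis unfolding p_def by (simp add: ennreal_mult')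
qed

text \<open>The factor min 1 r is what makes r^(-\<sigma>-1) integrable at both ends. In the
  constant, 32 = 4 * 8 combines \<open>tame_second_difference\<close> with the estimate
  \<open>m\<close> below, and 2^(N/2) is the normalised mass of exp (-|z|^2/2).\<close>

lemma heat_difference_L1:
  assumes f: "tame M (f :: 'a::euclidean_space \<Rightarrow> real)" and r: "r > 0"
  shows "(\<integral>\<^sup>+x. ennreal \<bar>f x - heat r f x\<bar> \<partial>lborel)
    \<le> ennreal (32 * M * measure lborel (cball (0::'a) (M + 1)) * 2 powr (real DIM('a) / 2) * min 1 r)"
proof -
  note [measurable] = tame_measurable[OF f]
  define V where "V = measure lborel (cball (0::'a) (M + 1))"
  have MV: "M \<ge> 0" "V \<ge> 0" using tame_nonneg[OF f] by (auto simp: V_def)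
  define p where "p = pi powr (- real DIM('a) / 2)"
  define c where "c = 2 * sqrt r"
  define F where "F x z = ennreal (exp (- (norm z)\<^sup>2)) * ennreal \<bar>f (x + c *\<^sub>R z) + f (x - c *\<^sub>R z) - 2 * f x\<bar>" for x z
  have [measurable]: "(\<lambda>(x, z). F x z) \<in> borel_measurable (borel \<Otimes>\<^sub>M borel)"
    unfolding F_def by measurable
  \<comment> \<open>Half of the Gaussian is spent on the factor |z|^2, by u exp (-u/2) \<le> 2; the
    other half is kept for the integration over z.\<close>
  have m: "exp (- (norm z)\<^sup>2) * min 1 ((norm (c *\<^sub>R z))\<^sup>2) \<le> 8 * min 1 r * exp (- (1 / 2) * (norm z)\<^sup>2)" for z :: 'a
  proof -
    define u where "u = (norm z)\<^sup>2"
    have u: "u \<ge> 0" by (simp add: u_def)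
    have n: "(norm (c *\<^sub>R z))\<^sup>2 = 4 * r * u" using r by (simp add: c_def u_def power_mult_distrib)
    define e where "e = exp (- (1 / 2) * u)"
    have e: "0 < e" "e \<le> 1" using u by (auto simp: e_def)
    have e2: "exp (- u) = e * e" unfolding e_def by (simp flip: exp_add)
    have ue: "u * e \<le> 2"
    proof -
      have "u \<le> 2 * exp (u / 2)" using exp_ge_add_one_self[of "u / 2"] by linarith
      then have "u * e \<le> (2 * exp (u / 2)) * e" using e(1) by (intro mult_right_mono) auto
      moreover have "exp (u / 2) * e = 1" by (simp add: e_def flip: exp_add)
      ultimately show ?thesis by (simp only: mult.assoc mult_1_right)
    qed
    have "e * e * min 1 (4 * r * u) \<le> e * (8 * min 1 r)"
    proof -
      have "e * min 1 (4 * r * u) \<le> 8 * min 1 r"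
      proof (cases "r \<le> 1")
        case True
        have "e * min 1 (4 * r * u) \<le> e * (4 * r * u)" using e by (intro mult_left_mono) auto
        also have "\<dots> = 4 * r * (u * e)" by simp
        also have "\<dots> \<le> 4 * r * 2" using ue r by (intro mult_left_mono) auto
        finally show ?thesis using True r by simp
      next
        case False
        have "e * min 1 (4 * r * u) \<le> 1 * 1" using e u r by (intro mult_mono) auto
        then show ?thesis using False by simp
      qed
      then show ?thesis using e by (simp add: mult.assoc mult_left_mono)
    qed
    then show ?thesis unfolding n unfolding u_def[symmetric] e2 e_def[symmetric] by (simp add: mult_ac)
  qed
  have "(\<integral>\<^sup>+x. ennreal \<bar>f x - heat r f x\<bar> \<partial>lborel) \<le> (\<integral>\<^sup>+x. ennreal p * (\<integral>\<^sup>+z. F x z \<partial>lborel) \<partial>lborel)"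
    unfolding F_def p_def c_def by (intro nn_integral_mono heat_difference_pointwise[OF f r])
  also have "\<dots> = ennreal p * (\<integral>\<^sup>+x. \<integral>\<^sup>+z. F x z \<partial>lborel \<partial>lborel)"
    by (rule nn_integral_cmult) measurable
  also have "(\<integral>\<^sup>+x. \<integral>\<^sup>+z. F x z \<partial>lborel \<partial>lborel) = (\<integral>\<^sup>+z. \<integral>\<^sup>+x. F x z \<partial>lborel \<partial>lborel)"
    by (rule lborel_pair.Fubini'[symmetric]) simp
  also have "\<dots> \<le> (\<integral>\<^sup>+z. ennreal (32 * M * V * min 1 r) * ennreal (exp (- (1 / 2) * (norm (z::'a))\<^sup>2)) \<partial>lborel)"
  proof (rule nn_integral_mono)
    fix z :: 'a
    have "(\<integral>\<^sup>+x. F x z \<partial>lborel) = ennreal (exp (- (norm z)\<^sup>2)) * (\<integral>\<^sup>+x. ennreal \<bar>f (x + c *\<^sub>R z) + f (x - c *\<^sub>R z) - 2 * f x\<bar> \<partial>lborel)"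
      unfolding F_def by (rule nn_integral_cmult) measurable
    also have "\<dots> \<le> ennreal (exp (- (norm z)\<^sup>2)) * ennreal (4 * M * V * min 1 ((norm (c *\<^sub>R z))\<^sup>2))"
      unfolding V_def by (intro mult_left_mono tame_second_difference f) auto
    also have "\<dots> = ennreal (4 * M * V * (exp (- (norm z)\<^sup>2) * min 1 ((norm (c *\<^sub>R z))\<^sup>2)))"
      by (simp add: mult_ac flip: ennreal_mult')
    also have "\<dots> \<le> ennreal (4 * M * V * (8 * min 1 r * exp (- (1 / 2) * (norm z)\<^sup>2)))"
      using MV by (intro ennreal_leI mult_left_mono m) auto
    also have "\<dots> = ennreal (32 * M * V * min 1 r) * ennreal (exp (- (1 / 2) * (norm z)\<^sup>2))"
      by (subst ennreal_mult''[symmetric]) (simp_all add: mult_ac)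
    finally show "(\<integral>\<^sup>+x. F x z \<partial>lborel) \<le> ennreal (32 * M * V * min 1 r) * ennreal (exp (- (1 / 2) * (norm z)\<^sup>2))" .
  qed
  also have "\<dots> = ennreal (32 * M * V * min 1 r) * ennreal ((pi / (1 / 2)) powr (real DIM('a) / 2))"
    by (subst nn_integral_cmult) (simp_all only: gaussian_nn_integral, measurable)
  also have "ennreal p * (ennreal (32 * M * V * min 1 r) * ennreal ((pi / (1 / 2)) powr (real DIM('a) / 2))) =
      ennreal (32 * M * V * 2 powr (real DIM('a) / 2) * min 1 r)"
    using MV r by (simp add: p_def powr_mult powr_minus field_simps flip: ennreal_mult')
  finally show ?thesis unfolding V_def by (simp add: mult_left_mono)
qed

text \<open>Estimating min 1 r by 2 (1 - exp (-r)) allows the r-integral to be evaluated exactly by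
  \<open>nn_integral_powr_one_minus_exp\<close> at l = 1. Its value cancels the prefactor
  \<sigma>/Gamma(1-\<sigma>), so the bound is free of \<sigma>, and 64 = 2 * 32.\<close>

lemma frac_lap_L1:
  assumes f: "tame M (f :: 'a::euclidean_space \<Rightarrow> real)" and \<sigma>: "0 < \<sigma>" "\<sigma> < 1"
  shows "(\<integral>\<^sup>+x. ennreal \<bar>frac_lap \<sigma> f x\<bar> \<partial>lborel)
    \<le> ennreal (64 * M * measure lborel (cball (0::'a) (M + 1)) * 2 powr (real DIM('a) / 2))"
proof -
  note [measurable] = tame_measurable[OF f]
  define D where "D = 32 * M * measure lborel (cball (0::'a) (M + 1)) * 2 powr (real DIM('a) / 2)"
  have D: "D \<ge> 0" using tame_nonneg[OF f] by (auto simp: D_def)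
  have G: "Gamma (1 - \<sigma>) > 0" using \<sigma> by (intro Gamma_real_pos) auto
  then have G0: "Gamma (1 - \<sigma>) \<noteq> 0" by (metis less_irrefl)
  define w where "w r = indicator {0<..} r * r powr (- \<sigma> - 1)" for r :: real
  have w: "w r \<ge> 0" for r by (simp add: w_def)
  have [measurable]: "w \<in> borel_measurable borel" unfolding w_def by measurable
  \<comment> \<open>The integral of a non-integrable function is 0 by convention, so the inequality
    holds for every \<open>g\<close>, and integrability in r need not be known at each x.\<close>
  have abs_le: "ennreal \<bar>LINT r|lborel. g r\<bar> \<le> (\<integral>\<^sup>+r. ennreal \<bar>g r\<bar> \<partial>lborel)" for g :: "real \<Rightarrow> real"
  proof (cases "integrable lborel g")
    case True
    then show ?thesis using integral_norm_bound_ennreal[OF True] by simp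
  qed (simp add: not_integrable_integral_eq)
  have "(\<integral>\<^sup>+x. ennreal \<bar>frac_lap \<sigma> f x\<bar> \<partial>lborel) \<le>
    (\<integral>\<^sup>+x. ennreal (\<sigma> / Gamma (1 - \<sigma>)) * (\<integral>\<^sup>+r. ennreal (w r) * ennreal \<bar>f x - heat r f x\<bar> \<partial>lborel) \<partial>lborel)"
  proof (rule nn_integral_mono)
    fix x
    have "ennreal \<bar>frac_lap \<sigma> f x\<bar> = ennreal (\<sigma> / Gamma (1 - \<sigma>)) * ennreal \<bar>LINT r|lborel. w r * (f x - heat r f x)\<bar>"
      using \<sigma> G unfolding frac_lap_heat[OF f \<sigma>] w_def by (simp add: abs_mult flip: ennreal_mult')
    also have "\<dots> \<le> ennreal (\<sigma> / Gamma (1 - \<sigma>)) * (\<integral>\<^sup>+r. ennreal \<bar>w r * (f x - heat r f x)\<bar> \<partial>lborel)"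
      by (intro mult_left_mono abs_le) auto
    finally show "ennreal \<bar>frac_lap \<sigma> f x\<bar> \<le> ennreal (\<sigma> / Gamma (1 - \<sigma>)) * (\<integral>\<^sup>+r. ennreal (w r) * ennreal \<bar>f x - heat r f x\<bar> \<partial>lborel)"
      using w by (simp add: abs_mult ennreal_mult')
  qed
  also have "\<dots> = ennreal (\<sigma> / Gamma (1 - \<sigma>)) * (\<integral>\<^sup>+x. \<integral>\<^sup>+r. ennreal (w r) * ennreal \<bar>f x - heat r f x\<bar> \<partial>lborel \<partial>lborel)"
    by (rule nn_integral_cmult) measurable
  also have "(\<integral>\<^sup>+x. \<integral>\<^sup>+r. ennreal (w r) * ennreal \<bar>f x - heat r f x\<bar> \<partial>lborel \<partial>lborel) =
      (\<integral>\<^sup>+r. \<integral>\<^sup>+x. ennreal (w r) * ennreal \<bar>f x - heat r f x\<bar> \<partial>lborel \<partial>lborel)"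
    by (rule lborel_pair.Fubini'[symmetric]) measurable
  also have "\<dots> \<le> (\<integral>\<^sup>+r. ennreal (2 * D) * ennreal (indicator {0<..} r * r powr (- \<sigma> - 1) * (1 - exp (- r * 1))) \<partial>lborel)"
  proof (rule nn_integral_mono)
    fix r :: real
    show "(\<integral>\<^sup>+x. ennreal (w r) * ennreal \<bar>f x - heat r f x\<bar> \<partial>lborel) \<le>
      ennreal (2 * D) * ennreal (indicator {0<..} r * r powr (- \<sigma> - 1) * (1 - exp (- r * 1)))"
    proof (cases "r > 0")
      case True
      have "(\<integral>\<^sup>+x. ennreal (w r) * ennreal \<bar>f x - heat r f x\<bar> \<partial>lborel) = ennreal (w r) * (\<integral>\<^sup>+x. ennreal \<bar>f x - heat r f x\<bar> \<partial>lborel)"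
        by (rule nn_integral_cmult) measurable
      also have "\<dots> \<le> ennreal (w r) * ennreal (D * min 1 r)"
        unfolding D_def by (intro mult_left_mono heat_difference_L1 f True) auto
      also have "\<dots> \<le> ennreal (w r) * ennreal (D * (2 * (1 - exp (- r))))"
      proof (intro mult_left_mono ennreal_leI D)
        have "exp (- r) \<le> 1 / (1 + r)"
          using exp_ge_add_one_self[of r] True by (simp add: exp_minus field_simps)
        also have "\<dots> = 1 - r / (1 + r)" using True by (simp add: field_simps)
        finally have "r / (1 + r) \<le> 1 - exp (- r)" by simp
        moreover have "min 1 r / 2 \<le> r / (1 + r)" using True by (simp add: min_def field_simps)
        ultimately have "min 1 r / 2 \<le> 1 - exp (- r)" by (rule order_trans[rotated])
        then show "min 1 r \<le> 2 * (1 - exp (- r))" by simp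
      qed auto
      also have "\<dots> = ennreal (2 * D) * ennreal (w r * (1 - exp (- r * 1)))"
        using D w True by (simp add: mult_ac flip: ennreal_mult')
      finally show ?thesis by (simp add: w_def)
    qed (simp add: w_def)
  qed
  also have "\<dots> = ennreal (2 * D) * ennreal (Gamma (1 - \<sigma>) / \<sigma> * 1 powr \<sigma>)"
    using nn_integral_powr_one_minus_exp[of \<sigma> 1] \<sigma> by (subst nn_integral_cmult) simp_all
  also have "ennreal (\<sigma> / Gamma (1 - \<sigma>)) * (ennreal (2 * D) * ennreal (Gamma (1 - \<sigma>) / \<sigma> * 1 powr \<sigma>)) = ennreal (2 * D)"
    using G G0 \<sigma> D by (simp flip: ennreal_mult')
  finally show ?thesis by (simp add: D_def mult_left_mono mult.assoc)
qed

subsection \<open>The fractional Laplacian tested against a power\<close>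

text \<open>Gaussian superposition takes the place of polar coordinates. Integrating over x leaves
  t^(a/2-1) (1+t)^(-N/2), which is integrable at 0 because a > 0 and at infinity because a <
  N.\<close>

lemma norm_powr_gaussian_integrable:
  assumes a: "0 < a" "a < real DIM('a::euclidean_space)"
  shows "integrable lborel (\<lambda>x::'a. norm x powr (- a) * exp (- (norm x)\<^sup>2))"
proof (rule integrableI_bounded)
  define N where "N = real DIM('a)"
  have aN: "(N - a) / 2 > 0" using a by (simp add: N_def)
  have G: "Gamma (a / 2) > 0" using a by (intro Gamma_real_pos) auto
  define K where "K x t = indicator {0<..} t * t powr (a / 2 - 1) * exp (- t * (norm x)\<^sup>2)" for x :: 'a and t
  have [measurable]: "(\<lambda>(x, t). K x t) \<in> borel_measurable (borel \<Otimes>\<^sub>M borel)"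
    unfolding K_def by measurable
  \<comment> \<open>A majorant made of two Gamma integrals: the first summand dominates for t \<le>
    1, where exp (-t) is at least 1/e, the second for t > 1, where exp (-1/t) is. This is also the
    origin of the factor \<open>exp 1\<close>.\<close>
  define E where "E t = indicator {0<..} t * t powr (a / 2 - 1) * exp (- t * 1) + indicator {0<..} t * t powr (- ((N - a) / 2) - 1) * exp (- 1 / t)" for t :: real
  have "(\<integral>\<^sup>+x. ennreal (norm (norm (x::'a) powr (- a) * exp (- (norm x)\<^sup>2))) \<partial>lborel)
     = (\<integral>\<^sup>+x. ennreal (1 / Gamma (a / 2)) * (\<integral>\<^sup>+t. ennreal (exp (- (norm (x::'a))\<^sup>2)) * ennreal (K x t) \<partial>lborel) \<partial>lborel)"
  proof (rule nn_integral_cong_AE, rule eventually_mono[OF AE_lborel_singleton[of 0]])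
    fix x :: 'a assume x: "x \<noteq> 0"
    have "(\<integral>\<^sup>+t. ennreal (exp (- (norm (x::'a))\<^sup>2)) * ennreal (K x t) \<partial>lborel) = ennreal (exp (- (norm (x::'a))\<^sup>2)) * ennreal (Gamma (a / 2) * ((norm x)\<^sup>2) powr (- (a / 2)))"
      unfolding K_def using x a nn_integral_powr_exp[of "a / 2" "(norm x)\<^sup>2"] by (subst nn_integral_cmult) auto
    also have "((norm x)\<^sup>2) powr (- (a / 2)) = norm x powr (- a)"
      using x by (simp add: powr_powr flip: powr_numeral)
    finally show "ennreal (norm (norm x powr (- a) * exp (- (norm x)\<^sup>2))) = ennreal (1 / Gamma (a / 2)) * (\<integral>\<^sup>+t. ennreal (exp (- (norm (x::'a))\<^sup>2)) * ennreal (K x t) \<partial>lborel)"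
      using G less_imp_neq[OF G] by (simp add: mult_ac flip: ennreal_mult')
  qed
  also have "\<dots> = ennreal (1 / Gamma (a / 2)) * (\<integral>\<^sup>+x. \<integral>\<^sup>+t. ennreal (exp (- (norm (x::'a))\<^sup>2)) * ennreal (K x t) \<partial>lborel \<partial>lborel)"
    by (rule nn_integral_cmult) measurable
  also have "(\<integral>\<^sup>+x. \<integral>\<^sup>+t. ennreal (exp (- (norm (x::'a))\<^sup>2)) * ennreal (K x t) \<partial>lborel \<partial>lborel) =
      (\<integral>\<^sup>+t. \<integral>\<^sup>+x. ennreal (exp (- (norm (x::'a))\<^sup>2)) * ennreal (K x t) \<partial>lborel \<partial>lborel)"
    by (rule lborel_pair.Fubini'[symmetric]) measurable
  also have "\<dots> \<le> (\<integral>\<^sup>+t. ennreal (exp 1 * pi powr (N / 2)) * ennreal (E t) \<partial>lborel)"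
  proof (rule nn_integral_mono)
    fix t :: real
    show "(\<integral>\<^sup>+x. ennreal (exp (- (norm (x::'a))\<^sup>2)) * ennreal (K x t) \<partial>lborel) \<le> ennreal (exp 1 * pi powr (N / 2)) * ennreal (E t)"
    proof (cases "t > 0")
      case True
      have "(\<integral>\<^sup>+x. ennreal (exp (- (norm (x::'a))\<^sup>2)) * ennreal (K x t) \<partial>lborel) =
        (\<integral>\<^sup>+x. ennreal (t powr (a / 2 - 1)) * ennreal (exp (- (1 + t) * (norm (x::'a))\<^sup>2)) \<partial>lborel)"
        using True by (intro nn_integral_cong) (simp add: K_def algebra_simps flip: ennreal_mult' exp_add)
      also have "\<dots> = ennreal (t powr (a / 2 - 1)) * ennreal ((pi / (1 + t)) powr (N / 2))"
        using True unfolding N_def by (subst nn_integral_cmult) (simp_all only: gaussian_nn_integral add_pos_pos zero_less_one, measurable)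
      also have "\<dots> = ennreal (pi powr (N / 2) * (t powr (a / 2 - 1) * (1 + t) powr (- (N / 2))))"
        using True by (simp add: powr_divide powr_minus field_simps flip: ennreal_mult')
      also have "\<dots> \<le> ennreal (pi powr (N / 2) * (exp 1 * E t))"
      proof (intro ennreal_leI mult_left_mono)
        show "t powr (a / 2 - 1) * (1 + t) powr (- (N / 2)) \<le> exp 1 * E t"
        proof (cases "t \<le> 1")
          case t1: True
          have "(1 + t) powr (- (N / 2)) \<le> (1 + t) powr 0" using True a by (intro powr_mono) (auto simp: N_def)
          then have "t powr (a / 2 - 1) * (1 + t) powr (- (N / 2)) \<le> t powr (a / 2 - 1) * (exp 1 * exp (- t * 1))"
            using t1 True by (intro mult_left_mono) (auto intro: order_trans[of _ 1] simp flip: exp_add)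
          also have "\<dots> = exp 1 * (indicator {0<..} t * t powr (a / 2 - 1) * exp (- t * 1))" using True by simp
          also have "\<dots> \<le> exp 1 * E t" unfolding E_def by (intro mult_left_mono) auto
          finally show ?thesis .
        next
          case t1: False
          have "(1 + t) powr (- (N / 2)) \<le> t powr (- (N / 2))" using True a by (intro powr_mono2') (auto simp: N_def)
          then have "t powr (a / 2 - 1) * (1 + t) powr (- (N / 2)) \<le> t powr (a / 2 - 1) * t powr (- (N / 2))"
            by (intro mult_left_mono) auto
          also have "\<dots> = t powr (- ((N - a) / 2) - 1)"
          proof -
            have "a / 2 - 1 + - (N / 2) = - ((N - a) / 2) - 1" by (simp add: field_simps)
            then show ?thesis by (simp only: powr_add[symmetric])
          qed
          also have "\<dots> \<le> t powr (- ((N - a) / 2) - 1) * (exp 1 * exp (- 1 / t))"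
            using t1 by (intro mult_le_cancel_left1[THEN iffD2]) (auto simp flip: exp_add)
          also have "\<dots> = exp 1 * (indicator {0<..} t * t powr (- ((N - a) / 2) - 1) * exp (- 1 / t))" using True by simp
          also have "\<dots> \<le> exp 1 * E t" unfolding E_def by (intro mult_left_mono) auto
          finally show ?thesis .
        qed
      qed auto
      also have "\<dots> = ennreal (exp 1 * pi powr (N / 2)) * ennreal (E t)"
        by (subst ennreal_mult'[symmetric]) (simp_all add: mult_ac)
      finally show ?thesis .
    qed (simp add: K_def)
  qed
  also have "\<dots> = ennreal (exp 1 * pi powr (N / 2)) * (\<integral>\<^sup>+t. ennreal (E t) \<partial>lborel)"
    unfolding E_def by (rule nn_integral_cmult) measurable
  also have "(\<integral>\<^sup>+t. ennreal (E t) \<partial>lborel) = ennreal (Gamma (a / 2) * 1 powr (- (a / 2))) + ennreal (Gamma ((N - a) / 2) * 1 powr (- ((N - a) / 2)))"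
  proof -
    have "(\<integral>\<^sup>+t. ennreal (E t) \<partial>lborel) = (\<integral>\<^sup>+t. ennreal (indicator {0<..} t * t powr (a / 2 - 1) * exp (- t * 1)) \<partial>lborel)
      + (\<integral>\<^sup>+t. ennreal (indicator {0<..} t * t powr (- ((N - a) / 2) - 1) * exp (- 1 / t)) \<partial>lborel)"
      unfolding E_def by (subst nn_integral_add[symmetric]) (auto intro!: nn_integral_cong ennreal_plus)
    also have "\<dots> = ennreal (Gamma (a / 2) * 1 powr (- (a / 2))) + ennreal (Gamma ((N - a) / 2) * 1 powr (- ((N - a) / 2)))"
      using a by (subst nn_integral_powr_exp, simp, simp, subst nn_integral_powr_exp_inverse[OF aN zero_less_one]) (rule refl)
    finally show ?thesis .
  qed
  finally have "(\<integral>\<^sup>+x. ennreal (norm (norm (x::'a) powr (- a) * exp (- (norm x)\<^sup>2))) \<partial>lborel)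
     \<le> ennreal (1 / Gamma (a / 2)) * (ennreal (exp 1 * pi powr (N / 2)) *
       (ennreal (Gamma (a / 2) * 1 powr (- (a / 2))) + ennreal (Gamma ((N - a) / 2) * 1 powr (- ((N - a) / 2)))))"
    by (simp add: mult_left_mono)
  then show "(\<integral>\<^sup>+x. ennreal (norm (norm (x::'a) powr (- a) * exp (- (norm x)\<^sup>2))) \<partial>lborel) < \<infinity>"
    by (rule order.strict_trans1) (simp add: ennreal_mult_less_top)
qed measurable

text \<open>Outside the unit ball the weight is at most 1. Inside, y is bounded by \<open>B\<close>,
  and \<open>exp 1\<close> times the Gaussian is at least 1. The Gaussian thus stands in for the
  indicator of the ball and has a weighted integral that is already under control.\<close>

lemma norm_powr_split:
  assumes a: "0 < a" and B: "\<bar>y\<bar> \<le> B"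
  shows "norm x powr (- a) * \<bar>y\<bar> \<le> \<bar>y\<bar> + (B * exp 1) * (norm x powr (- a) * exp (- (norm x)\<^sup>2))"
proof (cases "norm x \<ge> 1")
  case True
  then have "norm x powr (- a) \<le> norm x powr 0" using a by (intro powr_mono) auto
  then have "norm x powr (- a) * \<bar>y\<bar> \<le> 1 * \<bar>y\<bar>" using True by (intro mult_right_mono) (auto split: if_splits)
  moreover have "0 \<le> (B * exp 1) * (norm x powr (- a) * exp (- (norm x)\<^sup>2))" using B by (intro mult_nonneg_nonneg) auto
  ultimately show ?thesis by simp
next
  case False
  have "1 \<le> exp (1 - (norm x)\<^sup>2)" using False by (simp add: power_le_one)
  then have "1 * \<bar>y\<bar> \<le> exp (1 - (norm x)\<^sup>2) * B" using B by (intro mult_mono) auto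
  then have "norm x powr (- a) * \<bar>y\<bar> \<le> norm x powr (- a) * (exp (1 - (norm x)\<^sup>2) * B)"
    by (intro mult_left_mono) auto
  also have "\<dots> = (B * exp 1) * (norm x powr (- a) * exp (- (norm x)\<^sup>2))"
    by (simp add: exp_diff exp_minus field_simps)
  finally show ?thesis by simp
qed

lemma norm_powr_times_integrable:
  fixes g :: "'a::euclidean_space \<Rightarrow> real"
  assumes a: "0 < a" "a < real DIM('a)" and g: "integrable lborel g" and B: "\<And>x. \<bar>g x\<bar> \<le> B"
  shows "integrable lborel (\<lambda>x. norm x powr (- a) * g x)"
proof (rule Bochner_Integration.integrable_bound)
  show "integrable lborel (\<lambda>x. \<bar>g x\<bar> + (B * exp 1) * (norm x powr (- a) * exp (- (norm x)\<^sup>2)))"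
    using g by (intro Bochner_Integration.integrable_add integrable_mult_right norm_powr_gaussian_integrable a) auto
  have B0: "B \<ge> 0" using B[of 0] by linarith
  show "AE x in lborel. norm (norm x powr (- a) * g x) \<le> norm (\<bar>g x\<bar> + (B * exp 1) * (norm x powr (- a) * exp (- (norm x)\<^sup>2)))"
  proof (rule AE_I2)
    fix x :: 'a
    have "norm x powr (- a) * \<bar>g x\<bar> \<le> \<bar>g x\<bar> + (B * exp 1) * (norm x powr (- a) * exp (- (norm x)\<^sup>2))"
      using a(1) B by (rule norm_powr_split)
    then show "norm (norm x powr (- a) * g x) \<le> norm (\<bar>g x\<bar> + (B * exp 1) * (norm x powr (- a) * exp (- (norm x)\<^sup>2)))"
      by (simp add: abs_mult)
  qed
  show "(\<lambda>x. norm x powr (- a) * g x) \<in> borel_measurable lborel"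
    using borel_measurable_integrable[OF g] by measurable
qed

text \<open>Because the Gaussian is integrable in x, Fubini requires nothing of \<open>h\<close>
  beyond L^1. It is applied to |\<xi>|^(2s) times the transform of \<open>f\<close>.\<close>

lemma gaussian_parseval:
  fixes h :: "'a::euclidean_space \<Rightarrow> complex"
  assumes h: "integrable lborel h" and t: "t > 0"
  shows "integrable lborel (\<lambda>x. complex_of_real (exp (- t * (norm x)\<^sup>2)) * (LINT \<xi>|lborel. cis (x \<bullet> \<xi>) * h \<xi>))"
    and "(LINT x|lborel. complex_of_real (exp (- t * (norm x)\<^sup>2)) * (LINT \<xi>|lborel. cis (x \<bullet> \<xi>) * h \<xi>))
      = (LINT \<xi>|lborel. complex_of_real ((pi / t) powr (real DIM('a) / 2) * exp (- (norm \<xi>)\<^sup>2 / (4 * t))) * h \<xi>)"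
proof -
  have [measurable]: "h \<in> borel_measurable borel" using h by auto
  define F where "F x \<xi> = complex_of_real (exp (- t * (norm x)\<^sup>2)) * (cis (x \<bullet> \<xi>) * h \<xi>)" for x \<xi>
  have nF: "norm (F x \<xi>) = exp (- t * (norm x)\<^sup>2) * norm (h \<xi>)" for x \<xi>
    unfolding F_def by (simp add: norm_mult)
  have [measurable]: "(\<lambda>(x, \<xi>). F x \<xi>) \<in> borel_measurable (borel \<Otimes>\<^sub>M borel)"
    unfolding F_def by measurable
  have int: "integrable (lborel \<Otimes>\<^sub>M lborel) (\<lambda>(x, \<xi>). F x \<xi>)"
  proof (rule lborel_pair.Fubini_integrable)
    show "integrable lborel (\<lambda>x. LINT \<xi>|lborel. norm (case (x, \<xi>) of (x, \<xi>) \<Rightarrow> F x \<xi>))"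
      using gaussian_integral(1)[OF t, where 'a='a] by (simp add: nF)
    have "integrable lborel (F x)" for x
    proof (rule Bochner_Integration.integrable_bound)
      show "integrable lborel (\<lambda>\<xi>. exp (- t * (norm x)\<^sup>2) * norm (h \<xi>))"
        using h by (intro integrable_mult_right integrable_norm)
    qed (auto simp: nF)
    then show "AE x in lborel. integrable lborel (\<lambda>\<xi>. case (x, \<xi>) of (x, \<xi>) \<Rightarrow> F x \<xi>)"
      by simp
  qed measurable
  have e: "(LINT \<xi>|lborel. F x \<xi>) = complex_of_real (exp (- t * (norm x)\<^sup>2)) * (LINT \<xi>|lborel. cis (x \<bullet> \<xi>) * h \<xi>)" for x
    unfolding F_def by (rule integral_mult_right_zero)
  show "integrable lborel (\<lambda>x. complex_of_real (exp (- t * (norm x)\<^sup>2)) * (LINT \<xi>|lborel. cis (x \<bullet> \<xi>) * h \<xi>))"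
    using lborel_pair.integrable_fst[OF int] unfolding e .
  have "(LINT x|lborel. complex_of_real (exp (- t * (norm x)\<^sup>2)) * (LINT \<xi>|lborel. cis (x \<bullet> \<xi>) * h \<xi>)) = (LINT \<xi>|lborel. LINT x|lborel. F x \<xi>)"
    using lborel_pair.Fubini_integral[OF int] unfolding e by simp
  also have "\<dots> = (LINT \<xi>|lborel. complex_of_real ((pi / t) powr (real DIM('a) / 2) * exp (- (norm \<xi>)\<^sup>2 / (4 * t))) * h \<xi>)"
  proof (rule Bochner_Integration.integral_cong[OF refl])
    fix \<xi> :: 'a
    have "(LINT x|lborel. F x \<xi>) = (LINT x|lborel. (cis (x \<bullet> \<xi>) * complex_of_real (exp (- t * (norm x)\<^sup>2))) * h \<xi>)"
      unfolding F_def by (simp only: mult_ac)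
    also have "\<dots> = (LINT x|lborel. cis (x \<bullet> \<xi>) * complex_of_real (exp (- t * (norm x)\<^sup>2))) * h \<xi>"
      by (rule integral_mult_left_zero)
    finally show "(LINT x|lborel. F x \<xi>) = complex_of_real ((pi / t) powr (real DIM('a) / 2) * exp (- (norm \<xi>)\<^sup>2 / (4 * t))) * h \<xi>"
      unfolding gaussian_fourier(2)[OF t] .
  qed
  finally show "(LINT x|lborel. complex_of_real (exp (- t * (norm x)\<^sup>2)) * (LINT \<xi>|lborel. cis (x \<bullet> \<xi>) * h \<xi>))
      = (LINT \<xi>|lborel. complex_of_real ((pi / t) powr (real DIM('a) / 2) * exp (- (norm \<xi>)\<^sup>2 / (4 * t))) * h \<xi>)" .
qed

lemma frac_lap_measurable [measurable (raw)]:
  assumes [measurable]: "(\<lambda>(w, y). \<phi> w y) \<in> borel_measurable (N \<Otimes>\<^sub>M borel)" "g \<in> borel_measurable N"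
  shows "(\<lambda>w. frac_lap s (\<phi> w) (g w :: 'a::euclidean_space)) \<in> borel_measurable N"
  unfolding frac_lap_def by measurable

lemma quarter_square_powr:
  assumes "x \<noteq> 0"
  shows "((norm x)\<^sup>2 / 4) powr (- (p / 2)) = 2 powr p * norm x powr (- p)"
proof -
  have "(norm x)\<^sup>2 / 4 = (norm x / 2) powr 2" using assms by (simp add: power_divide)
  then have "((norm x)\<^sup>2 / 4) powr (- (p / 2)) = (norm x / 2) powr (- p)"
    by (simp only: powr_powr) simp
  then show ?thesis by (simp add: powr_divide powr_minus field_simps)
qed

text \<open>As \<open>f 0 = 0\<close>, only minus the heat average at the origin survives in
  \<open>frac_lap_heat\<close>. The power |x|^(-b) is not integrable at the origin since b > N; that
  \<open>f\<close> vanishes on a whole ball around it makes the right-hand integral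
  converge.\<close>

lemma frac_lap_at_zero:
  fixes f :: "'a::euclidean_space \<Rightarrow> real"
  assumes f: "tame M f" and \<delta>: "\<delta> > 0" "\<And>x. norm x < \<delta> \<Longrightarrow> f x = 0"
    and b: "real DIM('a) < b" "b < real DIM('a) + 2"
  shows "frac_lap ((b - real DIM('a)) / 2) f 0 =
      (4 * pi) powr (- real DIM('a) / 2) * Gamma (b / 2) * 2 powr b / Gamma ((real DIM('a) - b) / 2)
        * (LINT x|lborel. norm x powr (- b) * f x)"
proof -
  note [measurable] = tame_measurable[OF f]
  define N where "N = real DIM('a)"
  define \<sigma> where "\<sigma> = (b - N) / 2"
  have \<sigma>: "0 < \<sigma>" "\<sigma> < 1" and b0: "b > 0" using b by (auto simp: \<sigma>_def N_def intro: order.strict_trans1[of _ "real DIM('a)"])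
  have i: "integrable lborel (\<lambda>x. norm x powr (- b) * f x)"
  proof (rule Bochner_Integration.integrable_bound)
    show "integrable lborel (\<lambda>x. \<delta> powr (- b) * f x)"
      by (intro integrable_mult_right tame_integrable[OF f])
    show "AE x in lborel. norm (norm x powr (- b) * f x) \<le> norm (\<delta> powr (- b) * f x)"
    proof (rule AE_I2)
      fix x :: 'a
      show "norm (norm x powr (- b) * f x) \<le> norm (\<delta> powr (- b) * f x)"
      proof (cases "norm x < \<delta>")
        case False
        then have "norm x powr (- b) \<le> \<delta> powr (- b)" using b0 \<delta> by (intro powr_mono2') auto
        then show ?thesis by (simp add: abs_mult mult_right_mono)
      qed (simp add: \<delta>)
    qed
  qed measurable
  \<comment> \<open>This is r^(-\<sigma>-1) times the heat kernel between x and the origin: the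
    exponents -\<sigma> and -N/2 add up to -b/2.\<close>
  define K where "K x r = (4 * pi) powr (- N / 2) * (indicator {0<..} r * r powr (- (b / 2) - 1) * exp (- ((norm x)\<^sup>2 / 4) / r))" for x :: 'a and r :: real
  define W where "W x = (4 * pi) powr (- N / 2) * Gamma (b / 2) * 2 powr b * norm x powr (- b)" for x :: 'a
  have G: "Gamma (b / 2) > 0" using b0 by (intro Gamma_real_pos) simp
  have "(LINT r|lborel. LINT x|lborel. K x r *\<^sub>R f x) = (LINT x|lborel. W x *\<^sub>R f x)"
  proof (rule kernel_superposition(2))
    show "(\<lambda>(x, r). K x r) \<in> borel_measurable (borel \<Otimes>\<^sub>M borel)"
      unfolding K_def by measurable
    show "K x r \<ge> 0" for x r unfolding K_def by (auto simp: indicator_def)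
    show "AE x in lborel. f x \<noteq> 0 \<longrightarrow> 0 \<le> W x \<and> (\<integral>\<^sup>+r. ennreal (K x r) \<partial>lborel) = ennreal (W x)"
    proof (intro AE_I2 impI conjI)
      fix x assume "f x \<noteq> 0"
      then have x: "x \<noteq> 0" using \<delta> by auto
      show "0 \<le> W x" unfolding W_def using G by simp
      have "(\<integral>\<^sup>+r. ennreal (K x r) \<partial>lborel) = ennreal ((4 * pi) powr (- N / 2)) *
        (\<integral>\<^sup>+r. ennreal (indicator {0<..} r * r powr (- (b / 2) - 1) * exp (- ((norm x)\<^sup>2 / 4) / r)) \<partial>lborel)"
        unfolding K_def by (subst nn_integral_cmult[symmetric]) (auto intro!: nn_integral_cong ennreal_mult')
      also have "\<dots> = ennreal ((4 * pi) powr (- N / 2)) * ennreal (Gamma (b / 2) * ((norm x)\<^sup>2 / 4) powr (- (b / 2)))"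
        using b0 x by (subst nn_integral_powr_exp_inverse) auto
      also have "\<dots> = ennreal (W x)"
        unfolding quarter_square_powr[OF x] W_def by (subst ennreal_mult'[symmetric]) (simp_all add: mult_ac)
      finally show "(\<integral>\<^sup>+r. ennreal (K x r) \<partial>lborel) = ennreal (W x)" .
    qed
    show "integrable lborel (\<lambda>x. W x *\<^sub>R f x)"
      using integrable_mult_right[OF i, of "(4 * pi) powr (- N / 2) * Gamma (b / 2) * 2 powr b"]
      by (simp add: W_def mult_ac)
  qed measurable
  also have "(LINT x|lborel. W x *\<^sub>R f x) = (4 * pi) powr (- N / 2) * Gamma (b / 2) * 2 powr b * (LINT x|lborel. norm x powr (- b) * f x)"
    unfolding W_def by (subst integral_mult_right_zero[symmetric]) (simp add: mult.assoc)
  finally have 1: "(LINT r|lborel. LINT x|lborel. K x r *\<^sub>R f x) = (4 * pi) powr (- N / 2) * Gamma (b / 2) * 2 powr b * (LINT x|lborel. norm x powr (- b) * f x)" .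
  have 2: "indicator {0<..} r * r powr (- \<sigma> - 1) * (f 0 - heat r f 0) = - (LINT x|lborel. K x r *\<^sub>R f x)" for r
  proof (cases "r > 0")
    case True
    have "r powr (- (b / 2) - 1) = r powr (- \<sigma> - 1) * r powr (- N / 2)"
      by (simp add: \<sigma>_def diff_divide_distrib flip: powr_add)
    then have "(LINT x|lborel. K x r *\<^sub>R f x) = (LINT x|lborel. (r powr (- \<sigma> - 1) * (4 * pi * r) powr (- N / 2)) * (f x * exp (- (norm (0 - x))\<^sup>2 / (4 * r))))"
      using True by (intro Bochner_Integration.integral_cong) (auto simp: K_def powr_mult mult_ac)
    also have "\<dots> = r powr (- \<sigma> - 1) * heat r f 0"
      unfolding heat_def N_def by (simp only: integral_mult_right_zero mult.assoc)
    finally show ?thesis using True \<delta> by simp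
  qed (simp add: K_def)
  have "frac_lap \<sigma> f 0 = - (\<sigma> / Gamma (1 - \<sigma>)) * ((4 * pi) powr (- N / 2) * Gamma (b / 2) * 2 powr b * (LINT x|lborel. norm x powr (- b) * f x))"
    unfolding frac_lap_heat[OF f \<sigma>] 2 1[symmetric] by simp
  \<comment> \<open>The functional equation of Gamma at -\<sigma>, which lies strictly between -1
    and 0 and so is no pole. Since -\<sigma> = (N-b)/2, this is the only negative factor of the
    constant.\<close>
  also have "- (\<sigma> / Gamma (1 - \<sigma>)) = 1 / Gamma (- \<sigma>)"
  proof -
    have "- \<sigma> \<notin> \<int>\<^sub>\<le>\<^sub>0"
    proof
      assume "- \<sigma> \<in> \<int>\<^sub>\<le>\<^sub>0"
      then obtain n :: int where "- \<sigma> = of_int n" by (auto elim!: nonpos_Ints_cases)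
      then have "real_of_int (- 1) < real_of_int n" "real_of_int n < real_of_int 0" using \<sigma> by simp_all
      then show False unfolding of_int_less_iff by simp
    qed
    then have "Gamma (1 - \<sigma>) = - \<sigma> * Gamma (- \<sigma>)" using Gamma_plus1[of "- \<sigma>"] by simp
    moreover have "Gamma (- \<sigma>) \<noteq> 0" using \<open>- \<sigma> \<notin> \<int>\<^sub>\<le>\<^sub>0\<close> by (simp add: Gamma_eq_zero_iff)
    ultimately show ?thesis using \<sigma> by simp
  qed
  also have "- \<sigma> = (N - b) / 2" by (simp add: \<sigma>_def field_simps)
  finally show "frac_lap ((b - real DIM('a)) / 2) f 0 =
      (4 * pi) powr (- real DIM('a) / 2) * Gamma (b / 2) * 2 powr b / Gamma ((real DIM('a) - b) / 2)
        * (LINT x|lborel. norm x powr (- b) * f x)"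
    unfolding \<sigma>_def N_def by (simp add: mult_ac)
qed

lemma frac_lap_integrable:
  assumes f: "tame M (f :: 'a::euclidean_space \<Rightarrow> real)" and \<sigma>: "0 < \<sigma>" "\<sigma> < 1"
  shows "integrable lborel (frac_lap \<sigma> f)"
proof (rule integrableI_bounded)
  show "frac_lap \<sigma> f \<in> borel_measurable lborel" using tame_measurable[OF f] by measurable
  show "(\<integral>\<^sup>+x. ennreal (norm (frac_lap \<sigma> f x)) \<partial>lborel) < \<infinity>"
    using frac_lap_L1[OF f \<sigma>] by (auto intro: order.strict_trans1)
qed

text \<open>On the frequency side the weight becomes a multiple of |\<xi>|^(a-N), and the factor
  |\<xi>|^(2s) of the operator raises the exponent to a + 2s - N. The hypotheses place this between
  0 and 2, so the result is again a fractional Laplacian of \<open>f\<close>, evaluated at the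
  origin.\<close>

theorem frac_lap_norm_powr:
  fixes f :: "'a::euclidean_space \<Rightarrow> real"
  assumes f: "tame M f" and \<delta>: "\<delta> > 0" "\<And>x. norm x < \<delta> \<Longrightarrow> f x = 0"
    and s: "0 < s" "s < 1" and a: "0 < a" "a < real DIM('a)" "real DIM('a) < a + 2 * s"
  shows "(LINT x|lborel. norm x powr (- a) * frac_lap s f x)
    = kconst DIM('a) s a * (LINT x|lborel. norm x powr (- (a + 2 * s)) * f x)"
proof -
  note [measurable] = tame_measurable[OF f]
  define N where "N = real DIM('a)"
  define b where "b = a + 2 * s"
  have b: "N < b" "b < N + 2" using a s by (auto simp: b_def N_def)
  have Ga: "Gamma (a / 2) > 0" and GN: "Gamma ((N - a) / 2) > 0"
    using a by (auto intro!: Gamma_real_pos simp: N_def)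
  define H where "H \<xi> = complex_of_real (norm \<xi> powr (2 * s)) * fourier f \<xi>" for \<xi>
  have H: "integrable lborel H"
    unfolding H_def using s by (intro tame_fourier_integrable[OF f]) (auto intro!: powr_le_one_plus_square)
  have [measurable]: "H \<in> borel_measurable borel" using H by auto
  have re: "Re (complex_of_real c * z) = c * Re z" for c z by simp
  define p where "p = 1 / (2 * pi) ^ DIM('a)"
  define J where "J = (LINT \<xi>|lborel. complex_of_real (norm \<xi> powr (b - N)) * fourier f \<xi>)"
  \<comment> \<open>Up to the factor 1/Gamma(a/2), this is the constant in the Fourier transform of
    |x|^(-a).\<close>
  define q where "q = pi powr (N / 2) * Gamma ((N - a) / 2) * 2 powr (N - a)"

  have fl: "frac_lap s f x = p * Re (LINT \<xi>|lborel. cis (x \<bullet> \<xi>) * H \<xi>)" for x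
    unfolding frac_lap_def re p_def H_def by (simp only: mult.assoc)
  \<comment> \<open>At x = 0 the phase is 1, so the plain frequency integral is already the value of
    a fractional Laplacian.\<close>
  have J: "p * Re J = frac_lap ((b - N) / 2) f 0"
  proof -
    have "2 * ((b - N) / 2) = b - N" by simp
    then show ?thesis
      unfolding frac_lap_def re p_def J_def by (simp only: inner_zero_left cis_zero mult_1_left)
  qed

  have A: "Gamma (a / 2) * (LINT x|lborel. norm x powr (- a) * frac_lap s f x)
    = (LINT t|lborel. LINT x|lborel. (indicator {0<..} t * t powr (a / 2 - 1) * exp (- t * (norm x)\<^sup>2)) *\<^sub>R frac_lap s f x)"
  proof (subst kernel_superposition(2)[where W="\<lambda>x. Gamma (a / 2) * norm x powr (- a)"])
    show "AE x in lborel. frac_lap s f x \<noteq> 0 \<longrightarrow> 0 \<le> Gamma (a / 2) * norm x powr (- a) \<and>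
       (\<integral>\<^sup>+t. ennreal (indicator {0<..} t * t powr (a / 2 - 1) * exp (- t * (norm x)\<^sup>2)) \<partial>lborel) = ennreal (Gamma (a / 2) * norm x powr (- a))"
    proof (rule eventually_mono[OF AE_lborel_singleton[of 0]], intro impI conjI)
      fix x :: 'a assume x: "x \<noteq> 0"
      have "((norm x)\<^sup>2) powr (- (a / 2)) = norm x powr (- a)"
        using x by (simp add: powr_powr flip: powr_numeral)
      then show "(\<integral>\<^sup>+t. ennreal (indicator {0<..} t * t powr (a / 2 - 1) * exp (- t * (norm x)\<^sup>2)) \<partial>lborel) = ennreal (Gamma (a / 2) * norm x powr (- a))"
        using nn_integral_powr_exp[of "a / 2" "(norm x)\<^sup>2"] a x by simp
    qed (use Ga in simp)
    have "integrable lborel (\<lambda>x. norm x powr (- a) * frac_lap s f x)"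
      using s by (intro norm_powr_times_integrable[OF a(1,2) frac_lap_integrable[OF f s] frac_lap_bounded[OF f]]) auto
    then show "integrable lborel (\<lambda>x. (Gamma (a / 2) * norm x powr (- a)) *\<^sub>R frac_lap s f x)"
      by (simp add: mult.assoc)
    show "Gamma (a / 2) * (LINT x|lborel. norm x powr (- a) * frac_lap s f x) = (LINT x|lborel. (Gamma (a / 2) * norm x powr (- a)) *\<^sub>R frac_lap s f x)"
      by (simp add: mult.assoc)
  qed (auto simp: indicator_def)

  define K where "K \<xi> t = pi powr (N / 2) * (indicator {0<..} t * t powr (- ((N - a) / 2) - 1) * exp (- ((norm \<xi>)\<^sup>2 / 4) / t))" for \<xi> :: 'a and t :: real
  \<comment> \<open>The transform of the Gaussian contributes t^(-N/2), which turns the exponent a/2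
    - 1 into -((N-a)/2) - 1. The t-integral is then of the inverted type, with exponent (N-a)/2 >
    0.\<close>
  have B: "(LINT x|lborel. (indicator {0<..} t * t powr (a / 2 - 1) * exp (- t * (norm x)\<^sup>2)) *\<^sub>R frac_lap s f x)
     = p * Re (LINT \<xi>|lborel. K \<xi> t *\<^sub>R H \<xi>)" for t
  proof (cases "t > 0")
    case True
    note P = gaussian_parseval[OF H True]
    have "(LINT x|lborel. (indicator {0<..} t * t powr (a / 2 - 1) * exp (- t * (norm x)\<^sup>2)) *\<^sub>R frac_lap s f x)
      = (LINT x|lborel. (p * t powr (a / 2 - 1)) * Re (complex_of_real (exp (- t * (norm x)\<^sup>2)) * (LINT \<xi>|lborel. cis (x \<bullet> \<xi>) * H \<xi>)))"
      unfolding re fl using True by (intro Bochner_Integration.integral_cong) auto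
    also have "\<dots> = (p * t powr (a / 2 - 1)) * Re (LINT x|lborel. complex_of_real (exp (- t * (norm x)\<^sup>2)) * (LINT \<xi>|lborel. cis (x \<bullet> \<xi>) * H \<xi>))"
      by (simp only: integral_mult_right_zero integral_Re[OF P(1)])
    also have "\<dots> = p * Re (complex_of_real (t powr (a / 2 - 1)) * (LINT \<xi>|lborel. complex_of_real ((pi / t) powr (N / 2) * exp (- (norm \<xi>)\<^sup>2 / (4 * t))) * H \<xi>))"
      unfolding P(2) re N_def by simp
    also have "complex_of_real (t powr (a / 2 - 1)) * (LINT \<xi>|lborel. complex_of_real ((pi / t) powr (N / 2) * exp (- (norm \<xi>)\<^sup>2 / (4 * t))) * H \<xi>)
       = (LINT \<xi>|lborel. K \<xi> t *\<^sub>R H \<xi>)"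
    proof (subst integral_mult_right_zero[symmetric], rule Bochner_Integration.integral_cong[OF refl])
      fix \<xi> :: 'a
      have "- ((N - a) / 2) - 1 = (a / 2 - 1) - N / 2" by (simp add: field_simps)
      then have "t powr (- ((N - a) / 2) - 1) = t powr (a / 2 - 1) / t powr (N / 2)" by (simp only: powr_diff)
      then have "K \<xi> t = t powr (a / 2 - 1) * ((pi / t) powr (N / 2) * exp (- (norm \<xi>)\<^sup>2 / (4 * t)))"
        using True by (simp add: K_def powr_divide)
      then show "complex_of_real (t powr (a / 2 - 1)) * (complex_of_real ((pi / t) powr (N / 2) * exp (- (norm \<xi>)\<^sup>2 / (4 * t))) * H \<xi>) = K \<xi> t *\<^sub>R H \<xi>"
        by (simp only: scaleR_conv_of_real of_real_mult mult.assoc)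
    qed
    finally show ?thesis .
  qed (simp add: K_def)

  have iJ: "integrable lborel (\<lambda>\<xi>. complex_of_real (norm \<xi> powr (b - N)) * fourier f \<xi>)"
    using b by (intro tame_fourier_integrable[OF f]) (auto intro!: powr_le_one_plus_square)
  have WH: "(q * norm \<xi> powr (- (N - a))) *\<^sub>R H \<xi> = complex_of_real q * (complex_of_real (norm \<xi> powr (b - N)) * fourier f \<xi>)" for \<xi>
  proof -
    have "- (N - a) + 2 * s = b - N" by (simp add: b_def)
    then have "norm \<xi> powr (b - N) = norm \<xi> powr (- (N - a)) * norm \<xi> powr (2 * s)" by (simp only: powr_add[symmetric])
    then show ?thesis by (simp add: H_def scaleR_conv_of_real)
  qed
  \<comment> \<open>Integrability in t is recorded along with the value because the real part has to
    be moved outside the t-integral.\<close>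
  have sup: "integrable lborel (\<lambda>t. LINT \<xi>|lborel. K \<xi> t *\<^sub>R H \<xi>) \<and>
      (LINT t|lborel. LINT \<xi>|lborel. K \<xi> t *\<^sub>R H \<xi>) = (LINT \<xi>|lborel. (q * norm \<xi> powr (- (N - a))) *\<^sub>R H \<xi>)"
  proof (rule conjI; rule kernel_superposition)
    show "(\<lambda>(\<xi>, t). K \<xi> t) \<in> borel_measurable (borel \<Otimes>\<^sub>M borel)"
      unfolding K_def by measurable
    then show "(\<lambda>(\<xi>, t). K \<xi> t) \<in> borel_measurable (borel \<Otimes>\<^sub>M borel)" .
    show "K \<xi> t \<ge> 0" for \<xi> t unfolding K_def by (auto simp: indicator_def)
    then show "K \<xi> t \<ge> 0" for \<xi> t .
    show "AE \<xi> in lborel. H \<xi> \<noteq> 0 \<longrightarrow> 0 \<le> q * norm \<xi> powr (- (N - a)) \<and> (\<integral>\<^sup>+t. ennreal (K \<xi> t) \<partial>lborel) = ennreal (q * norm \<xi> powr (- (N - a)))"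
    proof (rule eventually_mono[OF AE_lborel_singleton[of 0]], intro impI conjI)
      fix \<xi> :: 'a assume x: "\<xi> \<noteq> 0"
      have "(\<integral>\<^sup>+t. ennreal (K \<xi> t) \<partial>lborel) = ennreal (pi powr (N / 2)) *
        (\<integral>\<^sup>+t. ennreal (indicator {0<..} t * t powr (- ((N - a) / 2) - 1) * exp (- ((norm \<xi>)\<^sup>2 / 4) / t)) \<partial>lborel)"
        unfolding K_def by (subst nn_integral_cmult[symmetric]) (auto intro!: nn_integral_cong ennreal_mult')
      also have "\<dots> = ennreal (pi powr (N / 2)) * ennreal (Gamma ((N - a) / 2) * ((norm \<xi>)\<^sup>2 / 4) powr (- ((N - a) / 2)))"
        using a x by (subst nn_integral_powr_exp_inverse) (auto simp: N_def)
      also have "\<dots> = ennreal (q * norm \<xi> powr (- (N - a)))"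
        unfolding quarter_square_powr[OF x] q_def by (subst ennreal_mult'[symmetric]) (simp_all add: mult_ac)
      finally show "(\<integral>\<^sup>+t. ennreal (K \<xi> t) \<partial>lborel) = ennreal (q * norm \<xi> powr (- (N - a)))" .
      show "0 \<le> q * norm \<xi> powr (- (N - a))" unfolding q_def using GN by simp
    qed
    then show "AE \<xi> in lborel. H \<xi> \<noteq> 0 \<longrightarrow> 0 \<le> q * norm \<xi> powr (- (N - a)) \<and> (\<integral>\<^sup>+t. ennreal (K \<xi> t) \<partial>lborel) = ennreal (q * norm \<xi> powr (- (N - a)))" .
    show "integrable lborel (\<lambda>\<xi>. (q * norm \<xi> powr (- (N - a))) *\<^sub>R H \<xi>)"
      unfolding WH by (intro integrable_mult_right iJ)
    then show "integrable lborel (\<lambda>\<xi>. (q * norm \<xi> powr (- (N - a))) *\<^sub>R H \<xi>)" .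
  qed measurable
  have "Gamma (a / 2) * (LINT x|lborel. norm x powr (- a) * frac_lap s f x) = p * (LINT t|lborel. Re (LINT \<xi>|lborel. K \<xi> t *\<^sub>R H \<xi>))"
    unfolding A B by (rule integral_mult_right_zero)
  also have "\<dots> = p * Re (LINT t|lborel. LINT \<xi>|lborel. K \<xi> t *\<^sub>R H \<xi>)"
    using sup by simp
  also have "\<dots> = p * Re (complex_of_real q * J)"
    using sup unfolding WH J_def by simp
  also have "\<dots> = q * frac_lap ((b - N) / 2) f 0"
    unfolding re J[symmetric] by simp
  also have "\<dots> = q * ((4 * pi) powr (- N / 2) * Gamma (b / 2) * 2 powr b / Gamma ((N - b) / 2)
        * (LINT x|lborel. norm x powr (- b) * f x))"
    using frac_lap_at_zero[OF f \<delta>, of b] b unfolding N_def by simp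
  also have "\<dots> = Gamma (a / 2) * (kconst DIM('a) s a * (LINT x|lborel. norm x powr (- b) * f x))"
  proof -
    \<comment> \<open>Bookkeeping of constants: the powers of pi cancel, and the exponents of 2 add
      up to (N-a) - N + b = 2s.\<close>
    have e4: "(4 * pi) powr (- N / 2) = 2 powr (- N) * pi powr (- (N / 2))"
    proof -
      have "(4::real) = 2 powr 2" by simp
      then have "(4::real) powr (- N / 2) = 2 powr (- N)" by (simp only: powr_powr) simp
      then show ?thesis by (simp add: powr_mult)
    qed
    have e2: "2 powr (N - a) * 2 powr (- N) * 2 powr b = 2 powr (2 * s)"
      by (simp add: b_def flip: powr_add)
    have epi: "pi powr (N / 2) * pi powr (- (N / 2)) = 1" by (simp flip: powr_add)
    have "q * ((4 * pi) powr (- N / 2) * Gamma (b / 2) * 2 powr b / Gamma ((N - b) / 2)) =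
       (pi powr (N / 2) * pi powr (- (N / 2))) * (2 powr (N - a) * 2 powr (- N) * 2 powr b) * (Gamma ((N - a) / 2) * Gamma (b / 2)) / Gamma ((N - b) / 2)"
      unfolding q_def e4 by (simp only: times_divide_eq_left times_divide_eq_right mult_ac)
    then have c: "q * ((4 * pi) powr (- N / 2) * Gamma (b / 2) * 2 powr b / Gamma ((N - b) / 2)) =
       2 powr (2 * s) * (Gamma ((N - a) / 2) * Gamma (b / 2)) / Gamma ((N - b) / 2)"
      unfolding e2 epi mult_1_left .
    have g: "Gamma (a / 2) * kconst DIM('a) s a = 2 powr (2 * s) * (Gamma ((N - a) / 2) * Gamma (b / 2)) / Gamma ((N - b) / 2)"
      using less_imp_neq[OF Ga] unfolding kconst_def N_def b_def by (simp add: algebra_simps)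
    show ?thesis
      by (subst mult.assoc[symmetric, of q], subst c, subst g[symmetric], rule mult.assoc)
  qed
  finally show ?thesis
    using less_imp_neq[OF Ga] unfolding b_def by simp
qed

subsection \<open>Time slices of test functions\<close>

lemma Ck_diff: "Ck k f \<Longrightarrow> Ck k g \<Longrightarrow> Ck k (\<lambda>x. f x - g x)"
proof (induction k arbitrary: f g)
  case (Suc k)
  from Suc.prems obtain f' g' where "\<forall>x. (f has_derivative f' x) (at x)" "\<forall>v. Ck k (\<lambda>x. f' x v)"
    "\<forall>x. (g has_derivative g' x) (at x)" "\<forall>v. Ck k (\<lambda>x. g' x v)"
    by auto
  then show ?case using Suc.IH
    by (auto intro!: exI[of _ "\<lambda>x v. f' x v - g' x v"] has_derivative_diff)
qed (auto intro: continuous_intros)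

lemma Ck_zero: "Ck k (\<lambda>x. 0)"
  by (induction k) (auto intro!: exI[of _ "\<lambda>x v. 0"])

lemma Ck_sum: "(\<And>b. b \<in> S \<Longrightarrow> Ck k (f b)) \<Longrightarrow> Ck k (\<lambda>x. \<Sum>b\<in>S. f b x)"
proof (induction S rule: infinite_finite_induct)
  case (insert b S)
  have "Ck k (\<lambda>x. f b x - (0 - (\<Sum>b\<in>S. f b x)))"
    using insert by (intro Ck_diff Ck_zero) auto
  then show ?case using insert.hyps by simp
qed (auto simp: Ck_zero)

lemma smooth_diff: "smooth f \<Longrightarrow> smooth g \<Longrightarrow> smooth (\<lambda>x. f x - g x)"
  by (simp add: smooth_def Ck_diff)

lemma smooth_sum: "(\<And>b. b \<in> S \<Longrightarrow> smooth (f b)) \<Longrightarrow> smooth (\<lambda>x. \<Sum>b\<in>S. f b x)"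
  by (simp add: smooth_def Ck_sum)

lemma smooth_continuous: "smooth f \<Longrightarrow> continuous_on UNIV f"
  unfolding smooth_def by (metis Ck.simps(1))

text \<open>The direction comes before the point, so that \<open>fderiv f v\<close> is again a
  function on the space and derivatives can be iterated.\<close>

abbreviation fderiv :: "('a::euclidean_space \<Rightarrow> real) \<Rightarrow> 'a \<Rightarrow> 'a \<Rightarrow> real" where
  "fderiv f v x \<equiv> frechet_derivative f (at x) v"

lemma smooth_has_derivative:
  assumes "smooth f"
  shows "(f has_derivative frechet_derivative f (at x)) (at x)"
proof -
  have "Ck (Suc 0) f" using assms unfolding smooth_def by blast
  then show ?thesis
    by (auto simp: differentiable_def intro!: frechet_derivative_works[THEN iffD1]) blast
qed

text \<open>The derivative in \<open>Ck\<close> is existentially quantified, with a possibly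
  different witness for each k. Uniqueness of derivatives identifies all of them with
  \<open>frechet_derivative\<close>.\<close>

lemma smooth_fderiv:
  assumes "smooth f"
  shows "smooth (fderiv f v)"
  unfolding smooth_def
proof
  fix k
  have "Ck (Suc k) f" using assms unfolding smooth_def by blast
  then obtain f' where f': "\<forall>x. (f has_derivative f' x) (at x)" "\<forall>v. Ck k (\<lambda>x. f' x v)"
    by auto
  then have "f' x = frechet_derivative f (at x)" for x
    by (intro has_derivative_unique[OF _ smooth_has_derivative[OF assms]]) auto
  then show "Ck k (fderiv f v)" using f'(2) by auto
qed

text \<open>The strict inequality makes the region of vanishing open, so derivatives vanish there
  too. Both differentiation and restriction to a time slice keep the same radius.\<close>

definition supported :: "real \<Rightarrow> ('a::euclidean_space \<Rightarrow> real) \<Rightarrow> bool" where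
  "supported R f \<longleftrightarrow> (\<forall>x. R < norm x \<longrightarrow> f x = 0)"

lemma fderiv_eq_0:
  fixes f :: "'a::euclidean_space \<Rightarrow> real"
  assumes "smooth f" "open U" "x \<in> U" "\<And>y. y \<in> U \<Longrightarrow> f y = 0"
  shows "fderiv f v x = 0"
proof -
  have "(f has_derivative (\<lambda>v. 0)) (at x)"
    by (rule has_derivative_transform_within_open[OF has_derivative_const[of 0] assms(2,3)]) (simp add: assms(4))
  then have "frechet_derivative f (at x) = (\<lambda>v. 0)"
    using has_derivative_unique[OF smooth_has_derivative[OF assms(1)]] by blast
  then show ?thesis by simp
qed

lemma supported_fderiv:
  fixes f :: "'a::euclidean_space \<Rightarrow> real"
  assumes "smooth f" "supported R f"
  shows "supported R (fderiv f v)"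
  unfolding supported_def
proof (intro allI impI)
  fix x :: 'a assume "R < norm x"
  then show "fderiv f v x = 0"
    using assms(2) by (intro fderiv_eq_0[OF assms(1), of "- cball 0 R"]) (auto simp: supported_def)
qed

lemma supported_bounded:
  assumes f: "continuous_on UNIV f" "supported R f"
  obtains B where "B \<ge> 0" "\<And>x. \<bar>f x\<bar> \<le> B"
proof -
  have "compact (f ` cball 0 R)"
    by (intro compact_continuous_image continuous_on_subset[OF f(1)]) auto
  then obtain B where "\<forall>y\<in>f ` cball 0 R. norm y \<le> B"
    using compact_imp_bounded bounded_iff by metis
  then have B: "norm x \<le> R \<Longrightarrow> \<bar>f x\<bar> \<le> B" for x by auto
  have "\<bar>f x\<bar> \<le> max B 0" for x
    using B[of x] f(2) by (cases "R < norm x") (auto simp: supported_def)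
  then show ?thesis by (intro that[of "max B 0"]) auto
qed

lemma smooth_fderiv_expand:
  assumes "smooth f"
  shows "fderiv f v x = (\<Sum>b\<in>Basis. (v \<bullet> b) * fderiv f b x)"
proof -
  interpret linear "frechet_derivative f (at x)"
    using smooth_has_derivative[OF assms] by (rule has_derivative_linear)
  have "fderiv f (\<Sum>b\<in>Basis. (v \<bullet> b) *\<^sub>R b) x = (\<Sum>b\<in>Basis. (v \<bullet> b) * fderiv f b x)"
    by (simp add: sum scale)
  then show ?thesis by (simp add: euclidean_representation)
qed

lemma smooth_lipschitz:
  fixes f :: "'a::euclidean_space \<Rightarrow> real"
  assumes f: "smooth f" "supported R f"
  obtains L where "L \<ge> 0" "\<And>x y. \<bar>f x - f y\<bar> \<le> L * norm (x - y)"
proof -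
  have "\<exists>B. B \<ge> 0 \<and> (\<forall>x. \<bar>fderiv f b x\<bar> \<le> B)" for b
    by (rule supported_bounded[OF smooth_continuous[OF smooth_fderiv[OF f(1)]] supported_fderiv[OF f], of b]) blast
  then obtain B where B: "\<And>b. B b \<ge> 0" "\<And>b x. \<bar>fderiv f b x\<bar> \<le> B b" by metis
  have "\<bar>f x - f y\<bar> \<le> (\<Sum>b\<in>Basis. B b) * norm (x - y)" for x y
  proof -
    have "norm (f x - f y) \<le> (\<Sum>b\<in>Basis. B b) * norm (x - y)"
    proof (rule differentiable_bound[OF convex_UNIV])
      fix z
      show "(f has_derivative frechet_derivative f (at z)) (at z within UNIV)"
        by (rule smooth_has_derivative[OF f(1)])
      show "onorm (frechet_derivative f (at z)) \<le> (\<Sum>b\<in>Basis. B b)"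
      proof (rule onorm_le)
        fix v
        have "\<bar>fderiv f v z\<bar> \<le> (\<Sum>b\<in>Basis. \<bar>(v \<bullet> b) * fderiv f b z\<bar>)"
          by (subst smooth_fderiv_expand[OF f(1)]) (rule sum_abs)
        also have "\<dots> \<le> (\<Sum>b\<in>Basis. norm v * B b)"
          unfolding abs_mult by (intro sum_mono mult_mono B Basis_le_norm) auto
        finally show "norm (fderiv f v z) \<le> (\<Sum>b\<in>Basis. B b) * norm v"
          by (simp add: sum_distrib_left mult.commute)
      qed
    qed auto
    then show ?thesis by simp
  qed
  then show ?thesis using B(1) by (intro that[of "\<Sum>b\<in>Basis. B b"]) (auto intro: sum_nonneg)
qed

text \<open>The second difference is the increment from x - v to x of z -> f(z+v) - f(z). The
  derivative of this function is at most L |v|, the partial derivatives of \<open>f\<close> being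
  Lipschitz, and the mean value inequality contributes the second factor |v|.\<close>

lemma smooth_second_difference:
  fixes f :: "'a::euclidean_space \<Rightarrow> real"
  assumes f: "smooth f" "supported R f"
  obtains L where "\<And>x v. \<bar>f (x + v) + f (x - v) - 2 * f x\<bar> \<le> L * (norm v)\<^sup>2"
proof -
  have "\<exists>B. B \<ge> 0 \<and> (\<forall>x y. \<bar>fderiv f b x - fderiv f b y\<bar> \<le> B * norm (x - y))" for b
    by (rule smooth_lipschitz[OF smooth_fderiv[OF f(1)] supported_fderiv[OF f], of b]) blast
  then obtain B where B: "\<And>b. B b \<ge> 0" "\<And>b x y. \<bar>fderiv f b x - fderiv f b y\<bar> \<le> B b * norm (x - y)" by metis
  define L where "L = (\<Sum>b\<in>Basis. B b)"
  have "\<bar>f (x + v) + f (x - v) - 2 * f x\<bar> \<le> L * (norm v)\<^sup>2" for x v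
  proof -
    have "norm ((f (x + v) - f x) - (f (x - v + v) - f (x - v))) \<le> (L * norm v) * norm (x - (x - v))"
    proof (rule differentiable_bound[OF convex_UNIV, where f="\<lambda>z. f (z + v) - f z"])
      fix z
      have "((\<lambda>z. f (z + v)) has_derivative frechet_derivative f (at (z + v))) (at z)"
        by (rule has_derivative_compose[OF _ smooth_has_derivative[OF f(1)], of "\<lambda>z. z + v" "\<lambda>w. w"])
           (auto intro!: derivative_eq_intros)
      then show "((\<lambda>z. f (z + v) - f z) has_derivative (\<lambda>w. fderiv f w (z + v) - fderiv f w z)) (at z within UNIV)"
        by (intro has_derivative_diff smooth_has_derivative[OF f(1)]) simp
      show "onorm (\<lambda>w. fderiv f w (z + v) - fderiv f w z) \<le> L * norm v"
      proof (rule onorm_le)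
        fix w
        have "fderiv f w (z + v) - fderiv f w z = (\<Sum>b\<in>Basis. (w \<bullet> b) * (fderiv f b (z + v) - fderiv f b z))"
          unfolding smooth_fderiv_expand[OF f(1), where v=w] by (simp add: sum_subtractf algebra_simps)
        also have "\<bar>\<dots>\<bar> \<le> (\<Sum>b\<in>Basis. \<bar>(w \<bullet> b) * (fderiv f b (z + v) - fderiv f b z)\<bar>)"
          by (rule sum_abs)
        also have "\<dots> \<le> (\<Sum>b\<in>Basis. norm w * (B b * norm v))"
          unfolding abs_mult using B(2)[where x="z + v" and y=z] by (intro sum_mono mult_mono Basis_le_norm) auto
        finally show "norm (fderiv f w (z + v) - fderiv f w z) \<le> L * norm v * norm w"
          by (simp add: L_def sum_distrib_left sum_distrib_right mult_ac)
      qed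
    qed auto
    then show ?thesis by (simp add: power2_eq_square mult.assoc algebra_simps)
  qed
  then show ?thesis by (rule that)
qed

section \<open>Fourier decay, uniformly over the time slices\<close>

lemma fourier_translate:
  assumes [measurable]: "f \<in> borel_measurable borel"
  shows "fourier (\<lambda>y. f (y + v)) \<xi> = cis (v \<bullet> \<xi>) * fourier f (\<xi> :: 'a::euclidean_space)"
proof -
  have "fourier f \<xi> = (LINT y|distr lborel borel ((+) v). cis (- (y \<bullet> \<xi>)) * complex_of_real (f y))"
    by (simp only: fourier_def lborel_distr_plus)
  also have "\<dots> = (LINT y|lborel. cis (- ((v + y) \<bullet> \<xi>)) * complex_of_real (f (v + y)))"
    by (subst integral_distr) auto
  also have "\<dots> = (LINT y|lborel. cis (- (v \<bullet> \<xi>)) * (cis (- (y \<bullet> \<xi>)) * complex_of_real (f (y + v))))"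
    by (simp add: inner_add_left cis_mult add.commute flip: mult.assoc)
  also have "\<dots> = cis (- (v \<bullet> \<xi>)) * fourier (\<lambda>y. f (y + v)) \<xi>"
    unfolding fourier_def by (rule integral_mult_right_zero)
  finally have "cis (v \<bullet> \<xi>) * fourier f \<xi> = (cis (v \<bullet> \<xi>) * cis (- (v \<bullet> \<xi>))) * fourier (\<lambda>y. f (y + v)) \<xi>"
    by simp
  then show ?thesis by (simp add: cis_mult)
qed

text \<open>Integration by parts, replaced by the limit of difference quotients: a translate of \<open>f\<close>
  is transformed into a phase factor.\<close>

lemma fourier_directional_derivative:
  fixes f :: "'a::euclidean_space \<Rightarrow> real"
  assumes f: "\<And>x. (f has_derivative f' x) (at x)" "supported R f"
    and f': "continuous_on UNIV (\<lambda>x. f' x b)" "\<And>x. \<bar>f' x b\<bar> \<le> B" and b: "norm b = 1"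
  shows "fourier (\<lambda>x. f' x b) \<xi> = \<i> * complex_of_real (b \<bullet> \<xi>) * fourier f \<xi>"
proof (rule LIMSEQ_unique)
  have cont: "continuous_on UNIV f"
    by (intro continuous_at_imp_continuous_on ballI has_derivative_continuous[OF f(1)])
  have [measurable]: "f \<in> borel_measurable borel" "(\<lambda>x. f' x b) \<in> borel_measurable borel"
    using cont f'(1) by (auto intro: borel_measurable_continuous_onI)
  define h where "h n = 1 / real (Suc n)" for n
  have h: "h n > 0" "h n \<le> 1" for n by (auto simp: h_def)
  have h0: "h \<longlonglongrightarrow> 0" unfolding h_def using LIMSEQ_inverse_real_of_nat by (simp add: divide_inverse)
  have h_at: "filterlim h (at 0) sequentially"
    using h0 h(1) by (auto simp: filterlim_at less_imp_neq[symmetric])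
  have line: "((\<lambda>t. f (x + t *\<^sub>R b)) has_real_derivative f' (x + t *\<^sub>R b) b) (at t)" for x t
  proof -
    have "((\<lambda>t. f (x + t *\<^sub>R b)) has_derivative (\<lambda>s. f' (x + t *\<^sub>R b) (s *\<^sub>R b))) (at t)"
      by (rule has_derivative_compose[OF _ f(1), of "\<lambda>t. x + t *\<^sub>R b" "\<lambda>s. s *\<^sub>R b"]) (auto intro!: derivative_eq_intros)
    moreover have "f' (x + t *\<^sub>R b) (s *\<^sub>R b) = f' (x + t *\<^sub>R b) b * s" for s
      using linear_scale[OF has_derivative_linear[OF f(1)]] by simp
    ultimately show ?thesis by (simp add: has_field_derivative_def)
  qed
  define Q where "Q n y = (f (y + h n *\<^sub>R b) - f y) / h n" for n y
  have [measurable]: "Q n \<in> borel_measurable borel" for n unfolding Q_def by measurable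
  \<comment> \<open>By the mean value theorem the quotient is a value of the derivative. Since
    \<open>h n\<close> is at most 1, all quotients vanish outside the ball of radius R + 1, so one
    majorant serves every n.\<close>
  have Q_le: "\<bar>Q n y\<bar> \<le> B * indicator (cball 0 (R + 1)) y" for n y
  proof (cases "norm y \<le> R + 1")
    case True
    obtain z where "f (y + h n *\<^sub>R b) - f (y + 0 *\<^sub>R b) = (h n - 0) * f' (y + z *\<^sub>R b) b"
      using MVT2[of 0 "h n" "\<lambda>t. f (y + t *\<^sub>R b)" "\<lambda>t. f' (y + t *\<^sub>R b) b"] h(1)[of n] line by blast
    then have "Q n y = f' (y + z *\<^sub>R b) b" using h(1)[of n] by (simp add: Q_def)
    then show ?thesis using f'(2) True by simp
  next
    case False
    have "norm y \<le> norm (y + h n *\<^sub>R b) + norm (h n *\<^sub>R b)" by (metis add_diff_cancel norm_triangle_ineq4)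
    then have "R < norm (y + h n *\<^sub>R b)" "R < norm y" using h[of n] b False by auto
    moreover have "B \<ge> 0" using f'(2)[of 0] by linarith
    ultimately show ?thesis using f(2) by (simp add: Q_def supported_def)
  qed
  show "(\<lambda>n. fourier (Q n) \<xi>) \<longlonglongrightarrow> fourier (\<lambda>x. f' x b) \<xi>"
    unfolding fourier_def
  proof (rule integral_dominated_convergence[where w="\<lambda>y. B * indicator (cball 0 (R + 1)) y"])
    show "integrable lborel (\<lambda>y::'a. B * indicator (cball 0 (R + 1)) y)"
      using emeasure_lborel_cball_finite[of "0::'a" "R + 1"] by (intro integrable_mult_right integrable_real_indicator) auto
    show "AE y in lborel. (\<lambda>n. cis (- (y \<bullet> \<xi>)) * complex_of_real (Q n y)) \<longlonglongrightarrow> cis (- (y \<bullet> \<xi>)) * complex_of_real (f' y b)"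
    proof (intro AE_I2 tendsto_intros)
      fix y
      have "((\<lambda>t. (f (y + t *\<^sub>R b) - f y) / t) \<longlongrightarrow> f' y b) (at 0)"
        using line[of y 0] by (simp add: DERIV_def)
      then show "(\<lambda>n. Q n y) \<longlonglongrightarrow> f' y b"
        unfolding Q_def by (rule filterlim_compose[OF _ h_at])
    qed
    show "AE y in lborel. norm (cis (- (y \<bullet> \<xi>)) * complex_of_real (Q n y)) \<le> B * indicator (cball 0 (R + 1)) y" for n
      using Q_le by (auto simp: norm_mult)
  qed measurable
  have fi: "integrable lborel (\<lambda>y. cis (- (y \<bullet> \<xi>)) * complex_of_real (f (y + v)))" for v
  proof -
    obtain B' where B': "\<And>x. \<bar>f x\<bar> \<le> B'" using supported_bounded[OF cont f(2)] by metis
    show ?thesis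
    proof (rule Bochner_Integration.integrable_bound)
      show "integrable lborel (\<lambda>y::'a. B' * indicator (cball (- v) R) y)"
        using emeasure_lborel_cball_finite[of "- v" R] by (intro integrable_mult_right integrable_real_indicator) auto
      show "AE y in lborel. norm (cis (- (y \<bullet> \<xi>)) * complex_of_real (f (y + v))) \<le> norm (B' * indicator (cball (- v) R) y)"
        using B' f(2) by (auto simp: norm_mult indicator_def dist_norm supported_def norm_minus_commute algebra_simps not_le intro: order_trans[OF B' abs_ge_self])
    qed measurable
  qed
  have FQ: "fourier (Q n) \<xi> = (cis (h n * (b \<bullet> \<xi>)) - 1) / complex_of_real (h n) * fourier f \<xi>" for n
  proof -
    have "fourier (Q n) \<xi> = (LINT y|lborel. (cis (- (y \<bullet> \<xi>)) * complex_of_real (f (y + h n *\<^sub>R b)) - cis (- (y \<bullet> \<xi>)) * complex_of_real (f (y + 0))) / complex_of_real (h n))"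
      unfolding fourier_def Q_def by (simp add: algebra_simps diff_divide_distrib)
    also have "\<dots> = (fourier (\<lambda>y. f (y + h n *\<^sub>R b)) \<xi> - fourier f \<xi>) / complex_of_real (h n)"
      unfolding fourier_def using Bochner_Integration.integral_diff[OF fi fi[of 0], of "h n *\<^sub>R b"] by simp
    also have "fourier (\<lambda>y. f (y + h n *\<^sub>R b)) \<xi> = cis (h n * (b \<bullet> \<xi>)) * fourier f \<xi>"
      by (subst fourier_translate) auto
    finally show ?thesis by (simp add: algebra_simps diff_divide_distrib)
  qed
  have "(\<lambda>n. (cis (h n * (b \<bullet> \<xi>)) - 1) / complex_of_real (h n)) \<longlonglongrightarrow> \<i> * complex_of_real (b \<bullet> \<xi>)"
  proof -
    define c where "c = \<i> * complex_of_real (b \<bullet> \<xi>)"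
    have "((\<lambda>z. exp (c * z)) has_field_derivative c) (at 0)"
      by (auto intro!: derivative_eq_intros)
    then have "((\<lambda>z. (exp (c * z) - 1) / z) \<longlongrightarrow> c) (at 0)"
      by (simp add: DERIV_def)
    moreover have "filterlim (\<lambda>n. complex_of_real (h n)) (at 0) sequentially"
      using tendsto_of_real[OF h0, where 'a=complex] h(1) by (auto simp: filterlim_at less_imp_neq[symmetric])
    ultimately have "(\<lambda>n. (exp (c * complex_of_real (h n)) - 1) / complex_of_real (h n)) \<longlonglongrightarrow> c"
      by (rule filterlim_compose)
    moreover have "exp (c * complex_of_real (h n)) = cis (h n * (b \<bullet> \<xi>))" for n
      by (simp add: cis_conv_exp c_def mult_ac)
    ultimately show ?thesis unfolding c_def by simp
  qed
  then show "(\<lambda>n. fourier (Q n) \<xi>) \<longlonglongrightarrow> \<i> * complex_of_real (b \<bullet> \<xi>) * fourier f \<xi>"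
    unfolding FQ by (rule tendsto_mult_right)
qed

lemma smooth_slice_has_derivative:
  fixes \<phi> :: "'a::euclidean_space \<times> real \<Rightarrow> real"
  assumes "smooth \<phi>"
  shows "((\<lambda>y. \<phi> (y, t)) has_derivative (\<lambda>v. fderiv \<phi> (v, 0) (y, t))) (at y)"
  by (rule has_derivative_compose[OF _ smooth_has_derivative[OF assms], of "\<lambda>y. (y, t)" "\<lambda>v. (v, 0)"])
     (auto intro!: derivative_eq_intros)

lemma supported_slice: "supported R \<phi> \<Longrightarrow> supported R (\<lambda>y. \<phi> (y, t))"
  unfolding supported_def by (meson norm_fst_le less_le_trans)

lemma slice_continuous:
  assumes "continuous_on UNIV \<phi>" shows "continuous_on UNIV (\<lambda>y. \<phi> (y, t))"
  by (rule continuous_on_compose2[OF assms]) (auto intro: continuous_intros)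

lemma fourier_slice_fderiv:
  fixes \<phi> :: "'a::euclidean_space \<times> real \<Rightarrow> real"
  assumes \<phi>: "smooth \<phi>" "supported R \<phi>" and b: "norm b = 1"
  shows "fourier (\<lambda>y. fderiv \<phi> (b, 0) (y, t)) \<xi> = \<i> * complex_of_real (b \<bullet> \<xi>) * fourier (\<lambda>y. \<phi> (y, t)) \<xi>"
proof -
  have c: "continuous_on UNIV (fderiv \<phi> (b, 0))"
    by (rule smooth_continuous[OF smooth_fderiv[OF \<phi>(1)]])
  obtain B where "\<And>p. \<bar>fderiv \<phi> (b, 0) p\<bar> \<le> B"
    using supported_bounded[OF c supported_fderiv[OF \<phi>]] by metis
  then show ?thesis
    by (intro fourier_directional_derivative[OF smooth_slice_has_derivative[OF \<phi>(1)] supported_slice[OF \<phi>(2)] slice_continuous[OF c] _ b])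
qed

lemma fourier_slice_integrable:
  fixes \<phi> :: "'a::euclidean_space \<times> real \<Rightarrow> real"
  assumes \<phi>: "continuous_on UNIV \<phi>" "supported R \<phi>"
  obtains B where "\<And>t \<xi>. integrable lborel (\<lambda>y. cis (- (y \<bullet> \<xi>)) * complex_of_real (\<phi> (y, t)))"
    "\<And>t \<xi>. norm (fourier (\<lambda>y. \<phi> (y, t)) \<xi>) \<le> B"
proof -
  obtain B where B: "\<And>p. \<bar>\<phi> p\<bar> \<le> B" using supported_bounded[OF \<phi>] by metis
  have ib: "integrable lborel (\<lambda>y::'a. B * indicator (cball 0 R) y)"
    using emeasure_lborel_cball_finite[of "0::'a" R] by (intro integrable_mult_right integrable_real_indicator) auto
  have le: "norm (cis (- (y \<bullet> \<xi>)) * complex_of_real (\<phi> (y, t))) \<le> B * indicator (cball 0 R) y" for y \<xi> t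
    using B[of "(y, t)"] supported_slice[OF \<phi>(2), of t] unfolding supported_def
    by (cases "R < norm y") (auto simp: norm_mult indicator_def)
  have i: "integrable lborel (\<lambda>y. cis (- (y \<bullet> \<xi>)) * complex_of_real (\<phi> (y, t)))" for t \<xi>
  proof (rule Bochner_Integration.integrable_bound[OF ib])
    have [measurable]: "(\<lambda>y. \<phi> (y, t)) \<in> borel_measurable borel"
      by (intro borel_measurable_continuous_onI slice_continuous \<phi>)
    show "(\<lambda>y. cis (- (y \<bullet> \<xi>)) * complex_of_real (\<phi> (y, t))) \<in> borel_measurable lborel" by measurable
    show "AE y in lborel. norm (cis (- (y \<bullet> \<xi>)) * complex_of_real (\<phi> (y, t))) \<le> norm (B * indicator (cball 0 R) y)"
      using order_trans[OF le abs_ge_self] by (intro AE_I2) simp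
  qed
  have "norm (fourier (\<lambda>y. \<phi> (y, t)) \<xi>) \<le> (LINT y|lborel. B * indicator (cball (0::'a) R) y)" for t \<xi>
  proof -
    have "norm (fourier (\<lambda>y. \<phi> (y, t)) \<xi>) \<le> (LINT y|lborel. norm (cis (- (y \<bullet> \<xi>)) * complex_of_real (\<phi> (y, t))))"
      unfolding fourier_def by (rule integral_norm_bound)
    also have "\<dots> \<le> (LINT y|lborel. B * indicator (cball (0::'a) R) y)"
      by (intro integral_mono integrable_norm i ib le)
    finally show ?thesis .
  qed
  with i show ?thesis by (rule that)
qed

text \<open>Induction on \<open>k\<close>: passing from \<open>\<phi>\<close> to \<open>\<phi> - \<Delta>\<phi>\<close> multiplies the transform by \<open>1 + |\<xi>|\<^sup>2\<close>.\<close>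

lemma fourier_slice_decay:
  fixes \<phi> :: "'a::euclidean_space \<times> real \<Rightarrow> real"
  assumes "smooth \<phi>" "supported R \<phi>"
  shows "\<exists>C. \<forall>t \<xi>. norm (fourier (\<lambda>y. \<phi> (y, t)) \<xi>) * (1 + (norm \<xi>)\<^sup>2) ^ k \<le> C"
  using assms
proof (induction k arbitrary: \<phi>)
  case 0
  then show ?case
    using fourier_slice_integrable[OF smooth_continuous[OF 0(1)] 0(2)] by (metis mult_1_right power_0)
next
  case (Suc k)
  define d2 where "d2 b = fderiv (fderiv \<phi> (b, 0)) (b, 0)" for b :: 'a
  define \<psi> where "\<psi> p = \<phi> p - (\<Sum>b\<in>Basis. d2 b p)" for p
  have d2: "smooth (d2 b)" "supported R (d2 b)" for b
    unfolding d2_def by (intro smooth_fderiv supported_fderiv Suc.prems)+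
  have \<psi>: "smooth \<psi>" "supported R \<psi>"
    unfolding \<psi>_def using d2 Suc.prems by (auto intro!: smooth_diff smooth_sum simp: supported_def)
  have e: "fourier (\<lambda>y. \<psi> (y, t)) \<xi> = complex_of_real (1 + (norm \<xi>)\<^sup>2) * fourier (\<lambda>y. \<phi> (y, t)) \<xi>" for t \<xi>
  proof -
    have i: "integrable lborel (\<lambda>y. cis (- (y \<bullet> \<xi>)) * complex_of_real (d2 b (y, t)))" for b
      by (rule fourier_slice_integrable[OF smooth_continuous[OF d2(1)] d2(2)])
    have i0: "integrable lborel (\<lambda>y. cis (- (y \<bullet> \<xi>)) * complex_of_real (\<phi> (y, t)))"
      by (rule fourier_slice_integrable[OF smooth_continuous[OF Suc.prems(1)] Suc.prems(2)])
    have "fourier (\<lambda>y. \<psi> (y, t)) \<xi> = (LINT y|lborel. cis (- (y \<bullet> \<xi>)) * complex_of_real (\<phi> (y, t)) -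
       (\<Sum>b\<in>Basis. cis (- (y \<bullet> \<xi>)) * complex_of_real (d2 b (y, t))))"
      unfolding fourier_def \<psi>_def by (simp add: right_diff_distrib sum_distrib_left)
    also have "\<dots> = fourier (\<lambda>y. \<phi> (y, t)) \<xi> - (\<Sum>b\<in>Basis. fourier (\<lambda>y. d2 b (y, t)) \<xi>)"
      unfolding fourier_def
      by (subst Bochner_Integration.integral_diff[OF i0 Bochner_Integration.integrable_sum[OF i]],
          subst Bochner_Integration.integral_sum[OF i]) (rule refl)
    also have "(\<Sum>b\<in>Basis. fourier (\<lambda>y. d2 b (y, t)) \<xi>) = (\<Sum>b\<in>Basis. - complex_of_real ((\<xi> \<bullet> b)\<^sup>2) * fourier (\<lambda>y. \<phi> (y, t)) \<xi>)"
    proof (rule sum.cong[OF refl])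
      have ii: "\<i> * a * (\<i> * a * z) = - a\<^sup>2 * z" for a z
      proof -
        have "\<i> * a * (\<i> * a * z) = (\<i> * \<i>) * (a\<^sup>2 * z)" by (simp only: mult_ac power2_eq_square)
        then show ?thesis by simp
      qed
      fix b :: 'a assume "b \<in> Basis"
      then have b: "norm b = 1" by simp
      show "fourier (\<lambda>y. d2 b (y, t)) \<xi> = - complex_of_real ((\<xi> \<bullet> b)\<^sup>2) * fourier (\<lambda>y. \<phi> (y, t)) \<xi>"
        unfolding d2_def
          fourier_slice_fderiv[OF smooth_fderiv[OF Suc.prems(1)] supported_fderiv[OF Suc.prems] b]
          fourier_slice_fderiv[OF Suc.prems b]
        by (simp only: ii inner_commute[of b] of_real_power)
    qed
    also have "\<dots> = - complex_of_real (\<Sum>b\<in>Basis. (\<xi> \<bullet> b)\<^sup>2) * fourier (\<lambda>y. \<phi> (y, t)) \<xi>"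
      by (simp add: sum_distrib_right sum_negf)
    also have "(\<Sum>b\<in>Basis. (\<xi> \<bullet> b)\<^sup>2) = (norm \<xi>)\<^sup>2"
      using euclidean_inner[of \<xi> \<xi>] unfolding power2_norm_eq_inner by (simp add: power2_eq_square)
    finally show ?thesis by (simp add: algebra_simps)
  qed
  obtain C where C: "\<And>t \<xi>. norm (fourier (\<lambda>y. \<psi> (y, t)) \<xi>) * (1 + (norm \<xi>)\<^sup>2) ^ k \<le> C"
    using Suc.IH[OF \<psi>] by blast
  have n: "norm (complex_of_real (1 + (norm \<xi>)\<^sup>2)) = 1 + (norm \<xi>)\<^sup>2" for \<xi> :: 'a
    unfolding norm_of_real by (simp add: add_pos_nonneg)
  have "norm (fourier (\<lambda>y. \<phi> (y, t)) \<xi>) * (1 + (norm \<xi>)\<^sup>2) ^ Suc k =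
      norm (fourier (\<lambda>y. \<psi> (y, t)) \<xi>) * (1 + (norm \<xi>)\<^sup>2) ^ k" for t \<xi>
    unfolding e norm_mult n power_Suc by (simp only: mult_ac)
  then have "norm (fourier (\<lambda>y. \<phi> (y, t)) \<xi>) * (1 + (norm \<xi>)\<^sup>2) ^ Suc k \<le> C" for t \<xi>
    by (simp only: C)
  then show ?case by blast
qed

text \<open>All estimates are made for \<phi> on space-time and then restricted, which makes them
  independent of t: a spatial second difference is one in the direction (v, 0). As
  \<open>tame\<close> has a single constant, the largest of the four bounds is taken.\<close>

lemma slices_tame:
  fixes \<phi> :: "'a::euclidean_space \<times> real \<Rightarrow> real"
  assumes \<phi>: "smooth \<phi>" "supported R \<phi>"
  obtains M where "\<And>t. tame M (\<lambda>y. \<phi> (y, t))"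
proof -
  obtain B where B: "\<And>p. \<bar>\<phi> p\<bar> \<le> B" using supported_bounded[OF smooth_continuous[OF \<phi>(1)] \<phi>(2)] by metis
  obtain L where L: "\<And>p v. \<bar>\<phi> (p + v) + \<phi> (p - v) - 2 * \<phi> p\<bar> \<le> L * (norm v)\<^sup>2"
    using smooth_second_difference[OF \<phi>] by metis
  obtain C where C: "\<And>t \<xi>. norm (fourier (\<lambda>y. \<phi> (y, t)) \<xi>) * (1 + (norm \<xi>)\<^sup>2) ^ (DIM('a) + 1) \<le> C"
    using fourier_slice_decay[OF \<phi>] by blast
  define M where "M = Max {R, B, L, C}"
  have M: "R \<le> M" "B \<le> M" "L \<le> M" "C \<le> M" by (auto simp: M_def)
  have "tame M (\<lambda>y. \<phi> (y, t))" for t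
    unfolding tame_def
  proof (intro conjI allI impI)
    show "continuous_on UNIV (\<lambda>y. \<phi> (y, t))"
      by (intro slice_continuous smooth_continuous \<phi>)
    show "\<phi> (y, t) = 0" if "M < norm y" for y
      using that M(1) supported_slice[OF \<phi>(2), of t] by (auto simp: supported_def)
    show "\<bar>\<phi> (y, t)\<bar> \<le> M" for y using B M(2) by (rule order_trans)
    show "\<bar>\<phi> (y + v, t) + \<phi> (y - v, t) - 2 * \<phi> (y, t)\<bar> \<le> M * (norm v)\<^sup>2" for y v
    proof -
      have "\<bar>\<phi> (y + v, t) + \<phi> (y - v, t) - 2 * \<phi> (y, t)\<bar> \<le> L * (norm v)\<^sup>2"
        using L[of "(y, t)" "(v, 0)"] by (simp add: norm_Pair)
      also have "\<dots> \<le> M * (norm v)\<^sup>2" using M(3) by (intro mult_right_mono) auto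
      finally show ?thesis .
    qed
    show "norm (fourier (\<lambda>y. \<phi> (y, t)) \<xi>) * (1 + (norm \<xi>)\<^sup>2) ^ (DIM('a) + 1) \<le> M" for \<xi>
      using C M(4) by (rule order_trans)
  qed
  then show ?thesis by (rule that)
qed

subsection \<open>The weak formulation\<close>

lemma pair_integrableI:
  fixes F :: "'a::euclidean_space \<times> real \<Rightarrow> real"
  assumes [measurable]: "F \<in> borel_measurable borel"
    and le: "\<And>t. (\<integral>\<^sup>+x. ennreal \<bar>F (x, t)\<bar> \<partial>lborel) \<le> ennreal A * indicator {0..T} t"
  shows "integrable lborel F"
proof (rule integrableI_bounded)
  have m: "(\<lambda>p. ennreal (norm (F p))) \<in> borel_measurable (lborel \<Otimes>\<^sub>M lborel)"
    unfolding lborel_prod by measurable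
  have "(\<integral>\<^sup>+p. ennreal (norm (F p)) \<partial>lborel) = (\<integral>\<^sup>+t. \<integral>\<^sup>+x. ennreal (norm (F (x, t))) \<partial>lborel \<partial>lborel)"
    using lborel_pair.nn_integral_snd[OF m] unfolding lborel_prod by simp
  also have "\<dots> \<le> (\<integral>\<^sup>+t. ennreal A * indicator {0..T} t \<partial>lborel)"
    using le by (intro nn_integral_mono) simp
  also have "\<dots> < \<infinity>"
    by (subst nn_integral_cmult_indicator) (auto simp: ennreal_mult_less_top emeasure_lborel_Icc_eq)
  finally show "(\<integral>\<^sup>+p. ennreal (norm (F p)) \<partial>lborel) < \<infinity>" .
qed measurable

text \<open>A quantitative counterpart of \<open>norm_powr_times_integrable\<close>: the bound
  involves \<open>g\<close> only through \<open>B\<close>, so it can be integrated over a bounded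
  range of times.\<close>

lemma norm_powr_nn_integral_bound:
  fixes g :: "'a::euclidean_space \<Rightarrow> real"
  assumes a: "0 < a" "a < real DIM('a)"
    and [measurable]: "g \<in> borel_measurable borel"
    and g: "\<And>x. \<bar>g x\<bar> \<le> B" "(\<integral>\<^sup>+x. ennreal \<bar>g x\<bar> \<partial>lborel) \<le> ennreal B"
  shows "(\<integral>\<^sup>+x. ennreal (norm x powr (- a) * \<bar>g x\<bar>) \<partial>lborel)
    \<le> ennreal (B + B * exp 1 * (LINT x|lborel. norm (x :: 'a) powr (- a) * exp (- (norm x)\<^sup>2)))"
proof -
  have B: "B \<ge> 0" using g(1)[of 0] by linarith
  define E where "E x = (B * exp 1) * (norm x powr (- a) * exp (- (norm x)\<^sup>2))" for x :: 'a
  have E: "integrable lborel E" "\<And>x. E x \<ge> 0"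
    unfolding E_def using B by (auto intro!: integrable_mult_right norm_powr_gaussian_integrable a)
  have [measurable]: "E \<in> borel_measurable borel" using E(1) by auto
  have "(\<integral>\<^sup>+x. ennreal (norm x powr (- a) * \<bar>g x\<bar>) \<partial>lborel) \<le> (\<integral>\<^sup>+x. ennreal \<bar>g x\<bar> + ennreal (E x) \<partial>lborel)"
  proof (rule nn_integral_mono)
    fix x
    show "ennreal (norm x powr (- a) * \<bar>g x\<bar>) \<le> ennreal \<bar>g x\<bar> + ennreal (E x)"
      using ennreal_leI[OF norm_powr_split[OF a(1) g(1)[of x], of x]] E(2)[of x]
      unfolding E_def[symmetric] by simp
  qed
  also have "\<dots> = (\<integral>\<^sup>+x. ennreal \<bar>g x\<bar> \<partial>lborel) + ennreal (integral\<^sup>L lborel E)"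
    using E by (subst nn_integral_add) (auto simp: nn_integral_eq_integral)
  also have "\<dots> \<le> ennreal B + ennreal (integral\<^sup>L lborel E)"
    using g(2) by (rule add_right_mono)
  also have "\<dots> = ennreal (B + integral\<^sup>L lborel E)"
    using B E(2) by (simp add: ennreal_plus)
  finally show ?thesis unfolding E_def by (simp only: integral_mult_right_zero)
qed

text \<open>The integrand lives on a compact set that avoids both x = 0 and t = 0, where the weights
  are continuous. Hence the exponents are arbitrary, in particular below -N.\<close>

lemma weighted_integrable:
  fixes \<psi> :: "'a::euclidean_space \<times> real \<Rightarrow> real"
  assumes \<psi>: "continuous_on UNIV \<psi>" and \<delta>: "\<delta> > 0"
    and z: "\<And>x t. norm x < \<delta> \<or> t < \<delta> \<or> R < norm (x, t) \<Longrightarrow> \<psi> (x, t) = 0"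
  shows "integrable lborel (\<lambda>(x, t). indicator {0<..} t * t powr p * norm x powr q * \<psi> (x, t))"
proof -
  define K :: "('a \<times> real) set" where "K = {w. \<delta> \<le> norm (fst w)} \<inter> {w. \<delta> \<le> snd w} \<inter> cball 0 R"
  have "compact K"
    unfolding K_def by (intro closed_Int_compact compact_cball closed_Int closed_Collect_le continuous_intros)
  moreover have "continuous_on K (\<lambda>w. snd w powr p * norm (fst w) powr q * \<psi> w)"
    using \<delta> by (intro continuous_intros continuous_on_subset[OF \<psi>]) (auto simp: K_def)
  ultimately have "integrable lborel (\<lambda>w. indicator K w *\<^sub>R (snd w powr p * norm (fst w) powr q * \<psi> w))"
    by (rule borel_integrable_compact)
  also have "(\<lambda>w. indicator K w *\<^sub>R (snd w powr p * norm (fst w) powr q * \<psi> w)) =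
      (\<lambda>(x, t). indicator {0<..} t * t powr p * norm x powr q * \<psi> (x, t))"
  proof (rule ext, clarify)
    fix x :: 'a and t :: real
    show "indicator K (x, t) *\<^sub>R (snd (x, t) powr p * norm (fst (x, t)) powr q * \<psi> (x, t)) =
      indicator {0<..} t * t powr p * norm x powr q * \<psi> (x, t)"
    proof (cases "(x, t) \<in> K")
      case True
      then show ?thesis using \<delta> by (auto simp: K_def)
    next
      case False
      then have "\<psi> (x, t) = 0" by (intro z) (auto simp: K_def)
      then show ?thesis by simp
    qed
  qed
  finally show ?thesis .
qed

lemma smooth_time_derivative:
  fixes \<phi> :: "'a::euclidean_space \<times> real \<Rightarrow> real"
  assumes "smooth \<phi>"
  shows "((\<lambda>\<tau>. \<phi> (x, \<tau>)) has_real_derivative fderiv \<phi> (0, 1) (x, t)) (at t)"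
proof -
  have "((\<lambda>\<tau>. \<phi> (x, \<tau>)) has_derivative (\<lambda>s. fderiv \<phi> (0, s) (x, t))) (at t)"
    by (rule has_derivative_compose[OF _ smooth_has_derivative[OF assms], of "\<lambda>\<tau>. (x, \<tau>)" "\<lambda>s. (0, s)"])
       (auto intro!: derivative_eq_intros)
  moreover have "(\<lambda>s. fderiv \<phi> (0, s) (x, t)) = (*) (fderiv \<phi> (0, 1) (x, t))"
  proof
    fix s
    show "fderiv \<phi> (0, s) (x, t) = fderiv \<phi> (0, 1) (x, t) * s"
      using linear_scale[OF has_derivative_linear[OF smooth_has_derivative[OF assms]], of "(x, t)" s "(0, 1)"] by simp
  qed
  ultimately show ?thesis unfolding has_field_derivative_def by simp
qed

text \<open>For fixed x the two integrands combine into |x|^q times the t-derivative of t^\<alpha>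
  \<phi>(x,t), whose integral is zero. Fubini is applied to this combination, with the t-integral
  inside.\<close>

lemma time_integration_by_parts:
  fixes \<phi> :: "'a::euclidean_space \<times> real \<Rightarrow> real"
  assumes \<phi>: "smooth \<phi>" and \<delta>: "\<delta> > 0"
    and z: "\<And>x t. norm x < \<delta> \<or> t < \<delta> \<or> R < norm (x, t) \<Longrightarrow> \<phi> (x, t) = 0"
    and z': "\<And>x t. norm x < \<delta> \<or> t < \<delta> \<or> R < norm (x, t) \<Longrightarrow> fderiv \<phi> (0, 1) (x, t) = 0"
  shows "(LINT p|lborel. (case p of (x, t) \<Rightarrow> indicator {0<..} t * t powr \<alpha> * norm x powr q * fderiv \<phi> (0, 1) (x, t)))
    = - \<alpha> * (LINT p|lborel. (case p of (x, t) \<Rightarrow> indicator {0<..} t * t powr (\<alpha> - 1) * norm x powr q * \<phi> (x, t)))"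
    (is "integral\<^sup>L _ ?G1 = - \<alpha> * integral\<^sup>L _ ?G2")
proof -
  have c: "continuous_on UNIV \<phi>" "continuous_on UNIV (fderiv \<phi> (0, 1))"
    by (intro smooth_continuous smooth_fderiv \<phi>)+
  have i1: "integrable lborel ?G1" by (rule weighted_integrable[OF c(2) \<delta> z'])
  have i2: "integrable lborel ?G2" by (rule weighted_integrable[OF c(1) \<delta> z])
  define H where "H x t = ?G1 (x, t) + \<alpha> * ?G2 (x, t)" for x t
  have H_eq: "case_prod H = (\<lambda>p. ?G1 p + \<alpha> * ?G2 p)" by (auto simp: H_def fun_eq_iff)
  have iH: "integrable lborel (case_prod H)"
    unfolding H_eq by (intro Bochner_Integration.integrable_add i1 integrable_mult_right i2)
  have H0: "(LINT t|lborel. H x t) = 0" for x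
  proof -
    \<comment> \<open>A time beyond the support of \<phi>, and large enough to lie to the right of
      \<delta>/2.\<close>
    define T where "T = max \<delta> R + 1"
    define h where "h t = t powr \<alpha> * fderiv \<phi> (0, 1) (x, t) + \<alpha> * t powr (\<alpha> - 1) * \<phi> (x, t)" for t
    have T: "\<delta> / 2 \<le> T" "T > 0" "R < T" using \<delta> by (auto simp: T_def)
    have big: "R < norm (x, t)" if "t \<ge> T" for t
      using norm_snd_le[where x=x and y=t] that T by simp
    \<comment> \<open>The interval starts at \<delta>/2 because \<phi> is known to vanish only for t
      strictly below \<delta>; the boundary term is then zero, and t stays away from the singularity
      of the power.\<close>
    have "(LINT t|lborel. indicator {\<delta> / 2..T} t *\<^sub>R h t) = T powr \<alpha> * \<phi> (x, T) - (\<delta> / 2) powr \<alpha> * \<phi> (x, \<delta> / 2)"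
    proof (rule integral_FTC_atLeastAtMost[OF T(1)])
      fix t assume t: "\<delta> / 2 \<le> t" "t \<le> T"
      have "((\<lambda>t. t powr \<alpha> * \<phi> (x, t)) has_real_derivative h t) (at t)"
        using t \<delta> unfolding h_def by (auto intro!: derivative_eq_intros smooth_time_derivative[OF \<phi>])
      then show "((\<lambda>t. t powr \<alpha> * \<phi> (x, t)) has_vector_derivative h t) (at t within {\<delta> / 2..T})"
        unfolding has_real_derivative_iff_has_vector_derivative by (rule has_vector_derivative_at_within)
    next
      show "continuous_on {\<delta> / 2..T} h"
        unfolding h_def using \<delta>
        by (intro continuous_intros continuous_on_compose2[OF c(1)] continuous_on_compose2[OF c(2)]) auto
    qed
    also have "\<dots> = 0" using z \<delta> big[of T] by simp
    also have "(\<lambda>t. indicator {\<delta> / 2..T} t *\<^sub>R h t) = (\<lambda>t. indicator {0<..} t * h t)"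
    proof
      fix t
      have "h t = 0" if "t < \<delta> / 2 \<or> t > T"
      proof -
        have "t < \<delta> \<or> R < norm (x, t)" using that \<delta> big[of t] by auto
        then show ?thesis using z z' unfolding h_def by simp
      qed
      then show "indicator {\<delta> / 2..T} t *\<^sub>R h t = indicator {0<..} t * h t"
        using \<delta> by (cases "t < \<delta> / 2 \<or> t > T") (auto simp: indicator_def)
    qed
    finally have "(LINT t|lborel. indicator {0<..} t * h t) = 0" .
    moreover have "H x t = norm x powr q * (indicator {0<..} t * h t)" for t
      by (simp add: H_def h_def algebra_simps)
    ultimately show ?thesis by simp
  qed
  have "(LINT x|lborel. LINT t|lborel. H x t) = integral\<^sup>L (lborel \<Otimes>\<^sub>M lborel) (\<lambda>(x, t). H x t)"
    by (rule lborel_pair.integral_fst) (use iH in \<open>simp add: lborel_prod\<close>)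
  then have "integral\<^sup>L lborel (case_prod H) = 0"
    by (simp add: H0 lborel_prod)
  moreover have "integral\<^sup>L lborel (case_prod H) = integral\<^sup>L lborel ?G1 + \<alpha> * integral\<^sup>L lborel ?G2"
    unfolding H_eq by (subst Bochner_Integration.integral_add[OF i1 integrable_mult_right[OF i2]]) simp
  ultimately show ?thesis by simp
qed

text \<open>On the compact closure of the nonzero set the continuous function min (|x|, t) is
  positive and attains its minimum. That minimum serves as \<delta> for the distance from the axis x
  = 0 and from the initial time alike.\<close>

lemma test_fun_vanishing:
  fixes \<phi> :: "'a::euclidean_space \<times> real \<Rightarrow> real"
  assumes "test_fun \<phi>"
  obtains \<delta> R where "\<delta> > 0" "\<And>x t. norm x < \<delta> \<or> t < \<delta> \<or> R < norm (x, t) \<Longrightarrow> \<phi> (x, t) = 0"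
proof -
  define S where "S = closure {p. \<phi> p \<noteq> 0}"
  have S: "compact S" "S \<subseteq> (UNIV - {0}) \<times> {0<..}"
    using assms unfolding test_fun_def S_def by auto
  have out: "\<phi> p = 0" if "p \<notin> S" for p
    using that closure_subset[of "{p. \<phi> p \<noteq> 0}"] unfolding S_def by auto
  obtain R where R: "\<And>p. p \<in> S \<Longrightarrow> norm p \<le> R"
    using compact_imp_bounded[OF S(1)] unfolding bounded_iff by auto
  obtain \<delta> where \<delta>: "\<delta> > 0" "\<And>p. p \<in> S \<Longrightarrow> \<delta> \<le> norm (fst p) \<and> \<delta> \<le> snd p"
  proof (cases "S = {}")
    case True
    then show ?thesis using that[of 1] by auto
  next
    case False
    have "continuous_on S (\<lambda>p. min (norm (fst p)) (snd p))" by (intro continuous_intros)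
    from continuous_attains_inf[OF S(1) False this]
    obtain p0 where p0: "p0 \<in> S" "\<forall>p\<in>S. min (norm (fst p0)) (snd p0) \<le> min (norm (fst p)) (snd p)"
      by blast
    have "min (norm (fst p0)) (snd p0) > 0" using p0(1) S(2) by auto
    moreover have "min (norm (fst p0)) (snd p0) \<le> norm (fst p) \<and> min (norm (fst p0)) (snd p0) \<le> snd p" if "p \<in> S" for p
      using bspec[OF p0(2) that] by (simp only: min.bounded_iff[of _ "norm (fst p)"])
    ultimately show ?thesis by (rule that)
  qed
  show ?thesis
  proof (rule that[OF \<delta>(1)])
    fix x :: 'a and t :: real assume "norm x < \<delta> \<or> t < \<delta> \<or> R < norm (x, t)"
    then have "(x, t) \<notin> S" using R[of "(x, t)"] \<delta>(2)[of "(x, t)"] by auto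
    then show "\<phi> (x, t) = 0" by (rule out)
  qed
qed

text \<open>The operator is nonlocal: the fractional Laplacian of a slice need not vanish near the
  origin or for large x, so \<open>weighted_integrable\<close> does not apply to it. Integrability
  in x comes from the L^1 and sup bounds, uniform in t. In time the support stays bounded, since a
  slice with t > R is identically zero.\<close>

lemma weighted_frac_lap:
  fixes \<phi> :: "'a::euclidean_space \<times> real \<Rightarrow> real"
  assumes \<phi>: "smooth \<phi>" and \<delta>: "\<delta> > 0"
    and z: "\<And>x t. norm x < \<delta> \<or> t < \<delta> \<or> R < norm (x, t) \<Longrightarrow> \<phi> (x, t) = 0"
    and s: "0 < s" "s < 1" and a: "0 < a" "a < real DIM('a)" "real DIM('a) < a + 2 * s" and p: "p \<ge> 0"
  shows "integrable lborel (\<lambda>(x, t). indicator {0<..} t * t powr p * norm x powr (- a) * frac_lap s (\<lambda>y. \<phi> (y, t)) x)"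
    (is "integrable _ ?G3")
    and "(LINT w|lborel. (case w of (x, t) \<Rightarrow> indicator {0<..} t * t powr p * norm x powr (- a) * frac_lap s (\<lambda>y. \<phi> (y, t)) x))
      = kconst DIM('a) s a * (LINT w|lborel. (case w of (x, t) \<Rightarrow> indicator {0<..} t * t powr p * norm x powr (- (a + 2 * s)) * \<phi> (x, t)))"
proof -
  have sup: "supported R \<phi>" unfolding supported_def using z by auto
  obtain M where M: "\<And>t. tame M (\<lambda>y. \<phi> (y, t))" using slices_tame[OF \<phi> sup] by metis
  have [measurable]: "\<phi> \<in> borel_measurable borel"
    by (intro borel_measurable_continuous_onI smooth_continuous \<phi>)
  have \<phi>_pair [measurable]: "\<phi> \<in> borel_measurable (borel \<Otimes>\<^sub>M borel)"
    unfolding borel_prod by measurable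
  have [measurable]: "?G3 \<in> borel_measurable borel"
    unfolding borel_prod[symmetric] by measurable
  define B where "B = max (M * (LINT x|lborel. 1 / (1 + (norm (x::'a))\<^sup>2) ^ DIM('a)))
    (64 * M * measure lborel (cball (0::'a) (M + 1)) * 2 powr (real DIM('a) / 2))"
  define A where "A = B + B * exp 1 * (LINT x|lborel. norm (x :: 'a) powr (- a) * exp (- (norm x)\<^sup>2))"
  show i3: "integrable lborel ?G3"
  proof (rule pair_integrableI)
    fix t
    show "(\<integral>\<^sup>+x. ennreal \<bar>?G3 (x, t)\<bar> \<partial>lborel) \<le> ennreal (R powr p * A) * indicator {0..R} t"
    proof (cases "t \<in> {0..R}")
      case True
      have m: "frac_lap s (\<lambda>y. \<phi> (y, t)) \<in> borel_measurable borel" by measurable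
      have "(\<integral>\<^sup>+x. ennreal \<bar>?G3 (x, t)\<bar> \<partial>lborel) \<le> (\<integral>\<^sup>+x. ennreal (R powr p) * ennreal (norm x powr (- a) * \<bar>frac_lap s (\<lambda>y. \<phi> (y, t)) x\<bar>) \<partial>lborel)"
      proof (rule nn_integral_mono)
        fix x
        have "indicator {0<..} t * t powr p \<le> R powr p"
          using True p by (auto simp: indicator_def intro: powr_mono2)
        then have "(indicator {0<..} t * t powr p) * (norm x powr (- a) * \<bar>frac_lap s (\<lambda>y. \<phi> (y, t)) x\<bar>) \<le> R powr p * (norm x powr (- a) * \<bar>frac_lap s (\<lambda>y. \<phi> (y, t)) x\<bar>)"
          by (rule mult_right_mono) simp
        then show "ennreal \<bar>?G3 (x, t)\<bar> \<le> ennreal (R powr p) * ennreal (norm x powr (- a) * \<bar>frac_lap s (\<lambda>y. \<phi> (y, t)) x\<bar>)"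
          by (subst ennreal_mult'[symmetric]) (auto simp: abs_mult mult.assoc intro!: ennreal_leI)
      qed
      also have "\<dots> = ennreal (R powr p) * (\<integral>\<^sup>+x. ennreal (norm x powr (- a) * \<bar>frac_lap s (\<lambda>y. \<phi> (y, t)) x\<bar>) \<partial>lborel)"
        using m by (intro nn_integral_cmult) measurable
      also have "\<dots> \<le> ennreal (R powr p) * ennreal A"
      proof (rule mult_left_mono, unfold A_def, rule norm_powr_nn_integral_bound[OF a(1,2) m])
        show "\<bar>frac_lap s (\<lambda>y. \<phi> (y, t)) x\<bar> \<le> B" for x
          unfolding B_def using frac_lap_bounded[OF M, of s t x] s by (intro max.coboundedI1) auto
        show "(\<integral>\<^sup>+x. ennreal \<bar>frac_lap s (\<lambda>y. \<phi> (y, t)) x\<bar> \<partial>lborel) \<le> ennreal B"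
          by (rule order_trans[OF frac_lap_L1[OF M s]]) (auto simp: B_def intro: ennreal_leI)
      qed auto
      finally show ?thesis using True by (simp add: ennreal_mult')
    next
      case False
      have "?G3 (x, t) = 0" for x
      proof (cases "t > 0")
        case True
        then have "\<bar>t\<bar> > R" using False by auto
        then have "R < norm (y, t)" for y :: 'a
          using norm_snd_le[where x=y and y=t] by simp
        then have "(\<lambda>y. \<phi> (y, t)) = (\<lambda>y. 0)"
          using z by blast
        moreover have "frac_lap s (\<lambda>y :: 'a. 0) x = 0"
          by (simp add: frac_lap_def fourier_def)
        ultimately show ?thesis by (simp only: prod.case mult_zero_right)
      qed simp
      then show ?thesis by (simp only: abs_zero ennreal_0) simp
    qed
  qed measurable
  let ?G2 = "\<lambda>(x, t). indicator {0<..} t * t powr p * norm x powr (- (a + 2 * s)) * \<phi> (x, t)"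
  have i2: "integrable lborel ?G2"
    by (rule weighted_integrable[OF smooth_continuous[OF \<phi>] \<delta> z])
  have "integral\<^sup>L lborel ?G3 = (LINT t|lborel. LINT x|lborel. ?G3 (x, t))"
    using lborel_pair.integral_snd[of "\<lambda>x t. ?G3 (x, t)"] i3 by (simp add: lborel_prod case_prod_beta')
  also have "\<dots> = (LINT t|lborel. kconst DIM('a) s a * (LINT x|lborel. ?G2 (x, t)))"
  proof (rule Bochner_Integration.integral_cong[OF refl])
    fix t :: real
    have "(LINT x|lborel. ?G3 (x, t)) = indicator {0<..} t * t powr p * (LINT x|lborel. norm x powr (- a) * frac_lap s (\<lambda>y. \<phi> (y, t)) x)"
      unfolding prod.case mult.assoc by (simp only: integral_mult_right_zero)
    also have "\<dots> = kconst DIM('a) s a * (indicator {0<..} t * t powr p * (LINT x|lborel. norm x powr (- (a + 2 * s)) * \<phi> (x, t)))"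
      using frac_lap_norm_powr[OF M \<delta> _ s a, of t] z by simp
    also have "indicator {0<..} t * t powr p * (LINT x|lborel. norm x powr (- (a + 2 * s)) * \<phi> (x, t)) = (LINT x|lborel. ?G2 (x, t))"
      unfolding prod.case mult.assoc by (simp only: integral_mult_right_zero)
    finally show "(LINT x|lborel. ?G3 (x, t)) = kconst DIM('a) s a * (LINT x|lborel. ?G2 (x, t))" .
  qed
  also have "\<dots> = kconst DIM('a) s a * integral\<^sup>L lborel ?G2"
    using lborel_pair.integral_snd[of "\<lambda>x t. ?G2 (x, t)"] i2 by (simp add: lborel_prod case_prod_beta')
  finally show "integral\<^sup>L lborel ?G3 = kconst DIM('a) s a * integral\<^sup>L lborel ?G2" .
qed

text \<open>With \<alpha> = 1/(1-m) and b = a + 2s = 2s/(1-m) one has \<alpha> m = \<alpha> - 1 and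
  b m = a. Integration by parts in time and the identity for the fractional Laplacian therefore lead
  to the same integral of t^(\<alpha>-1) |x|^(-b) \<phi>, with total coefficient -(C \<alpha> + C^m
  k(a)).\<close>

lemma gen_weak_solution_powr:
  fixes s m C :: real
  assumes s: "0 < s" "s < 1" and m: "0 < m" "m < 1"
    and a_def: "a = 2 * s * m / (1 - m)" and a: "a < real DIM('a::euclidean_space)" "real DIM('a) < a + 2 * s"
    and C: "C > 0" "C powr (1 - m) = (1 - m) * (- kconst DIM('a) s a)"
  shows "gen_weak_solution s m (\<lambda>(x :: 'a) t. C * t powr (1 / (1 - m)) * norm x powr (- 2 * s / (1 - m)))"
proof -
  define \<alpha> where "\<alpha> = 1 / (1 - m)"
  define b where "b = a + 2 * s"
  define u where "u x t = C * t powr \<alpha> * norm x powr (- b)" for x :: 'a and t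
  have a0: "a > 0" using s m by (simp add: a_def)
  have b: "b = 2 * s / (1 - m)" using m by (simp add: b_def a_def field_simps)
  have \<alpha>: "\<alpha> * m = \<alpha> - 1" "\<alpha> > 1" "b * m = a" using m by (simp_all add: \<alpha>_def b a_def field_simps)
  have u_eq: "(\<lambda>(x :: 'a) t. C * t powr (1 / (1 - m)) * norm x powr (- 2 * s / (1 - m))) = u"
    by (simp add: u_def \<alpha>_def b fun_eq_iff)
  have um: "u x t powr m = C powr m * t powr (\<alpha> - 1) * norm x powr (- a)" for x t
    using C by (simp add: u_def powr_mult powr_powr \<alpha>)
  \<comment> \<open>The defining equation of C multiplied by C^m; this is the balance that makes the
    total coefficient zero.\<close>
  have k: "C * \<alpha> = - (C powr m * kconst DIM('a) s a)"
  proof -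
    have "C = C powr (m + (1 - m))" using C(1) by simp
    also have "\<dots> = C powr m * C powr (1 - m)" by (rule powr_add)
    also have "\<dots> = (1 - m) * - (C powr m * kconst DIM('a) s a)" by (simp add: C(2))
    finally have "C = (1 - m) * - (C powr m * kconst DIM('a) s a)" .
    then show ?thesis using m by (simp add: \<alpha>_def field_simps)
  qed
  show ?thesis
    unfolding u_eq gen_weak_solution_def
  proof (intro conjI allI impI)
    show "0 \<le> u x t" for x t using C by (simp add: u_def)
  next
    \<comment> \<open>Here the compact set may meet x = 0, and a < N makes |x|^(-a) integrable
      across it.\<close>
    show "locally_integrable_on (\<lambda>(x, t). u x t powr m) (UNIV \<times> {0<..})"
      unfolding locally_integrable_on_def
    proof (intro allI impI)
      fix K :: "('a \<times> real) set" assume K: "compact K \<and> K \<subseteq> UNIV \<times> {0<..}"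
      then obtain R where R: "\<And>p. p \<in> K \<Longrightarrow> norm p \<le> R" using compact_imp_bounded bounded_iff by metis
      have [measurable]: "K \<in> sets borel" using K by (auto intro: borel_compact)
      \<comment> \<open>\<open>norm_powr_nn_integral_bound\<close> takes one constant both for the
        supremum of the indicator, which is at most 1, and for its integral, the volume of the
        ball.\<close>
      define B where "B = max 1 (measure lborel (cball (0::'a) R))"
      define A where "A = B + B * exp 1 * (LINT x|lborel. norm (x :: 'a) powr (- a) * exp (- (norm x)\<^sup>2))"
      define g where "g x = (indicator (cball 0 R) x :: real)" for x :: 'a
      have g_meas [measurable]: "g \<in> borel_measurable borel"
        unfolding g_def by (intro borel_measurable_indicator) auto
      have gA: "(\<integral>\<^sup>+x. ennreal (norm x powr (- a) * \<bar>g x\<bar>) \<partial>lborel) \<le> ennreal A"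
      unfolding A_def
      proof (rule norm_powr_nn_integral_bound[OF a0 a(1)])
        show "g \<in> borel_measurable borel" by (rule g_meas)
        show "\<bar>g x\<bar> \<le> B" for x by (auto simp: g_def B_def indicator_def)
        have "(\<integral>\<^sup>+x. ennreal \<bar>g x\<bar> \<partial>lborel) = (\<integral>\<^sup>+x. indicator (cball (0::'a) R) x \<partial>lborel)"
          by (intro nn_integral_cong) (auto simp: g_def indicator_def)
        also have "\<dots> = emeasure lborel (cball (0::'a) R)"
          by (rule nn_integral_indicator) auto
        also have "\<dots> = ennreal (measure lborel (cball (0::'a) R))"
          using emeasure_lborel_cball_finite[of "0::'a" R] by (intro emeasure_eq_ennreal_measure) auto
        finally show "(\<integral>\<^sup>+x. ennreal \<bar>g x\<bar> \<partial>lborel) \<le> ennreal B"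
          by (simp add: B_def ennreal_leI)
      qed
      define F where "F p = indicator K p *\<^sub>R (case p of (x, t) \<Rightarrow> u x t powr m)" for p
      have "(\<lambda>(x, t). u x t powr m) \<in> borel_measurable (borel \<Otimes>\<^sub>M borel)" unfolding u_def by measurable
      then have [measurable]: "F \<in> borel_measurable borel" unfolding F_def borel_prod by measurable
      have "integrable lborel F"
      proof (rule pair_integrableI)
        fix t :: real
        show "(\<integral>\<^sup>+x. ennreal \<bar>F (x, t)\<bar> \<partial>lborel) \<le> ennreal (C powr m * R powr (\<alpha> - 1) * A) * indicator {0..R} t"
        proof (cases "t \<in> {0..R}")
          case True
          have "(\<integral>\<^sup>+x. ennreal \<bar>F (x, t)\<bar> \<partial>lborel) \<le> (\<integral>\<^sup>+x. ennreal (C powr m * R powr (\<alpha> - 1)) * ennreal (norm x powr (- a) * \<bar>g x\<bar>) \<partial>lborel)"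
          proof (rule nn_integral_mono)
            fix x
            have "\<bar>F (x, t)\<bar> \<le> C powr m * R powr (\<alpha> - 1) * (norm x powr (- a) * \<bar>g x\<bar>)"
            proof (cases "(x, t) \<in> K")
              case inK: True
              have "norm x \<le> R" using R[OF inK] norm_fst_le[where x=x and y=t] by simp
              then have "g x = 1" by (simp add: g_def)
              moreover have "t powr (\<alpha> - 1) \<le> R powr (\<alpha> - 1)" using True \<alpha> by (intro powr_mono2) auto
              ultimately show ?thesis using inK by (auto simp: F_def um abs_mult intro!: mult_mono)
            qed (simp add: F_def)
            then show "ennreal \<bar>F (x, t)\<bar> \<le> ennreal (C powr m * R powr (\<alpha> - 1)) * ennreal (norm x powr (- a) * \<bar>g x\<bar>)"
              by (subst ennreal_mult'[symmetric]) (auto intro: ennreal_leI)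
          qed
          also have "\<dots> = ennreal (C powr m * R powr (\<alpha> - 1)) * (\<integral>\<^sup>+x. ennreal (norm x powr (- a) * \<bar>g x\<bar>) \<partial>lborel)"
            by (rule nn_integral_cmult) measurable
          also have "\<dots> \<le> ennreal (C powr m * R powr (\<alpha> - 1)) * ennreal A"
            by (intro mult_left_mono gA) auto
          finally show ?thesis using True by (simp add: ennreal_mult')
        next
          case False
          have "(x, t) \<notin> K" for x
            using False K R[of "(x, t)"] norm_snd_le[where x=x and y=t] by auto
          then show ?thesis by (simp add: F_def)
        qed
      qed measurable
      then show "set_integrable lborel K (\<lambda>(x, t). u x t powr m)"
        unfolding set_integrable_def F_def .
    qed
  next
    \<comment> \<open>Since b > N, the singularity of u at x = 0 is not integrable; away from it u
      is continuous.\<close>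
    show "locally_integrable_on (\<lambda>(x, t). u x t) ((UNIV - {0}) \<times> {0<..})"
      unfolding locally_integrable_on_def
    proof (intro allI impI)
      fix K :: "('a \<times> real) set" assume K: "compact K \<and> K \<subseteq> (UNIV - {0}) \<times> {0<..}"
      have "continuous_on K (\<lambda>p. C * snd p powr \<alpha> * norm (fst p) powr (- b))"
        using K by (intro continuous_intros) auto
      then show "set_integrable lborel K (\<lambda>(x, t). u x t)"
        unfolding set_integrable_def u_def case_prod_beta using K by (intro borel_integrable_compact) auto
    qed
  next
    fix \<phi> :: "'a \<times> real \<Rightarrow> real" assume T: "test_fun \<phi>"
    then have \<phi>: "smooth \<phi>" by (simp add: test_fun_def)
    obtain \<delta> R where \<delta>: "\<delta> > 0" and z: "\<And>x t. norm x < \<delta> \<or> t < \<delta> \<or> R < norm (x, t) \<Longrightarrow> \<phi> (x, t) = 0"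
      using test_fun_vanishing[OF T] by metis
    \<comment> \<open>All three inequalities are strict, so the region where \<phi> is known to
      vanish is open and its derivative vanishes there as well.\<close>
    have z': "fderiv \<phi> (0, 1) (x, t) = 0" if "norm x < \<delta> \<or> t < \<delta> \<or> R < norm (x, t)" for x t
    proof (rule fderiv_eq_0[OF \<phi>])
      show "open ({p :: 'a \<times> real. norm (fst p) < \<delta>} \<union> {p. snd p < \<delta>} \<union> {p. R < norm p})"
        by (intro open_Un open_Collect_less continuous_intros)
    qed (use that z in auto)
    let ?G1 = "\<lambda>(x :: 'a, t). indicator {0<..} t * t powr \<alpha> * norm x powr (- b) * fderiv \<phi> (0, 1) (x, t)"
    let ?G2 = "\<lambda>(x :: 'a, t). indicator {0<..} t * t powr (\<alpha> - 1) * norm x powr (- b) * \<phi> (x, t)"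
    let ?G3 = "\<lambda>(x :: 'a, t). indicator {0<..} t * t powr (\<alpha> - 1) * norm x powr (- a) * frac_lap s (\<lambda>y. \<phi> (y, t)) x"
    have i1: "integrable lborel ?G1"
      by (rule weighted_integrable[OF smooth_continuous[OF smooth_fderiv[OF \<phi>]] \<delta> z'])
    have i3: "integrable lborel ?G3"
      using \<alpha> by (intro weighted_frac_lap(1)[OF \<phi> \<delta> z s a0 a]) auto
    have I1: "integral\<^sup>L lborel ?G1 = - \<alpha> * integral\<^sup>L lborel ?G2"
      by (rule time_integration_by_parts[OF \<phi> \<delta> z z'])
    have I3: "integral\<^sup>L lborel ?G3 = kconst DIM('a) s a * integral\<^sup>L lborel ?G2"
      unfolding b_def using \<alpha> by (intro weighted_frac_lap(2)[OF \<phi> \<delta> z s a0 a]) auto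
    define g where "g = (\<lambda>(x, t). u x t * deriv (\<lambda>\<tau>. \<phi> (x, \<tau>)) t - u x t powr m * frac_lap s (\<lambda>y. \<phi> (y, t)) x)"
    have g: "(\<lambda>p. indicator (UNIV \<times> {0<..}) p *\<^sub>R g p) = (\<lambda>p. C * ?G1 p - C powr m * ?G3 p)"
    proof
      fix p :: "'a \<times> real"
      obtain x t where p: "p = (x, t)" by fastforce
      have "deriv (\<lambda>\<tau>. \<phi> (x, \<tau>)) t = fderiv \<phi> (0, 1) (x, t)"
        by (rule DERIV_imp_deriv[OF smooth_time_derivative[OF \<phi>]])
      then show "indicator (UNIV \<times> {0<..}) p *\<^sub>R g p = C * ?G1 p - C powr m * ?G3 p"
        unfolding p by (cases "t > 0") (auto simp: g_def um, simp add: u_def)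
    qed
    have "set_integrable lborel (UNIV \<times> {0<..}) g"
      unfolding set_integrable_def g by (intro Bochner_Integration.integrable_diff integrable_mult_right i1 i3)
    moreover have "(LINT p:UNIV \<times> {0<..}|lborel. g p) = C * integral\<^sup>L lborel ?G1 - C powr m * integral\<^sup>L lborel ?G3"
      unfolding set_lebesgue_integral_def g
      by (subst Bochner_Integration.integral_diff[OF integrable_mult_right[OF i1] integrable_mult_right[OF i3]])
         (simp only: integral_mult_right_zero)
    moreover have "C * integral\<^sup>L lborel ?G1 - C powr m * integral\<^sup>L lborel ?G3 = - (C * \<alpha> + C powr m * kconst DIM('a) s a) * integral\<^sup>L lborel ?G2"
    proof -
      have "C * (- \<alpha> * I) - X * (\<kappa> * I) = - (C * \<alpha> + X * \<kappa>) * I" for I X \<kappa> :: real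
        by (simp add: algebra_simps)
      then show ?thesis unfolding I1 I3 .
    qed
    ultimately show "let g = (\<lambda>(x, t). u x t * deriv (\<lambda>\<tau>. \<phi> (x, \<tau>)) t - u x t powr m * frac_lap s (\<lambda>y. \<phi> (y, t)) x)
         in set_integrable lborel (UNIV \<times> {0<..}) g \<and> (LINT p:UNIV \<times> {0<..}|lborel. g p) = 0"
      unfolding g_def[symmetric] Let_def by (simp add: k)
  qed
qed

text \<open>The bounds on m translate into those on a = 2sm/(1-m): a < N means m (N + 2s) < N, and,
  because a + 2s = 2s/(1-m), N < a + 2s means N - 2s < m N. The maximum with 0 secures m > 0 also
  when N \<le> 2s.\<close>

theorem theorem13p1:
  fixes s m C :: real
  assumes "0 < s" "s < 1"
    and "max ((real CARD('n) - 2 * s) / real CARD('n)) 0 < m"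
    and "m < real CARD('n) / (real CARD('n) + 2 * s)"
    and "C > 0"
    and "C powr (1 - m) = (1 - m) * (- kconst CARD('n) s (2 * s * m / (1 - m)))"
  shows "gen_weak_solution s m
           (\<lambda>(x :: real ^ 'n) t. C * t powr (1 / (1 - m)) * norm x powr (- 2 * s / (1 - m)))"
proof (rule gen_weak_solution_powr)
  define N where "N = real CARD('n)"
  have N: "N > 0" by (simp add: N_def)
  have m: "m > 0" "(N - 2 * s) < m * N" "m * (N + 2 * s) < N"
    using assms(1,3,4) N unfolding N_def[symmetric] by (auto simp: field_simps)
  have "m * N < N" using m mult_pos_pos[OF m(1) assms(1)] by (simp add: algebra_simps)
  then show m1: "m < 1" using N by simp
  show "0 < m" by fact
  show "2 * s * m / (1 - m) < real DIM(real ^ 'n)"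
    using m m1 by (simp add: N_def[symmetric] field_simps)
  have "2 * s * m / (1 - m) + 2 * s = 2 * s / (1 - m)" using m1 by (simp add: field_simps)
  then show "real DIM(real ^ 'n) < 2 * s * m / (1 - m) + 2 * s"
    using m m1 by (simp add: N_def[symmetric] field_simps)
qed (use assms in auto)

end
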